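(* Let $G$ be a Lie group with $\dim G=n\ge2$, and let $E=E_{H,F}$ be a Courant algebroid of type $B_n$ over $G$ with left-invariant $H$ and $F$. Given a left-invariant generalized metric $E_-$ on $E$ and a left-invariant divergence operator $\delta\in\tilde E^*$, there is a left-invariant Levi-Civita generalized connection $D$ of $E_-$ such that $\delta^D=\delta$.
   Context: Let $G$ have Lie algebra $\mathfrak{g}$ (left-invariant vector fields) and let $H\in\Omega^3(G)$, $F\in\Omega^2(G)$ be left-invariant with $dF=0$ and $dH+F\wedge F=0$. $E_{H,F}$ is the bundle $TG\oplus T^*G\oplus\mathbb{R}$ with anchor $\pi$ the projection to $TG$, scalar product $\langle X+\xi+\lambda,Y+\eta+\mu\rangle=\frac12(\xi(Y)+\eta(X))+\lambda\mu$ and Dorfman bracket $$[X+\xi+\lambda,Y+\eta+\mu]_{H,F}=\mathcal{L}_X(Y+\eta)-i_Yd\xi+2\mu\,d\lambda+i_Xi_YH-2(\mu\, i_XF-\lambda\, i_YF)+X(\mu)-Y(\lambda)+F(X,Y).$$ $G$ acts on $E$ by $x(X_y+\alpha_y+\lambda_y)=(d_yL_x)X_y+\alpha_y\circ(d_yL_x)^{-1}+\lambda_y$; left-invariant sections form $\tilde E=\mathfrak{g}\oplus\mathfrak{g}^*\oplus\mathbb{R}$. A generalized metric is a subbundle $E_-\subset E$ with $\langle\cdot,\cdot\rangle|_{E_-}$ non-degenerate and $\pi|_{E_-}:E_-\to TG$ an isomorphism; it is left-invariant if preserved by the $G$-action. A generalized connection is a linear map $D:\Gamma(E)\to\Gamma(E^*\otimes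 E)$, $v\mapsto(u\mapsto D_uv)$, with $D_u(fv)=\pi(u)(f)v+fD_uv$ and $\pi(u)\langle v,w\rangle=\langle D_uv,w\rangle+\langle v,D_uw\rangle$. Its torsion is $T^D(u,v,w)=\langle D_uv-D_vu-[u,v]_{H,F},w\rangle+\langle v,D_wu\rangle$. $D$ is Levi-Civita for $E_-$ if $T^D=0$ and $D_u\Gamma(E_-)\subset\Gamma(E_-)$ for all $u\in\Gamma(E)$; it is left-invariant if $D_uv$ is left-invariant for all left-invariant $u,v$. A divergence operator is an additive map $\delta:\Gamma(E)\to C^\infty(G)$ with $\delta(fu)=\pi(u)(f)+f\delta(u)$; it is left-invariant if $\delta(u)$ is constant for left-invariant $u$, and is then identified with an element of $\tilde E^*$. The divergence of $D$ is $\delta^D(u)=\mathrm{tr}\,Du$. *)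

theory Defs
  imports "HOL-Analysis.Analysis" "HOL-Library.Function_Algebras"
begin

section \<open>Function spaces as real vector spaces\<close>

text \<open>
  Tangent vectors are operators on functions and cotangent vectors are functions on tangent
  vectors.  With the pointwise vector space structure, the library notions \<^term>\<open>subspace\<close>,
  \<^term>\<open>span\<close>, \<^term>\<open>independent\<close> and \<^term>\<open>representation\<close> apply to the fibres of
  $E = TG \oplus T^*G \oplus R$.
\<close>

instantiation "fun" :: (type, real_vector) real_vector
begin

definition scaleR_fun :: "real \<Rightarrow> ('a \<Rightarrow> 'b) \<Rightarrow> 'a \<Rightarrow> 'b"
  where "scaleR_fun c f = (\<lambda>x. c *\<^sub>R f x)"

instance
  by standard (auto simp: scaleR_fun_def fun_eq_iff scaleR_add_right scaleR_add_left)

end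

definition linear_on :: "'a::real_vector set \<Rightarrow> ('a \<Rightarrow> 'b::real_vector) \<Rightarrow> bool"
  where "linear_on S f \<longleftrightarrow>
    (\<forall>x\<in>S. \<forall>y\<in>S. f (x + y) = f x + f y) \<and> (\<forall>x\<in>S. \<forall>c. f (c *\<^sub>R x) = c *\<^sub>R f x)"

text \<open>Trace of an endomorphism \<open>f\<close> of a finite-dimensional subspace \<open>S\<close>, computed in some basis.\<close>

definition trace_on :: "'a::real_vector set \<Rightarrow> ('a \<Rightarrow> 'a) \<Rightarrow> real"
  where "trace_on S f =
    (let B = (SOME B. independent B \<and> span B = S) in \<Sum>b\<in>B. representation B (f b) b)"


section \<open>Smooth manifolds and Lie groups\<close>

primrec C_k_on :: "nat \<Rightarrow> 'a::real_normed_vector set \<Rightarrow> ('a \<Rightarrow> 'b::real_normed_vector) \<Rightarrow> bool"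
  where
    "C_k_on 0 S f \<longleftrightarrow> continuous_on S f"
  | "C_k_on (Suc k) S f \<longleftrightarrow>
       (\<forall>x\<in>S. f differentiable (at x)) \<and> (\<forall>v. C_k_on k S (\<lambda>x. frechet_derivative f (at x) v))"

text \<open>Only used for open subsets \<open>S\<close> of Euclidean spaces.\<close>

definition smooth_on :: "'a::real_normed_vector set \<Rightarrow> ('a \<Rightarrow> 'b::real_normed_vector) \<Rightarrow> bool"
  where "smooth_on S f \<longleftrightarrow> (\<forall>k. C_k_on k S f)"

text \<open>A chart is a pair \<open>(U, \<phi>)\<close>; its inverse is \<^term>\<open>inv_into U \<phi>\<close>.\<close>

type_synonym ('g, 'n) chart = "'g set \<times> ('g \<Rightarrow> real ^ 'n)"

locale smooth_manifold =
  fixes A :: "('g::{t2_space, second_countable_topology}, 'n::finite) chart set"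
  assumes charts: "(U, \<phi>) \<in> A \<Longrightarrow>
      open U \<and> open (\<phi> ` U) \<and> homeomorphism U (\<phi> ` U) \<phi> (inv_into U \<phi>)"
    and cover: "\<Union> (fst ` A) = UNIV"
    and compatible: "(U, \<phi>) \<in> A \<Longrightarrow> (V, \<psi>) \<in> A \<Longrightarrow>
      smooth_on (\<phi> ` (U \<inter> V)) (\<psi> \<circ> inv_into U \<phi>)"

locale lie_group = smooth_manifold A + group mul one ginv
  for A :: "('g::{t2_space, second_countable_topology}, 'n::finite) chart set"
    and mul :: "'g \<Rightarrow> 'g \<Rightarrow> 'g" and one :: 'g and ginv :: "'g \<Rightarrow> 'g" +
  assumes continuous_mult: "continuous_on UNIV (\<lambda>(x, y). mul x y)"
    and smooth_mult: "(U, \<phi>) \<in> A \<Longrightarrow> (V, \<psi>) \<in> A \<Longrightarrow> (W, \<theta>) \<in> A \<Longrightarrow>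
      smooth_on {(\<phi> x, \<psi> y) | x y. x \<in> U \<and> y \<in> V \<and> mul x y \<in> W}
        (\<lambda>(a, b). \<theta> (mul (inv_into U \<phi> a) (inv_into V \<psi> b)))"
    and continuous_inverse: "continuous_on UNIV ginv"
    and smooth_inverse: "(U, \<phi>) \<in> A \<Longrightarrow> (V, \<psi>) \<in> A \<Longrightarrow>
      smooth_on (\<phi> ` (U \<inter> ginv -` V)) (\<lambda>a. \<psi> (ginv (inv_into U \<phi> a)))"

definition smooth_fun_on ::
    "('g::topological_space, 'n::finite) chart set \<Rightarrow> 'g set \<Rightarrow> ('g \<Rightarrow> real) \<Rightarrow> bool"
  where "smooth_fun_on A W f \<longleftrightarrow> (\<forall>(U, \<phi>) \<in> A. smooth_on (\<phi> ` (U \<inter> W)) (f \<circ> inv_into U \<phi>))"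

definition smooth_near ::
    "('g::topological_space, 'n::finite) chart set \<Rightarrow> 'g \<Rightarrow> ('g \<Rightarrow> real) \<Rightarrow> bool"
  where "smooth_near A p f \<longleftrightarrow> (\<exists>W. open W \<and> p \<in> W \<and> smooth_fun_on A W f)"


section \<open>Tangent and cotangent vectors\<close>

text \<open>
  A tangent vector at \<open>p\<close> is identified with the directional derivative it induces on the functions
  that are smooth near \<open>p\<close>.  To make the representation unique, it is set to 0 on all other
  functions; likewise a cotangent vector at \<open>p\<close> is set to 0 outside of the tangent space.
\<close>

type_synonym 'g tvec = "('g \<Rightarrow> real) \<Rightarrow> real"
type_synonym 'g covec = "'g tvec \<Rightarrow> real"

definition tangent_space ::
    "('g::topological_space, 'n::finite) chart set \<Rightarrow> 'g \<Rightarrow> 'g tvec set"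
  where "tangent_space A p =
    {(\<lambda>f. if smooth_near A p f then frechet_derivative (f \<circ> inv_into U \<phi>) (at (\<phi> p)) w else 0)
      | U \<phi> w. (U, \<phi>) \<in> A \<and> p \<in> U}"

definition cotangent_space ::
    "('g::topological_space, 'n::finite) chart set \<Rightarrow> 'g \<Rightarrow> 'g covec set"
  where "cotangent_space A p =
    {\<alpha>. linear_on (tangent_space A p) \<alpha> \<and> (\<forall>v. v \<notin> tangent_space A p \<longrightarrow> \<alpha> v = 0)}"

definition differential :: "('g \<Rightarrow> 'g) \<Rightarrow> 'g tvec \<Rightarrow> 'g tvec"
  where "differential h v = (\<lambda>f. v (f \<circ> h))"


section \<open>Vector fields and differential forms\<close>

definition vector_fields_on ::
    "('g::topological_space, 'n::finite) chart set \<Rightarrow> 'g set \<Rightarrow> ('g \<Rightarrow> 'g tvec) set"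
  where "vector_fields_on A W =
    {X. (\<forall>p\<in>W. X p \<in> tangent_space A p) \<and>
        (\<forall>V f. open V \<and> V \<subseteq> W \<and> smooth_fun_on A V f \<longrightarrow> smooth_fun_on A V (\<lambda>p. X p f))}"

definition one_forms_on ::
    "('g::topological_space, 'n::finite) chart set \<Rightarrow> 'g set \<Rightarrow> ('g \<Rightarrow> 'g covec) set"
  where "one_forms_on A W =
    {\<xi>. (\<forall>p\<in>W. \<xi> p \<in> cotangent_space A p) \<and>
        (\<forall>V. open V \<and> V \<subseteq> W \<longrightarrow>
          (\<forall>X\<in>vector_fields_on A V. smooth_fun_on A V (\<lambda>p. \<xi> p (X p))))}"

definition two_forms ::
    "('g::topological_space, 'n::finite) chart set \<Rightarrow> ('g \<Rightarrow> 'g tvec \<Rightarrow> 'g tvec \<Rightarrow> real) set"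
  where "two_forms A =
    {F. (\<forall>p. \<forall>v\<in>tangent_space A p.
          linear_on (tangent_space A p) (\<lambda>u. F p u v) \<and>
          linear_on (tangent_space A p) (\<lambda>u. F p v u) \<and> F p v v = 0) \<and>
        (\<forall>V. open V \<longrightarrow> (\<forall>X\<in>vector_fields_on A V. \<forall>Y\<in>vector_fields_on A V.
          smooth_fun_on A V (\<lambda>p. F p (X p) (Y p))))}"

definition three_forms ::
    "('g::topological_space, 'n::finite) chart set \<Rightarrow>
      ('g \<Rightarrow> 'g tvec \<Rightarrow> 'g tvec \<Rightarrow> 'g tvec \<Rightarrow> real) set"
  where "three_forms A =
    {H. (\<forall>p. \<forall>v\<in>tangent_space A p. \<forall>w\<in>tangent_space A p.
          linear_on (tangent_space A p) (\<lambda>u. H p u v w) \<and>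
          linear_on (tangent_space A p) (\<lambda>u. H p v u w) \<and>
          linear_on (tangent_space A p) (\<lambda>u. H p v w u) \<and>
          H p v v w = 0 \<and> H p v w w = 0 \<and> H p v w v = 0) \<and>
        (\<forall>V. open V \<longrightarrow> (\<forall>X\<in>vector_fields_on A V. \<forall>Y\<in>vector_fields_on A V.
          \<forall>Z\<in>vector_fields_on A V. smooth_fun_on A V (\<lambda>p. H p (X p) (Y p) (Z p))))}"

definition lie_bracket ::
    "('g::topological_space, 'n::finite) chart set \<Rightarrow>
      ('g \<Rightarrow> 'g tvec) \<Rightarrow> ('g \<Rightarrow> 'g tvec) \<Rightarrow> 'g \<Rightarrow> 'g tvec"
  where "lie_bracket A X Y p =
    (\<lambda>f. if smooth_near A p f then X p (\<lambda>q. Y q f) - Y p (\<lambda>q. X q f) else 0)"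

text \<open>
  The Lie derivative of 1-forms and the exterior derivatives of 1-, 2- and 3-forms, evaluated on
  vector fields (Koszul's formula).
\<close>

definition lie_derivative ::
    "('g::topological_space, 'n::finite) chart set \<Rightarrow>
      ('g \<Rightarrow> 'g tvec) \<Rightarrow> ('g \<Rightarrow> 'g covec) \<Rightarrow> ('g \<Rightarrow> 'g tvec) \<Rightarrow> 'g \<Rightarrow> real"
  where "lie_derivative A X \<eta> Z p =
    X p (\<lambda>q. \<eta> q (Z q)) - \<eta> p (lie_bracket A X Z p)"

definition ext_deriv1 ::
    "('g::topological_space, 'n::finite) chart set \<Rightarrow>
      ('g \<Rightarrow> 'g covec) \<Rightarrow> ('g \<Rightarrow> 'g tvec) \<Rightarrow> ('g \<Rightarrow> 'g tvec) \<Rightarrow> 'g \<Rightarrow> real"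
  where "ext_deriv1 A \<xi> X Y p =
    X p (\<lambda>q. \<xi> q (Y q)) - Y p (\<lambda>q. \<xi> q (X q)) - \<xi> p (lie_bracket A X Y p)"

definition ext_deriv2 ::
    "('g::topological_space, 'n::finite) chart set \<Rightarrow> ('g \<Rightarrow> 'g tvec \<Rightarrow> 'g tvec \<Rightarrow> real) \<Rightarrow>
      ('g \<Rightarrow> 'g tvec) \<Rightarrow> ('g \<Rightarrow> 'g tvec) \<Rightarrow> ('g \<Rightarrow> 'g tvec) \<Rightarrow> 'g \<Rightarrow> real"
  where "ext_deriv2 A F X Y Z p =
      X p (\<lambda>q. F q (Y q) (Z q)) - Y p (\<lambda>q. F q (X q) (Z q)) + Z p (\<lambda>q. F q (X q) (Y q))
    - F p (lie_bracket A X Y p) (Z p) + F p (lie_bracket A X Z p) (Y p)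
    - F p (lie_bracket A Y Z p) (X p)"

definition ext_deriv3 ::
    "('g::topological_space, 'n::finite) chart set \<Rightarrow>
      ('g \<Rightarrow> 'g tvec \<Rightarrow> 'g tvec \<Rightarrow> 'g tvec \<Rightarrow> real) \<Rightarrow>
      ('g \<Rightarrow> 'g tvec) \<Rightarrow> ('g \<Rightarrow> 'g tvec) \<Rightarrow> ('g \<Rightarrow> 'g tvec) \<Rightarrow> ('g \<Rightarrow> 'g tvec) \<Rightarrow> 'g \<Rightarrow> real"
  where "ext_deriv3 A H X Y Z W p =
      X p (\<lambda>q. H q (Y q) (Z q) (W q)) - Y p (\<lambda>q. H q (X q) (Z q) (W q))
    + Z p (\<lambda>q. H q (X q) (Y q) (W q)) - W p (\<lambda>q. H q (X q) (Y q) (Z q))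
    - H p (lie_bracket A X Y p) (Z p) (W p) + H p (lie_bracket A X Z p) (Y p) (W p)
    - H p (lie_bracket A X W p) (Y p) (Z p) - H p (lie_bracket A Y Z p) (X p) (W p)
    + H p (lie_bracket A Y W p) (X p) (Z p) - H p (lie_bracket A Z W p) (X p) (Y p)"

text \<open>
  The wedge product is normalised compatibly with the exterior derivatives above:
  $(\alpha \wedge \beta)(X, Y) = \alpha(X) \beta(Y) - \alpha(Y) \beta(X)$ for 1-forms.
\<close>

definition wedge22 ::
    "('g \<Rightarrow> 'g tvec \<Rightarrow> 'g tvec \<Rightarrow> real) \<Rightarrow> ('g \<Rightarrow> 'g tvec \<Rightarrow> 'g tvec \<Rightarrow> real) \<Rightarrow>
      'g \<Rightarrow> 'g tvec \<Rightarrow> 'g tvec \<Rightarrow> 'g tvec \<Rightarrow> 'g tvec \<Rightarrow> real"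
  where "wedge22 F K p x y z w =
      F p x y * K p z w - F p x z * K p y w + F p x w * K p y z
    + F p y z * K p x w - F p y w * K p x z + F p z w * K p x y"

text \<open>The integrability conditions $dF = 0$ and $dH + F \wedge F = 0$.\<close>

definition Bn_integrable ::
    "('g::topological_space, 'n::finite) chart set \<Rightarrow>
      ('g \<Rightarrow> 'g tvec \<Rightarrow> 'g tvec \<Rightarrow> 'g tvec \<Rightarrow> real) \<Rightarrow>
      ('g \<Rightarrow> 'g tvec \<Rightarrow> 'g tvec \<Rightarrow> real) \<Rightarrow> bool"
  where "Bn_integrable A H F \<longleftrightarrow>
    (\<forall>X\<in>vector_fields_on A UNIV. \<forall>Y\<in>vector_fields_on A UNIV. \<forall>Z\<in>vector_fields_on A UNIV. \<forall>p.
      ext_deriv2 A F X Y Z p = 0) \<and>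
    (\<forall>X\<in>vector_fields_on A UNIV. \<forall>Y\<in>vector_fields_on A UNIV. \<forall>Z\<in>vector_fields_on A UNIV.
      \<forall>W\<in>vector_fields_on A UNIV. \<forall>p.
      ext_deriv3 A H X Y Z W p + wedge22 F F p (X p) (Y p) (Z p) (W p) = 0)"

definition left_invariant_two_form ::
    "('g::topological_space, 'n::finite) chart set \<Rightarrow> ('g \<Rightarrow> 'g \<Rightarrow> 'g) \<Rightarrow>
      ('g \<Rightarrow> 'g tvec \<Rightarrow> 'g tvec \<Rightarrow> real) \<Rightarrow> bool"
  where "left_invariant_two_form A mul F \<longleftrightarrow>
    (\<forall>x y. \<forall>u\<in>tangent_space A y. \<forall>v\<in>tangent_space A y.
      F (mul x y) (differential (mul x) u) (differential (mul x) v) = F y u v)"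

definition left_invariant_three_form ::
    "('g::topological_space, 'n::finite) chart set \<Rightarrow> ('g \<Rightarrow> 'g \<Rightarrow> 'g) \<Rightarrow>
      ('g \<Rightarrow> 'g tvec \<Rightarrow> 'g tvec \<Rightarrow> 'g tvec \<Rightarrow> real) \<Rightarrow> bool"
  where "left_invariant_three_form A mul H \<longleftrightarrow>
    (\<forall>x y. \<forall>u\<in>tangent_space A y. \<forall>v\<in>tangent_space A y. \<forall>w\<in>tangent_space A y.
      H (mul x y) (differential (mul x) u) (differential (mul x) v) (differential (mul x) w)
      = H y u v w)"


section \<open>The Courant algebroid $E_{H,F}$ of type $B_n$\<close>

text \<open>A triple \<open>(v, \<alpha>, \<lambda>)\<close> stands for the element $v + \alpha + \lambda$ of a fibre of $E$.\<close>

type_synonym 'g E_elem = "'g tvec \<times> 'g covec \<times> real"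
type_synonym 'g E_section = "'g \<Rightarrow> 'g E_elem"

definition E_fibre :: "('g::topological_space, 'n::finite) chart set \<Rightarrow> 'g \<Rightarrow> 'g E_elem set"
  where "E_fibre A p = tangent_space A p \<times> cotangent_space A p \<times> UNIV"

abbreviation tvec_part :: "'g E_section \<Rightarrow> 'g \<Rightarrow> 'g tvec"
  where "tvec_part u \<equiv> (\<lambda>p. fst (u p))"

abbreviation covec_part :: "'g E_section \<Rightarrow> 'g \<Rightarrow> 'g covec"
  where "covec_part u \<equiv> (\<lambda>p. fst (snd (u p)))"

abbreviation scal_part :: "'g E_section \<Rightarrow> 'g \<Rightarrow> real"
  where "scal_part u \<equiv> (\<lambda>p. snd (snd (u p)))"

definition sections_on ::
    "('g::topological_space, 'n::finite) chart set \<Rightarrow> 'g set \<Rightarrow> 'g E_section set"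
  where "sections_on A W =
    {u. tvec_part u \<in> vector_fields_on A W \<and> covec_part u \<in> one_forms_on A W \<and>
        smooth_fun_on A W (scal_part u)}"

abbreviation sections :: "('g::topological_space, 'n::finite) chart set \<Rightarrow> 'g E_section set"
  where "sections A \<equiv> sections_on A UNIV"

abbreviation smooth_fun :: "('g::topological_space, 'n::finite) chart set \<Rightarrow> ('g \<Rightarrow> real) \<Rightarrow> bool"
  where "smooth_fun A \<equiv> smooth_fun_on A UNIV"

definition fun_scale :: "('g \<Rightarrow> real) \<Rightarrow> 'g E_section \<Rightarrow> 'g E_section"
  where "fun_scale f u = (\<lambda>p. f p *\<^sub>R u p)"

definition anchor_apply :: "'g E_section \<Rightarrow> ('g \<Rightarrow> real) \<Rightarrow> 'g \<Rightarrow> real"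
  where "anchor_apply u f = (\<lambda>p. tvec_part u p f)"

definition pairing :: "'g E_elem \<Rightarrow> 'g E_elem \<Rightarrow> real"
  where "pairing = (\<lambda>(x, \<xi>, l) (y, \<eta>, m). (\<xi> y + \<eta> x) / 2 + l * m)"

text \<open>
  An operator \<open>\<Phi>\<close> that is linear over the smooth functions, defined on a space \<open>\<S>\<close> of
  sections, acts fibrewise: its value on \<open>e\<close> at \<open>p\<close> is the value at \<open>p\<close> of \<open>\<Phi>\<close> on any
  section through \<open>e\<close>.
\<close>

definition value_at :: "('g \<Rightarrow> 'v) set \<Rightarrow> (('g \<Rightarrow> 'v) \<Rightarrow> 'g \<Rightarrow> 'w) \<Rightarrow> 'g \<Rightarrow> 'v \<Rightarrow> 'w"
  where "value_at \<S> \<Phi> p e = (THE r. \<forall>s\<in>\<S>. s p = e \<longrightarrow> \<Phi> s p = r)"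

definition one_form_of ::
    "('g::topological_space, 'n::finite) chart set \<Rightarrow> (('g \<Rightarrow> 'g tvec) \<Rightarrow> 'g \<Rightarrow> real) \<Rightarrow>
      'g \<Rightarrow> 'g covec"
  where "one_form_of A \<Phi> p =
    (\<lambda>v. if v \<in> tangent_space A p then value_at (vector_fields_on A UNIV) \<Phi> p v else 0)"

text \<open>
  The Dorfman bracket.  The 1-form component is
  $\mathcal{L}_X \eta - i_Y d\xi + 2 \mu\, d\lambda + i_X i_Y H - 2 (\mu\, i_X F - \lambda\, i_Y F)$,
  evaluated on \<open>Z\<close>; note that $i_X i_Y H = H(Y, X, \cdot)$.
\<close>

definition dorfman ::
    "('g::topological_space, 'n::finite) chart set \<Rightarrow>
      ('g \<Rightarrow> 'g tvec \<Rightarrow> 'g tvec \<Rightarrow> 'g tvec \<Rightarrow> real) \<Rightarrow>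
      ('g \<Rightarrow> 'g tvec \<Rightarrow> 'g tvec \<Rightarrow> real) \<Rightarrow>
      'g E_section \<Rightarrow> 'g E_section \<Rightarrow> 'g E_section"
  where "dorfman A H F u v =
    (let X = tvec_part u; \<xi> = covec_part u; l = scal_part u;
         Y = tvec_part v; \<eta> = covec_part v; m = scal_part v
     in (\<lambda>p.
       (lie_bracket A X Y p,
        one_form_of A
          (\<lambda>Z q. lie_derivative A X \<eta> Z q - ext_deriv1 A \<xi> Y Z q + 2 * m q * Z q l
             + H q (Y q) (X q) (Z q) - 2 * (m q * F q (X q) (Z q) - l q * F q (Y q) (Z q))) p,
        X p m - Y p l + F p (X p) (Y p))))"

text \<open>The action $x (X_y + \alpha_y + \lambda_y)
  = (d_y L_x) X_y + \alpha_y \circ (d_y L_x)^{-1} + \lambda_y$, as a map from the fibre at \<open>y\<close> to the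
  fibre at \<open>x y\<close>.\<close>

definition E_action :: "('g \<Rightarrow> 'g \<Rightarrow> 'g) \<Rightarrow> 'g \<Rightarrow> 'g E_elem \<Rightarrow> 'g E_elem"
  where "E_action mul x =
    (\<lambda>(v, \<alpha>, l). (differential (mul x) v, \<alpha> \<circ> inv (differential (mul x)), l))"

definition left_invariant_section :: "('g \<Rightarrow> 'g \<Rightarrow> 'g) \<Rightarrow> 'g E_section \<Rightarrow> bool"
  where "left_invariant_section mul u \<longleftrightarrow> (\<forall>x y. u (mul x y) = E_action mul x (u y))"


section \<open>Generalized metrics, connections and divergence operators\<close>

text \<open>A subbundle is given by its fibres, which admit local frames of smooth sections.\<close>

definition subbundle ::
    "('g::topological_space, 'n::finite) chart set \<Rightarrow> ('g \<Rightarrow> 'g E_elem set) \<Rightarrow> bool"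
  where "subbundle A E' \<longleftrightarrow>
    (\<forall>p. subspace (E' p) \<and> E' p \<subseteq> E_fibre A p) \<and>
    (\<forall>p. \<exists>W B. open W \<and> p \<in> W \<and> finite B \<and> B \<subseteq> sections_on A W \<and>
      (\<forall>q\<in>W. inj_on (\<lambda>u. u q) B \<and> independent ((\<lambda>u. u q) ` B) \<and> span ((\<lambda>u. u q) ` B) = E' q))"

definition generalized_metric ::
    "('g::topological_space, 'n::finite) chart set \<Rightarrow> ('g \<Rightarrow> 'g E_elem set) \<Rightarrow> bool"
  where "generalized_metric A Em \<longleftrightarrow>
    subbundle A Em \<and>
    (\<forall>p. \<forall>e\<in>Em p. (\<forall>e'\<in>Em p. pairing e e' = 0) \<longrightarrow> e = 0) \<and>
    (\<forall>p. bij_betw fst (Em p) (tangent_space A p))"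

definition left_invariant_subbundle :: "('g \<Rightarrow> 'g \<Rightarrow> 'g) \<Rightarrow> ('g \<Rightarrow> 'g E_elem set) \<Rightarrow> bool"
  where "left_invariant_subbundle mul E' \<longleftrightarrow> (\<forall>x y. E_action mul x ` E' y \<subseteq> E' (mul x y))"

text \<open>\<open>D u v\<close> is $D_u v$; that $D v$ is a section of $E^* \otimes E$ is expressed by linearity of
  \<open>D u v\<close> in \<open>u\<close> over the smooth functions.\<close>

definition generalized_connection ::
    "('g::topological_space, 'n::finite) chart set \<Rightarrow>
      ('g E_section \<Rightarrow> 'g E_section \<Rightarrow> 'g E_section) \<Rightarrow> bool"
  where "generalized_connection A D \<longleftrightarrow>
    (\<forall>u\<in>sections A. \<forall>v\<in>sections A. D u v \<in> sections A) \<and>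
    (\<forall>u\<in>sections A. \<forall>u'\<in>sections A. \<forall>v\<in>sections A. D (u + u') v = D u v + D u' v) \<and>
    (\<forall>f. \<forall>u\<in>sections A. \<forall>v\<in>sections A. smooth_fun A f \<longrightarrow>
      D (fun_scale f u) v = fun_scale f (D u v)) \<and>
    (\<forall>u\<in>sections A. linear_on (sections A) (D u)) \<and>
    (\<forall>f. \<forall>u\<in>sections A. \<forall>v\<in>sections A. smooth_fun A f \<longrightarrow>
      D u (fun_scale f v) = fun_scale (anchor_apply u f) v + fun_scale f (D u v)) \<and>
    (\<forall>u\<in>sections A. \<forall>v\<in>sections A. \<forall>w\<in>sections A. \<forall>p.
      anchor_apply u (\<lambda>q. pairing (v q) (w q)) p
      = pairing (D u v p) (w p) + pairing (v p) (D u w p))"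

definition torsion ::
    "('g::topological_space, 'n::finite) chart set \<Rightarrow>
      ('g \<Rightarrow> 'g tvec \<Rightarrow> 'g tvec \<Rightarrow> 'g tvec \<Rightarrow> real) \<Rightarrow>
      ('g \<Rightarrow> 'g tvec \<Rightarrow> 'g tvec \<Rightarrow> real) \<Rightarrow>
      ('g E_section \<Rightarrow> 'g E_section \<Rightarrow> 'g E_section) \<Rightarrow>
      'g E_section \<Rightarrow> 'g E_section \<Rightarrow> 'g E_section \<Rightarrow> 'g \<Rightarrow> real"
  where "torsion A H F D u v w p =
    pairing ((D u v - D v u - dorfman A H F u v) p) (w p) + pairing (v p) (D w u p)"

definition levi_civita ::
    "('g::topological_space, 'n::finite) chart set \<Rightarrow>
      ('g \<Rightarrow> 'g tvec \<Rightarrow> 'g tvec \<Rightarrow> 'g tvec \<Rightarrow> real) \<Rightarrow>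
      ('g \<Rightarrow> 'g tvec \<Rightarrow> 'g tvec \<Rightarrow> real) \<Rightarrow> ('g \<Rightarrow> 'g E_elem set) \<Rightarrow>
      ('g E_section \<Rightarrow> 'g E_section \<Rightarrow> 'g E_section) \<Rightarrow> bool"
  where "levi_civita A H F Em D \<longleftrightarrow>
    (\<forall>u\<in>sections A. \<forall>v\<in>sections A. \<forall>w\<in>sections A. \<forall>p. torsion A H F D u v w p = 0) \<and>
    (\<forall>u\<in>sections A. \<forall>v\<in>sections A. (\<forall>p. v p \<in> Em p) \<longrightarrow> (\<forall>p. D u v p \<in> Em p))"

definition left_invariant_connection ::
    "('g::topological_space, 'n::finite) chart set \<Rightarrow> ('g \<Rightarrow> 'g \<Rightarrow> 'g) \<Rightarrow>
      ('g E_section \<Rightarrow> 'g E_section \<Rightarrow> 'g E_section) \<Rightarrow> bool"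
  where "left_invariant_connection A mul D \<longleftrightarrow>
    (\<forall>u\<in>sections A. \<forall>v\<in>sections A. left_invariant_section mul u \<and> left_invariant_section mul v \<longrightarrow>
      left_invariant_section mul (D u v))"

definition divergence_operator ::
    "('g::topological_space, 'n::finite) chart set \<Rightarrow> ('g E_section \<Rightarrow> 'g \<Rightarrow> real) \<Rightarrow> bool"
  where "divergence_operator A \<delta> \<longleftrightarrow>
    (\<forall>u\<in>sections A. smooth_fun A (\<delta> u)) \<and>
    (\<forall>u\<in>sections A. \<forall>v\<in>sections A. \<delta> (u + v) = \<delta> u + \<delta> v) \<and>
    (\<forall>f. \<forall>u\<in>sections A. smooth_fun A f \<longrightarrow>
      \<delta> (fun_scale f u) = anchor_apply u f + f * \<delta> u)"

definition left_invariant_divergence ::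
    "('g::topological_space, 'n::finite) chart set \<Rightarrow> ('g \<Rightarrow> 'g \<Rightarrow> 'g) \<Rightarrow>
      ('g E_section \<Rightarrow> 'g \<Rightarrow> real) \<Rightarrow> bool"
  where "left_invariant_divergence A mul \<delta> \<longleftrightarrow>
    (\<forall>u\<in>sections A. left_invariant_section mul u \<longrightarrow> (\<exists>c. \<forall>p. \<delta> u p = c))"

text \<open>The trace, at each point, of the endomorphism $D u : e \mapsto D_e u$ of the fibre.\<close>

definition connection_divergence ::
    "('g::topological_space, 'n::finite) chart set \<Rightarrow>
      ('g E_section \<Rightarrow> 'g E_section \<Rightarrow> 'g E_section) \<Rightarrow> 'g E_section \<Rightarrow> 'g \<Rightarrow> real"
  where "connection_divergence A D u p =
    trace_on (E_fibre A p) (value_at (sections A) (\<lambda>v. D v u) p)"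

end

theory Submission
  imports Defs
begin

text \<open>
  Left translation trivialises \<open>E\<close>.  Every fibre becomes the model
  $V = R^n \oplus R^n \oplus R$ with its split pairing, sections become smooth $V$-valued functions,
  left-invariant sections become constants, and a left-invariant generalized metric becomes a single
  nondegenerate subspace $W \subseteq V$ of dimension $n$ (\<open>generalized_metric_model\<close>).  For a bilinear
  $\Gamma : V \times V \to V$ consider $D_u v = dv(\pi(u)) + \Gamma(u, v)$
  (\<open>triv_connection\<close>).  It is left-invariant since constants have derivative 0, and it is a
  generalized connection as soon as every $\Gamma(a, \cdot)$ is skew for the pairing.

  In the trivialisation the Dorfman bracket satisfies
  $$\langle [u, v], w \rangle = \langle d_u v, w \rangle - \langle d_v u, w \rangle
    + \langle d_w u, v \rangle + C(u, v, w)$$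
  with a constant alternating form $C$ (\<open>pairing_dorfman\<close>).  The first three terms cancel against the
  derivative part of $D$ in the torsion, so that $T^D = 0$ says that the cyclic sum of
  $\langle \Gamma(a, b), c \rangle$ is $C(a, b, c)$.  Likewise every divergence operator has the
  same derivative part (\<open>divergence_frame_expand\<close>, \<open>connection_divergence_triv\<close>), so that
  $\delta^D = \delta$ prescribes the linear form $b \mapsto \mathrm{tr}\, \Gamma(\cdot, b)$.

  What remains is linear algebra (\<open>exists_connection_coefficients\<close>).  Split $V$ into $W$ and its
  orthogonal complement, and let $\langle \Gamma(a, b), c \rangle$ be $C/3$ if $a, b, c$ lie in the
  same summand, $C$ if $b, c$ lie in one summand and $a$ in the other, and 0 if $b, c$ lie in
  different summands.  Only the trace may be wrong.  On a summand of dimension $r$, adding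
  $\langle a, b \rangle e - \langle e, b \rangle a$ to $\Gamma(a, b)$ changes neither the skewness
  nor the cyclic sum, and it changes the trace by $(1 - r) \langle e, b \rangle$.  The two
  dimensions are $n$ and $n + 1$, which differ from 1 because $n \ge 2$, so a suitable $e$ in each summand
  corrects the trace.

  Two facts from analysis support this.  The left-invariant frame and its dual coframe are smooth
  (\<open>left_field_vector_field\<close>, \<open>smooth_frame_coords\<close>), because they are partial derivatives of the
  multiplication $x y$ and of the division $x^{-1} y$.  The Lie bracket of two vector fields, which is defined
  as an operator on functions, is a tangent vector (\<open>lie_bracket_tangent\<close>), because second derivatives
  are symmetric.
\<close>

section \<open>Smooth functions on open subsets of Euclidean spaces\<close>

lemma frechet_derivative_cong_open:
  assumes "open S" "x \<in> S" "\<And>y. y \<in> S \<Longrightarrow> f y = g y"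
  shows "frechet_derivative f (at x) = frechet_derivative g (at x)"
proof -
  have "(f has_derivative D) (at x) \<longleftrightarrow> (g has_derivative D) (at x)" for D
    using assms has_derivative_transform_within_open[of f D x UNIV S g]
      has_derivative_transform_within_open[of g D x UNIV S f] by auto
  then show ?thesis
    by (simp add: frechet_derivative_def)
qed

lemma differentiable_cong_open:
  assumes "open S" "x \<in> S" "\<And>y. y \<in> S \<Longrightarrow> f y = g y" "f differentiable (at x)"
  shows "g differentiable (at x)"
  using assms has_derivative_transform_within_open[of f _ x UNIV S g]
  unfolding differentiable_def by blast

lemma C_k_on_cong_imp:
  assumes "open S" "\<And>y. y \<in> S \<Longrightarrow> f y = g y" "C_k_on k S f"
  shows "C_k_on k S g"
  using assms(2,3)
proof (induction k arbitrary: f g)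
  case 0
  then show ?case by (simp cong: continuous_on_cong)
next
  case (Suc k)
  have "g differentiable (at x)" if "x \<in> S" for x
    using differentiable_cong_open[OF assms(1) that Suc.prems(1)] Suc.prems(2) that by simp
  moreover have "C_k_on k S (\<lambda>x. frechet_derivative g (at x) v)" for v
  proof (rule Suc.IH)
    show "frechet_derivative f (at y) v = frechet_derivative g (at y) v" if "y \<in> S" for y
      using frechet_derivative_cong_open[OF assms(1) that Suc.prems(1)] by simp
    show "C_k_on k S (\<lambda>x. frechet_derivative f (at x) v)"
      using Suc.prems(2) by simp
  qed
  ultimately show ?case by simp
qed

lemma C_k_on_subset: "C_k_on k S f \<Longrightarrow> T \<subseteq> S \<Longrightarrow> C_k_on k T f"
  by (induction k arbitrary: f) (auto intro: continuous_on_subset)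

lemma C_k_on_SucD: "C_k_on (Suc k) S f \<Longrightarrow> C_k_on k S f"
proof (induction k arbitrary: f)
  case 0
  then show ?case
    by (auto intro!: continuous_at_imp_continuous_on differentiable_imp_continuous_within)
next
  case (Suc k)
  have "f differentiable (at x)" if "x \<in> S" for x
    using Suc.prems that by simp
  moreover have "C_k_on k S (\<lambda>x. frechet_derivative f (at x) v)" for v
    using Suc.prems by (intro Suc.IH) (subst (asm) C_k_on.simps(2), blast)
  ultimately show ?case by simp
qed

lemma C_k_on_local:
  assumes "\<And>x. x \<in> S \<Longrightarrow> \<exists>N. open N \<and> x \<in> N \<and> C_k_on k N f"
  shows "C_k_on k S f"
  using assms
proof (induction k arbitrary: f)
  case 0
  have "isCont f x" if "x \<in> S" for x
    using 0[OF that] by (auto simp: continuous_on_eq_continuous_at)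
  then show ?case
    by (auto intro: continuous_at_imp_continuous_on)
next
  case (Suc k)
  have "f differentiable (at x)" if "x \<in> S" for x
    using Suc.prems[OF that] by auto
  moreover have "C_k_on k S (\<lambda>x. frechet_derivative f (at x) v)" for v
    by (rule Suc.IH) (use Suc.prems in fastforce)
  ultimately show ?case by simp
qed

lemma C_k_on_Suc_has_derivative:
  "C_k_on (Suc k) S f \<Longrightarrow> x \<in> S \<Longrightarrow> (f has_derivative frechet_derivative f (at x)) (at x)"
  by (simp add: frechet_derivative_works[symmetric])

lemma C_k_on_const: "C_k_on k S (\<lambda>x. c)"
  by (induction k arbitrary: c) auto

lemma C_k_on_bounded_linear:
  assumes "bounded_linear L" "open S" "C_k_on k S f"
  shows "C_k_on k S (\<lambda>x. L (f x))"
  using assms(3)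
proof (induction k arbitrary: f)
  case 0
  then show ?case
    using linear_continuous_on[OF assms(1)] continuous_on_compose2[of UNIV L S f] by simp
next
  case (Suc k)
  have d: "((\<lambda>x. L (f x)) has_derivative (\<lambda>v. L (frechet_derivative f (at x) v))) (at x)"
    if "x \<in> S" for x
    by (rule bounded_linear.has_derivative[OF assms(1) C_k_on_Suc_has_derivative[OF Suc.prems that]])
  have "C_k_on k S (\<lambda>x. frechet_derivative (\<lambda>x. L (f x)) (at x) v)" for v
  proof (rule C_k_on_cong_imp[OF assms(2)])
    show "C_k_on k S (\<lambda>x. L (frechet_derivative f (at x) v))"
      using Suc by simp
    show "L (frechet_derivative f (at y) v) = frechet_derivative (\<lambda>x. L (f x)) (at y) v"
      if "y \<in> S" for y
      using frechet_derivative_at[OF d[OF that]] by (simp add: fun_eq_iff)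
  qed
  then show ?case using d by (auto simp: differentiable_def)
qed

lemma C_k_on_add:
  assumes "open S" "C_k_on k S f" "C_k_on k S g"
  shows "C_k_on k S (\<lambda>x. f x + g x)"
  using assms(2,3)
proof (induction k arbitrary: f g)
  case 0
  then show ?case by (simp add: continuous_on_add)
next
  case (Suc k)
  have d: "((\<lambda>x. f x + g x) has_derivative
      (\<lambda>v. frechet_derivative f (at x) v + frechet_derivative g (at x) v)) (at x)"
    if "x \<in> S" for x
    by (intro has_derivative_add C_k_on_Suc_has_derivative[OF Suc.prems(1) that]
        C_k_on_Suc_has_derivative[OF Suc.prems(2) that])
  have "C_k_on k S (\<lambda>x. frechet_derivative (\<lambda>x. f x + g x) (at x) v)" for v
  proof (rule C_k_on_cong_imp[OF assms(1)])
    show "C_k_on k S (\<lambda>x. frechet_derivative f (at x) v + frechet_derivative g (at x) v)"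
      using Suc by simp
    show "frechet_derivative f (at y) v + frechet_derivative g (at y) v
        = frechet_derivative (\<lambda>x. f x + g x) (at y) v"
      if "y \<in> S" for y
      using frechet_derivative_at[OF d[OF that]] by (simp add: fun_eq_iff)
  qed
  then show ?case using d by (auto simp: differentiable_def)
qed

lemma C_k_on_scaleR:
  fixes f :: "'a::real_normed_vector \<Rightarrow> real" and g :: "'a \<Rightarrow> 'b::real_normed_vector"
  assumes "open S" "C_k_on k S f" "C_k_on k S g"
  shows "C_k_on k S (\<lambda>x. f x *\<^sub>R g x)"
  using assms(2,3)
proof (induction k arbitrary: f g)
  case 0
  then show ?case by (simp add: continuous_on_scaleR)
next
  case (Suc k)
  have d: "((\<lambda>x. f x *\<^sub>R g x) has_derivative
      (\<lambda>v. f x *\<^sub>R frechet_derivative g (at x) v + frechet_derivative f (at x) v *\<^sub>R g x)) (at x)"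
    if "x \<in> S" for x
    by (intro has_derivative_scaleR C_k_on_Suc_has_derivative[OF Suc.prems(1) that]
        C_k_on_Suc_has_derivative[OF Suc.prems(2) that])
  have "C_k_on k S (\<lambda>x. frechet_derivative (\<lambda>x. f x *\<^sub>R g x) (at x) v)" for v
  proof (rule C_k_on_cong_imp[OF assms(1)])
    show "C_k_on k S (\<lambda>x. f x *\<^sub>R frechet_derivative g (at x) v
        + frechet_derivative f (at x) v *\<^sub>R g x)"
      using Suc.prems C_k_on_SucD[of k S f] C_k_on_SucD[of k S g]
      by (intro C_k_on_add[OF assms(1)] Suc.IH) auto
    show "f y *\<^sub>R frechet_derivative g (at y) v + frechet_derivative f (at y) v *\<^sub>R g y
        = frechet_derivative (\<lambda>x. f x *\<^sub>R g x) (at y) v"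
      if "y \<in> S" for y
      using frechet_derivative_at[OF d[OF that]] by (simp add: fun_eq_iff)
  qed
  then show ?case using d by (auto simp: differentiable_def)
qed

lemma C_k_on_sum:
  assumes "open S" "\<And>i. i \<in> I \<Longrightarrow> C_k_on k S (f i)"
  shows "C_k_on k S (\<lambda>x. \<Sum>i\<in>I. f i x)"
  using assms(2)
  by (induction I rule: infinite_finite_induct) (auto intro: C_k_on_const C_k_on_add[OF assms(1)])

text \<open>Expanding the derivative of the inner function in the basis turns the chain rule into a sum of products
  whose factors are one order less smooth, which is what the induction needs.\<close>

lemma C_k_on_compose:
  fixes f :: "'a::real_normed_vector \<Rightarrow> 'b::euclidean_space"
    and g :: "'b \<Rightarrow> 'c::real_normed_vector"
  assumes "open S" "open T" "f ` S \<subseteq> T" "C_k_on k S f" "C_k_on k T g"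
  shows "C_k_on k S (\<lambda>x. g (f x))"
  using assms(4,5)
proof (induction k arbitrary: g)
  case 0
  then show ?case using assms(3) continuous_on_compose2[of T g S f] by simp
next
  case (Suc k)
  have df: "(f has_derivative frechet_derivative f (at x)) (at x)" if "x \<in> S" for x
    by (rule C_k_on_Suc_has_derivative[OF Suc.prems(1) that])
  have dg: "(g has_derivative frechet_derivative g (at (f x))) (at (f x))" if "x \<in> S" for x
    using C_k_on_Suc_has_derivative[OF Suc.prems(2)] that assms(3) by blast
  have d: "((\<lambda>x. g (f x)) has_derivative
      (\<lambda>v. frechet_derivative g (at (f x)) (frechet_derivative f (at x) v))) (at x)"
    if "x \<in> S" for x
    using has_derivative_compose[OF df[OF that] dg[OF that]] .
  have "C_k_on k S (\<lambda>x. frechet_derivative (\<lambda>x. g (f x)) (at x) v)" for v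
  proof (rule C_k_on_cong_imp[OF assms(1)])
    show "C_k_on k S (\<lambda>x. \<Sum>b\<in>Basis. (frechet_derivative f (at x) v \<bullet> b) *\<^sub>R
        frechet_derivative g (at (f x)) b)"
      using Suc.prems C_k_on_SucD[of k S f]
      by (intro C_k_on_sum[OF assms(1)] C_k_on_scaleR[OF assms(1)]
          C_k_on_bounded_linear[OF bounded_linear_inner_left assms(1)] Suc.IH) auto
    show "(\<Sum>b\<in>Basis. (frechet_derivative f (at y) v \<bullet> b) *\<^sub>R frechet_derivative g (at (f y)) b)
        = frechet_derivative (\<lambda>x. g (f x)) (at y) v" if "y \<in> S" for y
    proof -
      have lin: "linear (frechet_derivative g (at (f y)))"
        using dg[OF that] has_derivative_linear by blast
      have "frechet_derivative (\<lambda>x. g (f x)) (at y) v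
          = frechet_derivative g (at (f y)) (frechet_derivative f (at y) v)"
        using frechet_derivative_at[OF d[OF that]] by (simp add: fun_eq_iff)
      also have "\<dots> = frechet_derivative g (at (f y))
          (\<Sum>b\<in>Basis. (frechet_derivative f (at y) v \<bullet> b) *\<^sub>R b)"
        by (simp add: euclidean_representation)
      finally show ?thesis
        by (simp add: linear_sum[OF lin] linear_cmul[OF lin])
    qed
  qed
  then show ?case using d by (auto simp: differentiable_def)
qed

lemma smooth_on_cong: "open S \<Longrightarrow> (\<And>y. y \<in> S \<Longrightarrow> f y = g y) \<Longrightarrow> smooth_on S f \<Longrightarrow> smooth_on S g"
  unfolding smooth_on_def using C_k_on_cong_imp by blast

lemma smooth_on_subset: "smooth_on S f \<Longrightarrow> T \<subseteq> S \<Longrightarrow> smooth_on T f"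
  unfolding smooth_on_def using C_k_on_subset by blast

lemma smooth_on_local:
  assumes "\<And>x. x \<in> S \<Longrightarrow> \<exists>N. open N \<and> x \<in> N \<and> smooth_on N f"
  shows "smooth_on S f"
  unfolding smooth_on_def
proof
  show "C_k_on k S f" for k
    by (rule C_k_on_local) (use assms in \<open>auto simp: smooth_on_def\<close>)
qed

lemma smooth_on_const: "smooth_on S (\<lambda>x. c)"
  by (simp add: smooth_on_def C_k_on_const)

lemma smooth_on_bounded_linear:
  "bounded_linear L \<Longrightarrow> open S \<Longrightarrow> smooth_on S f \<Longrightarrow> smooth_on S (\<lambda>x. L (f x))"
  by (simp add: smooth_on_def C_k_on_bounded_linear)

lemma smooth_on_add: "open S \<Longrightarrow> smooth_on S f \<Longrightarrow> smooth_on S g \<Longrightarrow> smooth_on S (\<lambda>x. f x + g x)"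
  by (simp add: smooth_on_def C_k_on_add)

lemma smooth_on_scaleR:
  fixes f :: "'a::real_normed_vector \<Rightarrow> real" and g :: "'a \<Rightarrow> 'b::real_normed_vector"
  shows "open S \<Longrightarrow> smooth_on S f \<Longrightarrow> smooth_on S g \<Longrightarrow> smooth_on S (\<lambda>x. f x *\<^sub>R g x)"
  by (simp add: smooth_on_def C_k_on_scaleR)

lemma smooth_on_mult:
  fixes f g :: "'a::real_normed_vector \<Rightarrow> real"
  shows "open S \<Longrightarrow> smooth_on S f \<Longrightarrow> smooth_on S g \<Longrightarrow> smooth_on S (\<lambda>x. f x * g x)"
  using smooth_on_scaleR[of S f g] by simp

lemma smooth_on_sum:
  "open S \<Longrightarrow> (\<And>i. i \<in> I \<Longrightarrow> smooth_on S (f i)) \<Longrightarrow> smooth_on S (\<lambda>x. \<Sum>i\<in>I. f i x)"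
  by (simp add: smooth_on_def C_k_on_sum)

lemma smooth_on_compose:
  fixes f :: "'a::real_normed_vector \<Rightarrow> 'b::euclidean_space"
    and g :: "'b \<Rightarrow> 'c::real_normed_vector"
  assumes "open S" "open T" "f ` S \<subseteq> T" "smooth_on S f" "smooth_on T g"
  shows "smooth_on S (\<lambda>x. g (f x))"
  using assms unfolding smooth_on_def by (blast intro: C_k_on_compose)

lemma smooth_on_id: "smooth_on S (\<lambda>x. x)"
proof -
  have "C_k_on k S (\<lambda>x. x)" for k
    by (cases k) (auto intro: C_k_on_const)
  then show ?thesis by (simp add: smooth_on_def)
qed

lemma smooth_on_linear: "bounded_linear L \<Longrightarrow> smooth_on S L"
  using smooth_on_subset[OF smooth_on_bounded_linear[OF _ open_UNIV smooth_on_id]] by auto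

lemma smooth_on_Pair:
  fixes f :: "'a::real_normed_vector \<Rightarrow> 'b::real_normed_vector"
    and g :: "'a \<Rightarrow> 'c::real_normed_vector"
  assumes "open S" "smooth_on S f" "smooth_on S g"
  shows "smooth_on S (\<lambda>x. (f x, g x))"
proof -
  have "smooth_on S (\<lambda>x. (f x, 0 :: 'c) + (0 :: 'b, g x))"
    by (intro smooth_on_add[OF assms(1)]
        smooth_on_bounded_linear[of "\<lambda>x. (x, 0)", OF _ assms(1,2)]
        smooth_on_bounded_linear[of "\<lambda>x. (0, x)", OF _ assms(1,3)]
        bounded_linear_Pair bounded_linear_ident bounded_linear_zero)
  then show ?thesis by simp
qed

lemma smooth_on_imp_differentiable: "smooth_on S f \<Longrightarrow> x \<in> S \<Longrightarrow> f differentiable (at x)"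
  unfolding smooth_on_def by (drule spec[of _ "Suc 0"]) simp

lemma smooth_on_derivative:
  assumes "smooth_on S f"
  shows "smooth_on S (\<lambda>x. frechet_derivative f (at x) v)"
  unfolding smooth_on_def
proof
  show "C_k_on k S (\<lambda>x. frechet_derivative f (at x) v)" for k
    using assms unfolding smooth_on_def by (auto dest: spec[of _ "Suc k"])
qed

lemma smooth_on_imp_continuous_on: "smooth_on S f \<Longrightarrow> continuous_on S f"
  unfolding smooth_on_def by (drule spec[of _ 0]) simp

text \<open>This is the mean value theorem along \<open>v\<close> and then along \<open>w\<close>.  The left-hand side is symmetric in
  \<open>v\<close> and \<open>w\<close>, which forces the two mixed derivatives to agree in the limit.\<close>

lemma second_difference_mean_value:
  fixes f :: "'a::real_normed_vector \<Rightarrow> real"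
  assumes "s > 0"
    and S: "\<And>r t. 0 \<le> r \<Longrightarrow> r \<le> s \<Longrightarrow> 0 \<le> t \<Longrightarrow> t \<le> s \<Longrightarrow> x + r *\<^sub>R v + t *\<^sub>R w \<in> S"
    and f: "smooth_on S f"
  shows "\<exists>r t. 0 \<le> r \<and> r \<le> s \<and> 0 \<le> t \<and> t \<le> s \<and>
    f (x + s *\<^sub>R v + s *\<^sub>R w) - f (x + s *\<^sub>R v) - f (x + s *\<^sub>R w) + f x
    = s * s * frechet_derivative (\<lambda>y. frechet_derivative f (at y) v) (at (x + r *\<^sub>R v + t *\<^sub>R w)) w"
proof -
  have line: "((\<lambda>r. h (y + r *\<^sub>R u)) has_real_derivative frechet_derivative h (at (y + r *\<^sub>R u)) u) (at r)"
    if "smooth_on S h" "y + r *\<^sub>R u \<in> S" for h :: "'a \<Rightarrow> real" and y u r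
  proof -
    have "(h has_derivative frechet_derivative h (at (y + r *\<^sub>R u))) (at (y + r *\<^sub>R u))"
      using smooth_on_imp_differentiable[OF that] frechet_derivative_works by blast
    moreover have "((\<lambda>r. y + r *\<^sub>R u) has_derivative (\<lambda>r. r *\<^sub>R u)) (at r)"
      by (auto intro!: derivative_eq_intros)
    ultimately have d: "((\<lambda>r. h (y + r *\<^sub>R u)) has_derivative
        (\<lambda>c. frechet_derivative h (at (y + r *\<^sub>R u)) (c *\<^sub>R u))) (at r)"
      using has_derivative_compose by blast
    have "linear (frechet_derivative h (at (y + r *\<^sub>R u)))"
      using linear_frechet_derivative smooth_on_imp_differentiable[OF that] by blast
    then show ?thesis
      using d by (simp add: has_field_derivative_def linear_cmul mult.commute[of _ "frechet_derivative _ _ _"])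
  qed
  define \<phi> where "\<phi> r = f ((x + s *\<^sub>R w) + r *\<^sub>R v) - f (x + r *\<^sub>R v)" for r
  have "\<exists>r. 0 < r \<and> r < s \<and> \<phi> s - \<phi> 0 = (s - 0) *
    (frechet_derivative f (at ((x + s *\<^sub>R w) + r *\<^sub>R v)) v - frechet_derivative f (at (x + r *\<^sub>R v)) v)"
  proof (rule MVT2[OF \<open>s > 0\<close>])
    fix r assume r: "0 \<le> r" "r \<le> s"
    show "(\<phi> has_real_derivative frechet_derivative f (at ((x + s *\<^sub>R w) + r *\<^sub>R v)) v
        - frechet_derivative f (at (x + r *\<^sub>R v)) v) (at r)"
      unfolding \<phi>_def
      using S[OF r, of s] S[OF r, of 0] \<open>s > 0\<close>
      by (intro DERIV_diff line f) (auto simp: algebra_simps)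
  qed
  then obtain r where r: "0 < r" "r < s" and e1: "\<phi> s - \<phi> 0 = s *
    (frechet_derivative f (at ((x + s *\<^sub>R w) + r *\<^sub>R v)) v - frechet_derivative f (at (x + r *\<^sub>R v)) v)"
    by auto
  define g where "g y = frechet_derivative f (at y) v" for y
  have "\<exists>t. 0 < t \<and> t < s \<and> g ((x + r *\<^sub>R v) + s *\<^sub>R w) - g ((x + r *\<^sub>R v) + 0 *\<^sub>R w)
    = (s - 0) * frechet_derivative g (at ((x + r *\<^sub>R v) + t *\<^sub>R w)) w"
  proof (rule MVT2[OF \<open>s > 0\<close>, where f="\<lambda>t. g ((x + r *\<^sub>R v) + t *\<^sub>R w)"])
    fix t assume t: "0 \<le> t" "t \<le> s"
    show "((\<lambda>t. g ((x + r *\<^sub>R v) + t *\<^sub>R w)) has_real_derivative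
        frechet_derivative g (at ((x + r *\<^sub>R v) + t *\<^sub>R w)) w) (at t)"
      by (rule line) (use smooth_on_derivative[OF f] S[of r t] r t in \<open>auto simp: g_def\<close>)
  qed
  then obtain t where t: "0 < t" "t < s" and e2: "g ((x + r *\<^sub>R v) + s *\<^sub>R w) - g (x + r *\<^sub>R v)
    = s * frechet_derivative g (at ((x + r *\<^sub>R v) + t *\<^sub>R w)) w"
    by auto
  have "f (x + s *\<^sub>R v + s *\<^sub>R w) - f (x + s *\<^sub>R v) - f (x + s *\<^sub>R w) + f x = \<phi> s - \<phi> 0"
    by (simp add: \<phi>_def algebra_simps)
  also have "\<dots> = s * (s * frechet_derivative g (at ((x + r *\<^sub>R v) + t *\<^sub>R w)) w)"
    unfolding e1 e2[symmetric] by (simp add: g_def algebra_simps)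
  finally show ?thesis
    using less_imp_le[OF r(1)] less_imp_le[OF r(2)] less_imp_le[OF t(1)] less_imp_le[OF t(2)]
    unfolding g_def mult.assoc by blast
qed

text \<open>For small steps the two mixed derivatives, each at some point near \<open>x\<close>, equal the same second
  difference quotient.  By continuity they agree at \<open>x\<close>.\<close>

lemma second_derivative_symmetric:
  fixes f :: "'a::real_normed_vector \<Rightarrow> real"
  assumes "open S" "x \<in> S" "smooth_on S f"
  shows "frechet_derivative (\<lambda>y. frechet_derivative f (at y) v) (at x) w
    = frechet_derivative (\<lambda>y. frechet_derivative f (at y) w) (at x) v"
proof -
  define g where "g v w y = frechet_derivative (\<lambda>y. frechet_derivative f (at y) v) (at y) w" for v w y
  have cont: "isCont (g v w) x" for v w
    using smooth_on_imp_continuous_on[OF smooth_on_derivative[OF smooth_on_derivative[OF assms(3)]]]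
      assms(1,2) unfolding g_def by (auto simp: continuous_on_eq_continuous_at)
  obtain e where e: "e > 0" "ball x e \<subseteq> S"
    using assms openE by blast
  have "\<bar>g v w x - g w v x\<bar> \<le> d" if "d > 0" for d
  proof -
    obtain d1 where d1: "d1 > 0" "\<And>y. dist y x < d1 \<Longrightarrow> dist (g v w y) (g v w x) < d / 2"
      using cont[of v w] \<open>d > 0\<close> unfolding continuous_at_eps_delta by (meson half_gt_zero)
    obtain d2 where d2: "d2 > 0" "\<And>y. dist y x < d2 \<Longrightarrow> dist (g w v y) (g w v x) < d / 2"
      using cont[of w v] \<open>d > 0\<close> unfolding continuous_at_eps_delta by (meson half_gt_zero)
    define m where "m = min e (min d1 d2)"
    define s where "s = m / (norm v + norm w + 1)"
    have m: "m > 0" using e d1 d2 by (simp add: m_def)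
    have nz: "norm v + norm w + 1 > 0" by (smt (verit) norm_ge_zero)
    have s: "s > 0" using m nz by (simp add: s_def)
    have near: "dist (x + r *\<^sub>R v + t *\<^sub>R w) x < m"
      if "0 \<le> r" "r \<le> s" "0 \<le> t" "t \<le> s" for r t
    proof -
      have "dist (x + r *\<^sub>R v + t *\<^sub>R w) x = norm (r *\<^sub>R v + t *\<^sub>R w)"
        by (simp add: dist_norm algebra_simps)
      also have "\<dots> \<le> r * norm v + t * norm w"
        using that norm_triangle_ineq[of "r *\<^sub>R v" "t *\<^sub>R w"] by simp
      also have "\<dots> \<le> s * norm v + s * norm w"
        using that by (intro add_mono mult_right_mono) auto
      also have "\<dots> < s * (norm v + norm w + 1)"
        using s by (simp add: algebra_simps)
      also have "\<dots> = m" using nz by (simp add: s_def)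
      finally show ?thesis .
    qed
    have in_S: "x + r *\<^sub>R v + t *\<^sub>R w \<in> S" "x + r *\<^sub>R w + t *\<^sub>R v \<in> S"
      if "0 \<le> r" "r \<le> s" "0 \<le> t" "t \<le> s" for r t
      using near[OF that] near[OF that(3,4,1,2)] e(2)
      by (auto simp: m_def dist_commute add_ac subset_iff)
    obtain r t where rt: "0 \<le> r" "r \<le> s" "0 \<le> t" "t \<le> s" and 1:
      "f (x + s *\<^sub>R v + s *\<^sub>R w) - f (x + s *\<^sub>R v) - f (x + s *\<^sub>R w) + f x
        = s * s * g v w (x + r *\<^sub>R v + t *\<^sub>R w)"
      using second_difference_mean_value[OF s in_S(1) assms(3)] unfolding g_def by blast
    obtain r' t' where rt': "0 \<le> r'" "r' \<le> s" "0 \<le> t'" "t' \<le> s" and 2: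
      "f (x + s *\<^sub>R w + s *\<^sub>R v) - f (x + s *\<^sub>R w) - f (x + s *\<^sub>R v) + f x
        = s * s * g w v (x + r' *\<^sub>R w + t' *\<^sub>R v)"
      using second_difference_mean_value[OF s in_S(2) assms(3)] unfolding g_def by blast
    have "s * s * g v w (x + r *\<^sub>R v + t *\<^sub>R w) = s * s * g w v (x + r' *\<^sub>R w + t' *\<^sub>R v)"
      unfolding 1[symmetric] 2[symmetric] by (simp add: add_ac)
    then have "g v w (x + r *\<^sub>R v + t *\<^sub>R w) = g w v (x + t' *\<^sub>R v + r' *\<^sub>R w)"
      using s by (simp add: add_ac)
    moreover have "dist (g v w (x + r *\<^sub>R v + t *\<^sub>R w)) (g v w x) < d / 2"
      using near[OF rt] by (intro d1) (simp add: m_def)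
    moreover have "dist (g w v (x + t' *\<^sub>R v + r' *\<^sub>R w)) (g w v x) < d / 2"
      using near[OF rt'(3,4,1,2)] by (intro d2) (simp add: m_def)
    ultimately show ?thesis unfolding dist_real_def by linarith
  qed
  then have "\<bar>g v w x - g w v x\<bar> \<le> 0"
    by (meson dense not_le)
  then show ?thesis by (simp add: g_def)
qed

text \<open>The first component of \<open>z\<close> is a parameter.  Below, \<open>h\<close> is the multiplication or the division of the
  group, read in charts and followed by a function.\<close>

lemma smooth_on_partial_derivative:
  fixes h :: "'a::euclidean_space \<times> 'b::euclidean_space \<Rightarrow> real"
  assumes S: "open S" and h: "smooth_on S h"
  shows "smooth_on S (\<lambda>z. frechet_derivative (\<lambda>b. h (fst z, b)) (at (snd z)) w)"
proof (rule smooth_on_cong[OF S _ smooth_on_derivative[OF h, of "(0, w)"]])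
  fix z assume "z \<in> S"
  then have "(h has_derivative frechet_derivative h (at z)) (at (fst z, snd z))"
    using smooth_on_imp_differentiable[OF h] frechet_derivative_works[of h "at z"] by simp
  moreover have "((\<lambda>b. (fst z, b)) has_derivative (\<lambda>b. (0, b))) (at (snd z))"
    by (auto intro!: derivative_eq_intros)
  ultimately have "((\<lambda>b. h (fst z, b)) has_derivative (\<lambda>b. frechet_derivative h (at z) (0, b))) (at (snd z))"
    using has_derivative_compose by blast
  from fun_cong[OF frechet_derivative_at[OF this]]
  show "frechet_derivative h (at z) (0, w) = frechet_derivative (\<lambda>b. h (fst z, b)) (at (snd z)) w" .
qed

section \<open>Traces and nondegenerate bilinear forms\<close>

lemma linear_eq_sum_Basis:
  fixes L :: "'a::euclidean_space \<Rightarrow> 'b::real_vector"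
  assumes "linear L"
  shows "L x = (\<Sum>i\<in>Basis. (x \<bullet> i) *\<^sub>R L i)"
proof -
  have "L x = L (\<Sum>i\<in>Basis. (x \<bullet> i) *\<^sub>R i)"
    by (simp add: euclidean_representation)
  then show ?thesis using assms by (simp add: linear_sum linear_cmul)
qed

lemma bilinear_eq_sum_Basis:
  fixes B :: "'a::euclidean_space \<Rightarrow> 'b::euclidean_space \<Rightarrow> 'c::real_vector"
  assumes "bilinear B"
  shows "B x y = (\<Sum>i\<in>Basis. \<Sum>j\<in>Basis. (x \<bullet> i * (y \<bullet> j)) *\<^sub>R B i j)"
proof -
  have l: "linear (\<lambda>x. B x y)" "linear (\<lambda>y. B x y)" for x y
    using assms by (auto simp: bilinear_def)
  have "B x y = (\<Sum>i\<in>Basis. (x \<bullet> i) *\<^sub>R B i y)"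
    by (rule linear_eq_sum_Basis[OF l(1)])
  also have "\<dots> = (\<Sum>i\<in>Basis. (x \<bullet> i) *\<^sub>R (\<Sum>j\<in>Basis. (y \<bullet> j) *\<^sub>R B i j))"
    by (subst linear_eq_sum_Basis[OF l(2)]) simp
  finally show ?thesis by (simp add: scaleR_sum_right)
qed

text \<open>This tests membership in \<open>W\<close> by scalar equations, which can be differentiated.\<close>

lemma orthogonal_to_complement_imp_mem:
  fixes W :: "'v::euclidean_space set"
  assumes "subspace W" and "\<And>y. (\<And>w. w \<in> W \<Longrightarrow> w \<bullet> y = 0) \<Longrightarrow> x \<bullet> y = 0"
  shows "x \<in> W"
proof -
  have "x \<in> orthogonal_comp (orthogonal_comp W)"
    using assms(2) by (auto simp: orthogonal_comp_def orthogonal_def inner_commute)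
  then show ?thesis by (simp add: orthogonal_comp_self assms(1))
qed

definition lin_trace :: "('v::euclidean_space \<Rightarrow> 'v) \<Rightarrow> real"
  where "lin_trace L = (\<Sum>i\<in>Basis. L i \<bullet> i)"

lemma lin_trace_add: "lin_trace (\<lambda>a. L a + M a) = lin_trace L + lin_trace M"
  and lin_trace_diff: "lin_trace (\<lambda>a. L a - M a) = lin_trace L - lin_trace M"
  and lin_trace_scaleR: "lin_trace (\<lambda>a. c *\<^sub>R L a) = c * lin_trace L"
  by (simp_all add: lin_trace_def inner_add_left inner_diff_left sum.distrib sum_subtractf
      sum_distrib_left)

lemma lin_trace_rank_one:
  assumes "linear \<phi>" shows "lin_trace (\<lambda>a. \<phi> a *\<^sub>R w) = \<phi> w"
  using linear_eq_sum_Basis[OF assms, of w] by (simp add: lin_trace_def mult.commute)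

text \<open>Coordinates with respect to \<open>B\<close> and with respect to the standard basis, transported by \<open>\<Phi>\<close>, give the
  trace as the same double sum, in two orders of summation.\<close>

lemma trace_in_basis:
  fixes \<Phi> :: "'v::euclidean_space \<Rightarrow> 'e::real_vector"
  assumes \<Phi>: "linear \<Phi>" "inj \<Phi>" and B: "independent B" "span B = range \<Phi>"
    and L: "linear L" and f: "\<And>x. f (\<Phi> x) = \<Phi> (L x)"
  shows "(\<Sum>b\<in>B. representation B (f b) b) = lin_trace L"
proof -
  have range_span: "range \<Phi> = span (\<Phi> ` Basis)"
    using linear_span_image[OF \<Phi>(1), of Basis] by simp
  have fin: "finite B"
    using independent_span_bound[of "\<Phi> ` Basis" B] B range_span span_superset[of B] by auto
  define \<psi> where "\<psi> b = inv \<Phi> b" for b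
  have \<psi>: "\<Phi> (\<psi> b) = b" if "b \<in> B" for b
    using that B(2) span_superset[of B] by (auto simp: \<psi>_def f_inv_into_f)
  have mem: "\<Phi> x \<in> span B" for x by (simp add: B(2))
  define R where "R b x = representation B (\<Phi> x) b" for b x
  have R: "linear (R b)" for b
    unfolding R_def
    by (rule linearI) (simp_all add: linear_add[OF \<Phi>(1)] linear_cmul[OF \<Phi>(1)]
        representation_add[OF B(1) mem mem] representation_scale[OF B(1) mem])
  have sum_R: "(\<Sum>b\<in>B. R b x *\<^sub>R \<psi> b) = x" for x
  proof -
    have "\<Phi> (\<Sum>b\<in>B. R b x *\<^sub>R \<psi> b) = (\<Sum>b\<in>B. R b x *\<^sub>R b)"
      by (simp add: linear_sum[OF \<Phi>(1)] linear_cmul[OF \<Phi>(1)] \<psi>)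
    also have "\<dots> = \<Phi> x"
      unfolding R_def by (rule sum_representation_eq[OF B(1) mem fin order_refl])
    finally show ?thesis using \<Phi>(2) by (simp add: inj_eq)
  qed
  have "(\<Sum>b\<in>B. representation B (f b) b) = (\<Sum>b\<in>B. R b (L (\<psi> b)))"
    by (rule sum.cong[OF refl]) (metis R_def \<psi> f)
  also have "\<dots> = (\<Sum>b\<in>B. \<Sum>i\<in>Basis. (\<psi> b \<bullet> i) * R b (L i))"
  proof (rule sum.cong[OF refl])
    show "R b (L (\<psi> b)) = (\<Sum>i\<in>Basis. (\<psi> b \<bullet> i) * R b (L i))" for b
      using linear_eq_sum_Basis[OF linear_compose[OF L R], of b "\<psi> b"] by simp
  qed
  also have "\<dots> = (\<Sum>i\<in>Basis. (\<Sum>b\<in>B. R b (L i) *\<^sub>R \<psi> b) \<bullet> i)"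
    by (subst sum.swap) (simp add: inner_sum_left mult.commute)
  finally show ?thesis
    by (simp add: sum_R lin_trace_def)
qed

lemma trace_on_range:
  fixes \<Phi> :: "'v::euclidean_space \<Rightarrow> 'e::real_vector"
  assumes "linear \<Phi>" "inj \<Phi>" "linear L" "\<And>x. f (\<Phi> x) = \<Phi> (L x)"
  shows "trace_on (range \<Phi>) f = lin_trace L"
proof -
  have sub: "subspace (range \<Phi>)"
    using linear_subspace_image[OF assms(1)] by simp
  obtain B where B: "B \<subseteq> range \<Phi>" "independent B" "range \<Phi> \<subseteq> span B"
    by (rule real_vector.basis_exists[of "range \<Phi>"])
  have "\<exists>B. independent B \<and> span B = range \<Phi>"
    using span_subspace[OF B(1,3) sub] B(2) by (intro exI[of _ B]) simp
  from someI_ex[OF this] show ?thesis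
    unfolding trace_on_def Let_def by (intro trace_in_basis[OF assms(1,2) _ _ assms(3,4)]) auto
qed

text \<open>In a basis that extends a basis of \<open>W\<close>, the diagonal entries of \<open>Q\<close> are 1 on the part in \<open>W\<close>
  and 0 elsewhere.\<close>

lemma lin_trace_projection:
  fixes Q :: "'v::euclidean_space \<Rightarrow> 'v"
  assumes "linear Q" "\<And>x. Q x \<in> W" "\<And>x. x \<in> W \<Longrightarrow> Q x = x" "subspace W"
  shows "lin_trace Q = dim W"
proof -
  obtain B where B: "B \<subseteq> W" "independent B" "W \<subseteq> span B" "card B = dim W"
    using basis_exists by blast
  obtain C where C: "B \<subseteq> C" "independent C" "span C = UNIV"
    by (rule maximal_independent_subset_extend[of B UNIV]) (use B(2) in \<open>simp_all add: top.extremum_unique\<close>)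
  have fin: "finite C" using C(2) by (simp add: independent_imp_finite)
  have "representation C (Q b) b = (if b \<in> B then 1 else 0)" if "b \<in> C" for b
  proof (cases "b \<in> B")
    case True
    then show ?thesis
      using assms(3)[of b] B(1) that representation_basis[OF C(2)] by auto
  next
    case False
    have "Q b \<in> span B" using assms(2) B(3) by blast
    then have "representation C (Q b) = representation B (Q b)"
      using representation_extend[OF C(2) _ C(1)] by blast
    then show ?thesis
      using False representation_ne_zero[of B "Q b" b] by auto
  qed
  then have "(\<Sum>b\<in>C. representation C (Q b) b) = (\<Sum>b\<in>C. if b \<in> B then 1 else 0)"
    by (rule sum.cong[OF refl])
  also have "\<dots> = card B"
    using fin C(1) by (simp add: sum.If_cases Int_absorb1)
  finally show ?thesis
    using trace_in_basis[of "\<lambda>x. x" C Q Q] C(2,3) assms(1) B(4) by (simp add: linear_id[unfolded id_def])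
qed

text \<open>Sending \<open>x \<in> W\<close> to the values of \<open>g x\<close> on a basis of \<open>W\<close>, used as coefficients, is an injective
  endomorphism of \<open>W\<close>, hence surjective.\<close>

lemma nondegenerate_represents_functional:
  fixes g :: "'v::euclidean_space \<Rightarrow> 'v \<Rightarrow> real"
  assumes g: "bilinear g" and W: "subspace W"
    and nondeg: "\<And>x. x \<in> W \<Longrightarrow> (\<And>y. y \<in> W \<Longrightarrow> g x y = 0) \<Longrightarrow> x = 0"
    and \<phi>: "linear \<phi>"
  shows "\<exists>w\<in>W. \<forall>y\<in>W. g w y = \<phi> y"
proof -
  obtain B where B: "B \<subseteq> W" "independent B" "W \<subseteq> span B"
    by (rule real_vector.basis_exists[of W])
  have fin: "finite B" using B(2) by (simp add: independent_imp_finite)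
  have gl: "linear (g x)" for x using g by (simp add: bilinear_def)
  define T where "T x = (\<Sum>b\<in>B. g x b *\<^sub>R b)" for x
  have T: "linear T"
    using g by (auto simp: T_def linear_iff bilinear_def scaleR_add_left sum.distrib scaleR_sum_right)
  have T_eq: "g x y = \<phi>' y" if "T x = (\<Sum>b\<in>B. \<phi>' b *\<^sub>R b)" "linear \<phi>'" "y \<in> W" for x y \<phi>'
  proof -
    have "(\<Sum>b\<in>B. (g x b - \<phi>' b) *\<^sub>R b) = 0"
      using that(1) by (simp add: T_def scaleR_diff_left sum_subtractf)
    then have "g x b = \<phi>' b" if "b \<in> B" for b
      using independentD[OF B(2) fin order_refl _ that, of "\<lambda>b. g x b - \<phi>' b"] by simp
    then show ?thesis
      using linear_eq_on_span[OF gl that(2)] B(3) that(3) by blast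
  qed
  have "inj_on T W"
    unfolding linear_inj_on_iff_eq_0[OF T W]
  proof (intro ballI impI)
    fix x assume x: "x \<in> W" "T x = 0"
    have "g x y = 0" if "y \<in> W" for y
      using T_eq[of x "\<lambda>_. 0", OF _ _ that] x(2) by (simp add: linear_zero)
    then show "x = 0" using nondeg x(1) by blast
  qed
  then have "dim (T ` W) = dim W"
    using dim_image_eq[OF T, of W] W by (simp add: span_eq_iff[THEN iffD2, OF W])
  moreover have "T ` W \<subseteq> W"
    using B(1) W by (auto simp: T_def intro!: subspace_sum subspace_scale)
  ultimately have "T ` W = W"
    using subspace_dim_equal[OF linear_subspace_image[OF T W] W] by simp
  moreover have "(\<Sum>b\<in>B. \<phi> b *\<^sub>R b) \<in> W"
    using B(1) W by (auto intro!: subspace_sum subspace_scale)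
  ultimately obtain w where "w \<in> W" "T w = (\<Sum>b\<in>B. \<phi> b *\<^sub>R b)"
    by (metis imageE)
  then show ?thesis using T_eq[OF _ \<phi>] by blast
qed

section \<open>Torsion-free coefficients with prescribed trace\<close>

text \<open>Read \<open>\<Gamma>\<close> as the constant part of a connection and \<open>C\<close> as that of the bracket.  Skewness makes the
  connection compatible with the pairing, the condition on the cyclic sum makes it torsion-free, and the
  trace is its divergence.  The dimensions \<open>r\<close> of \<open>W\<close>
  and of its complement enter through the factors \<open>1 - r\<close>, which have to be inverted in order to correct the
  trace.\<close>

lemma exists_connection_coefficients:
  fixes g :: "'v::euclidean_space \<Rightarrow> 'v \<Rightarrow> real" and C :: "'v \<Rightarrow> 'v \<Rightarrow> 'v \<Rightarrow> real"
  assumes g: "bilinear g" and g_sym: "\<And>x y. g x y = g y x"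
    and g_nondeg: "\<And>x. (\<And>y. g x y = 0) \<Longrightarrow> x = 0"
    and C_linear: "\<And>y z. linear (\<lambda>x. C x y z)"
    and C_skew: "\<And>x y z. C y x z = - C x y z" "\<And>x y z. C x z y = - C x y z"
    and c: "linear c" and W: "subspace W"
    and W_nondeg: "\<And>x. x \<in> W \<Longrightarrow> (\<And>y. y \<in> W \<Longrightarrow> g x y = 0) \<Longrightarrow> x = 0"
    and dims: "dim W \<noteq> 1" "dim W + 1 \<noteq> DIM('v)"
  obtains \<Gamma> where "bilinear \<Gamma>" and "\<And>x y z. g (\<Gamma> x y) z = - g y (\<Gamma> x z)"
    and "\<And>x y z. g (\<Gamma> x y) z + g (\<Gamma> y z) x + g (\<Gamma> z x) y = C x y z"
    and "\<And>x y. y \<in> W \<Longrightarrow> \<Gamma> x y \<in> W" and "\<And>y. lin_trace (\<lambda>x. \<Gamma> x y) = c y"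
proof -
  note g_simps = bilinear_ladd[OF g] bilinear_radd[OF g] bilinear_lsub[OF g] bilinear_rsub[OF g]
    bilinear_lmul[OF g] bilinear_rmul[OF g] bilinear_lzero[OF g] bilinear_rzero[OF g]
  have g_linear: "linear (g x)" for x using g by (simp add: bilinear_def)
  have g_eqI: "x = y" if "\<And>z. g x z = g y z" for x y
    using g_nondeg[of "x - y"] that by (simp add: g_simps)
  have riesz: "\<exists>w. \<forall>y. g w y = \<phi> y" if "linear \<phi>" for \<phi>
    using nondegenerate_represents_functional[OF g subspace_UNIV _ that] g_nondeg by auto
  have C1: "C (x + x') y z = C x y z + C x' y z" "C (r *\<^sub>R x) y z = r * C x y z" for x x' y z r
    using C_linear linear_add[of "\<lambda>x. C x y z"] linear_cmul[of "\<lambda>x. C x y z"] by auto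
  have C2: "C x (y + y') z = C x y z + C x y' z" "C x (r *\<^sub>R y) z = r * C x y z" for x y y' z r
    using C_skew(1)[of x] C1 by auto
  have C3: "C x y (z + z') = C x y z + C x y z'" "C x y (r *\<^sub>R z) = r * C x y z" for x y z z' r
    using C_skew(2)[of x y] C2 by auto

  \<comment> \<open>\<open>Q\<close> is the orthogonal projection onto \<open>W\<close>, and \<open>P = 1 - Q\<close> the one onto its complement.\<close>
  have "\<exists>q\<in>W. \<forall>y\<in>W. g q y = g x y" for x
    by (rule nondegenerate_represents_functional[OF g W W_nondeg g_linear])
  then obtain Q where Q_in: "\<And>x. Q x \<in> W" and Q: "\<And>x y. y \<in> W \<Longrightarrow> g (Q x) y = g x y"
    by metis
  have Q_unique: "q = Q x" if "q \<in> W" "\<And>y. y \<in> W \<Longrightarrow> g q y = g x y" for q x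
    using W_nondeg[of "q - Q x"] that Q Q_in W by (simp add: subspace_diff g_simps)
  have Q_linear: "linear Q"
    by (rule linearI; rule Q_unique[symmetric])
      (use W Q_in Q in \<open>auto simp: subspace_add subspace_scale g_simps\<close>)
  have Q_id: "Q x = x" if "x \<in> W" for x
    using Q_unique[OF that, of x] by simp
  define P where "P x = x - Q x" for x
  have P_linear: "linear P"
    unfolding P_def using Q_linear by (simp add: linear_iff algebra_simps)
  have PQ: "P x + Q x = x" for x by (simp add: P_def)
  note PQ_simps = linear_add[OF P_linear] linear_add[OF Q_linear]
    linear_cmul[OF P_linear] linear_cmul[OF Q_linear]
  have QQ: "Q (Q x) = Q x" for x by (rule Q_id[OF Q_in])
  have idem: "P (P x) = P x" "P (Q x) = 0" "Q (P x) = 0" for x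
    by (simp_all add: P_def QQ linear_diff[OF Q_linear])
  have orth: "g (P x) (Q y) = 0" "g (Q x) (P y) = 0" for x y
    using Q[OF Q_in, of y x] Q[OF Q_in, of x y] g_sym by (simp_all add: P_def g_simps)
  have gP: "g (P x) y = g (P x) (P y)" "g x (P y) = g (P x) (P y)" for x y
    using arg_cong[OF PQ[of y], of "g (P x)"] arg_cong[OF PQ[of x], of "\<lambda>x. g x (P y)"] orth
    by (simp_all add: g_simps)
  have gQ: "g (Q x) y = g (Q x) (Q y)" "g x (Q y) = g (Q x) (Q y)" for x y
    using arg_cong[OF PQ[of y], of "g (Q x)"] arg_cong[OF PQ[of x], of "\<lambda>x. g x (Q y)"] orth
    by (simp_all add: g_simps)
  have in_W: "x \<in> W" if "\<And>z. g x (P z) = 0" for x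
  proof -
    have "P x = 0" using g_nondeg[of "P x"] that gP by auto
    then show ?thesis using PQ[of x] Q_in[of x] by simp
  qed

  \<comment> \<open>In the cyclic sum, arguments from the same summand give three times \<open>C / 3\<close>.  With mixed arguments,
    only the rotation whose last two arguments share a summand contributes.\<close>
  define K where "K x y z = C (P x) (P y) (P z) / 3 + C (Q x) (P y) (P z)
    + C (Q x) (Q y) (Q z) / 3 + C (P x) (Q y) (Q z)" for x y z
  have K_linear: "linear (\<lambda>x. K x y z)" "linear (\<lambda>y. K x y z)" "linear (\<lambda>z. K x y z)" for x y z
    by (rule linearI; simp add: K_def PQ_simps C1 C2 C3 algebra_simps add_divide_distrib)+
  have K_skew: "K x z y = - K x y z" for x y z
    using C_skew(2)[of "P x" "P y" "P z"] C_skew(2)[of "Q x" "P y" "P z"]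
      C_skew(2)[of "Q x" "Q y" "Q z"] C_skew(2)[of "P x" "Q y" "Q z"]
    by (simp add: K_def)
  have C_cyc: "C x y z = C y z x" for x y z
    using C_skew(1)[of x y z] C_skew(2)[of y z x] by simp
  have K_cyc: "K x y z + K y z x + K z x y = C x y z" for x y z
  proof -
    have "C x y z = C (P x + Q x) (P y + Q y) (P z + Q z)" by (simp add: PQ)
    also have "\<dots> = C (P x) (P y) (P z) + C (Q x) (P y) (P z) + C (P x) (Q y) (P z)
      + C (P x) (P y) (Q z) + C (Q x) (Q y) (P z) + C (Q x) (P y) (Q z) + C (P x) (Q y) (Q z)
      + C (Q x) (Q y) (Q z)"
      by (simp add: C1 C2 C3)
    also have "\<dots> = K x y z + K y z x + K z x y"
      using C_cyc[of "P x" "P y" "P z"] C_cyc[of "P z" "P x" "P y"]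
        C_cyc[of "Q x" "Q y" "Q z"] C_cyc[of "Q z" "Q x" "Q y"]
        C_cyc[of "P x" "Q y" "P z"] C_cyc[of "Q z" "P x" "P y"]
        C_cyc[of "Q x" "P y" "Q z"] C_cyc[of "P z" "Q x" "Q y"]
      by (simp add: K_def)
    finally show ?thesis by simp
  qed
  have "\<exists>w. \<forall>z. g w z = K x y z" for x y
    by (rule riesz[OF K_linear(3)])
  then obtain \<Gamma>\<^sub>0 where \<Gamma>\<^sub>0: "\<And>x y z. g (\<Gamma>\<^sub>0 x y) z = K x y z" by metis
  have \<Gamma>\<^sub>0_bilinear: "bilinear \<Gamma>\<^sub>0"
    unfolding bilinear_def
    by (intro conjI allI linearI; rule g_eqI)
      (simp_all add: g_simps \<Gamma>\<^sub>0 linear_add[OF K_linear(1)] linear_add[OF K_linear(2)]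
        linear_cmul[OF K_linear(1)] linear_cmul[OF K_linear(2)])
  have \<Gamma>\<^sub>0_W: "\<Gamma>\<^sub>0 x y \<in> W" if "y \<in> W" for x y
  proof (rule in_W)
    have "P y = 0" using Q_id[OF that] by (simp add: P_def)
    moreover have "C u 0 w = 0" "C u v 0 = 0" for u v w using C2(2)[of u 0] C3(2)[of u v 0] by auto
    ultimately show "g (\<Gamma>\<^sub>0 x y) (P z) = 0" for z
      by (simp add: \<Gamma>\<^sub>0 K_def idem)
  qed

  define \<tau> where "\<tau> y = lin_trace (\<lambda>x. \<Gamma>\<^sub>0 x y)" for y
  have \<tau>: "linear \<tau>"
    by (rule linearI) (simp_all add: \<tau>_def bilinear_radd[OF \<Gamma>\<^sub>0_bilinear]
        bilinear_rmul[OF \<Gamma>\<^sub>0_bilinear] lin_trace_add lin_trace_scaleR)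
  have tr_Q: "lin_trace Q = dim W"
    by (rule lin_trace_projection[OF Q_linear Q_in Q_id W])
  have tr_P: "lin_trace P = DIM('v) - real (dim W)"
    by (simp add: P_def[abs_def] lin_trace_diff tr_Q lin_trace_def[of "\<lambda>x. x"])
  have ne: "1 - lin_trace P \<noteq> 0" "1 - lin_trace Q \<noteq> 0"
    using dims unfolding tr_Q tr_P by linarith+
  have lin: "linear (\<lambda>y. (c y - \<tau> y) / r)" for r
    by (rule linearI) (simp_all add: linear_add[OF c] linear_add[OF \<tau>] linear_cmul[OF c]
        linear_cmul[OF \<tau>] diff_divide_distrib add_divide_distrib algebra_simps)
  \<comment> \<open>The terms with \<open>e\<close> change the trace by \<open>(1 - lin_trace P) * g (P e) y\<close>, those with \<open>f\<close> likewise; both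
    vectors are chosen to make up for the defect \<open>c - \<tau>\<close> on their summand.\<close>
  obtain e where e: "\<And>y. g e y = (c y - \<tau> y) / (1 - lin_trace P)"
    using riesz[OF lin] by blast
  obtain f where f: "\<And>y. g f y = (c y - \<tau> y) / (1 - lin_trace Q)"
    using riesz[OF lin] by blast
  define \<Gamma> where "\<Gamma> x y = \<Gamma>\<^sub>0 x y + (g (P x) (P y) *\<^sub>R P e - g (P e) (P y) *\<^sub>R P x)
    + (g (Q x) (Q y) *\<^sub>R Q f - g (Q f) (Q y) *\<^sub>R Q x)" for x y
  have g\<Gamma>: "g (\<Gamma> x y) z = K x y z + (g (P x) (P y) * g (P e) (P z) - g (P e) (P y) * g (P x) (P z))
      + (g (Q x) (Q y) * g (Q f) (Q z) - g (Q f) (Q y) * g (Q x) (Q z))" for x y z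
    unfolding \<Gamma>_def using gP(1)[of _ z] gQ(1)[of _ z] by (simp add: g_simps \<Gamma>\<^sub>0)
  have "bilinear \<Gamma>"
    unfolding bilinear_def \<Gamma>_def
    by (intro conjI allI linearI)
      (simp_all add: bilinear_ladd[OF \<Gamma>\<^sub>0_bilinear] bilinear_radd[OF \<Gamma>\<^sub>0_bilinear]
        bilinear_lmul[OF \<Gamma>\<^sub>0_bilinear] bilinear_rmul[OF \<Gamma>\<^sub>0_bilinear] PQ_simps g_simps algebra_simps)
  moreover have "g (\<Gamma> x y) z = - g y (\<Gamma> x z)" for x y z
    unfolding g_sym[of y] g\<Gamma> using K_skew[of x y z] by simp
  moreover have "g (\<Gamma> x y) z + g (\<Gamma> y z) x + g (\<Gamma> z x) y = C x y z" for x y z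
    unfolding g\<Gamma> K_cyc[symmetric] using g_sym by (simp add: mult.commute)
  moreover have "\<Gamma> x y \<in> W" if "y \<in> W" for x y
  proof -
    have "P y = 0" using Q_id[OF that] by (simp add: P_def)
    then show ?thesis
      unfolding \<Gamma>_def using \<Gamma>\<^sub>0_W[OF that] Q_in W
      by (simp add: g_simps subspace_add subspace_diff subspace_scale)
  qed
  moreover have "lin_trace (\<lambda>x. \<Gamma> x y) = c y" for y
  proof -
    have lP: "linear (\<lambda>x. g (P x) (P y))" and lQ: "linear (\<lambda>x. g (Q x) (Q y))"
      by (rule linearI; simp add: PQ_simps g_simps)+
    have "lin_trace (\<lambda>x. \<Gamma> x y) = \<tau> y + (g (P e) (P y)) * (1 - lin_trace P)
        + (g (Q f) (Q y)) * (1 - lin_trace Q)"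
      unfolding \<Gamma>_def lin_trace_add lin_trace_diff lin_trace_scaleR lin_trace_rank_one[OF lP]
        lin_trace_rank_one[OF lQ]
      by (simp add: \<tau>_def idem QQ algebra_simps)
    also have "\<dots> = \<tau> y + (c (P y) - \<tau> (P y)) + (c (Q y) - \<tau> (Q y))"
      using ne by (simp add: gP(2)[symmetric] gQ(2)[symmetric] e f)
    also have "\<dots> = c y"
      using linear_add[OF c, of "P y" "Q y"] linear_add[OF \<tau>, of "P y" "Q y"] by (simp add: PQ)
    finally show ?thesis .
  qed
  ultimately show thesis by (rule that)
qed

section \<open>Charts and smooth functions on a manifold\<close>

lemma sum_fun_apply: "(\<Sum>i\<in>I. F i) x = (\<Sum>i\<in>I. F i x)"
  by (induction I rule: infinite_finite_induct) auto

context smooth_manifold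
begin

lemma chart_at:
  obtains U \<phi> where "(U, \<phi>) \<in> A" "p \<in> U"
proof -
  have "p \<in> \<Union> (fst ` A)" by (simp add: cover)
  then show thesis using that by (auto simp: split_paired_all)
qed

context
  fixes U \<phi> assumes U: "(U, \<phi>) \<in> A"
begin

lemma open_chart: "open U" "open (\<phi> ` U)"
  using charts[OF U] by auto

lemma chart_inverse [simp]: "x \<in> U \<Longrightarrow> inv_into U \<phi> (\<phi> x) = x"
  using charts[OF U] by (auto simp: homeomorphism_def)

lemma continuous_chart: "continuous_on U \<phi>" "continuous_on (\<phi> ` U) (inv_into U \<phi>)"
  using charts[OF U] by (auto simp: homeomorphism_def)

lemma open_chart_image:
  assumes "open W" shows "open (\<phi> ` (U \<inter> W))"
proof -
  have "\<phi> ` (U \<inter> W) = \<phi> ` U \<inter> inv_into U \<phi> -` W"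
    by (auto simp: image_iff)
  then show ?thesis
    using continuous_open_preimage[OF continuous_chart(2) open_chart(2) assms] by simp
qed

end

lemma smooth_fun_onD: "smooth_fun_on A W f \<Longrightarrow> (U, \<phi>) \<in> A \<Longrightarrow> smooth_on (\<phi> ` (U \<inter> W)) (f \<circ> inv_into U \<phi>)"
  by (auto simp: smooth_fun_on_def)

lemma smooth_fun_onI:
  "(\<And>U \<phi>. (U, \<phi>) \<in> A \<Longrightarrow> smooth_on (\<phi> ` (U \<inter> W)) (f \<circ> inv_into U \<phi>)) \<Longrightarrow> smooth_fun_on A W f"
  by (auto simp: smooth_fun_on_def)

lemma smooth_fun_on_subset: "smooth_fun_on A W f \<Longrightarrow> V \<subseteq> W \<Longrightarrow> smooth_fun_on A V f"
  by (rule smooth_fun_onI) (rule smooth_on_subset[OF smooth_fun_onD], auto)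

lemma smooth_fun_on_cong:
  assumes "open W" "\<And>q. q \<in> W \<Longrightarrow> f q = g q" "smooth_fun_on A W f"
  shows "smooth_fun_on A W g"
  by (rule smooth_fun_onI, rule smooth_on_cong[OF open_chart_image _ smooth_fun_onD[OF assms(3)]])
    (use assms in auto)

lemma smooth_fun_on_const: "smooth_fun_on A W (\<lambda>_. c)"
  by (rule smooth_fun_onI) (simp add: comp_def smooth_on_const)

lemma smooth_fun_on_add:
  "open W \<Longrightarrow> smooth_fun_on A W f \<Longrightarrow> smooth_fun_on A W g \<Longrightarrow> smooth_fun_on A W (\<lambda>p. f p + g p)"
  using smooth_on_add[OF open_chart_image smooth_fun_onD smooth_fun_onD]
  by (auto simp: smooth_fun_on_def comp_def)

lemma smooth_fun_on_mult:
  "open W \<Longrightarrow> smooth_fun_on A W f \<Longrightarrow> smooth_fun_on A W g \<Longrightarrow> smooth_fun_on A W (\<lambda>p. f p * g p)"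
  using smooth_on_mult[OF open_chart_image smooth_fun_onD smooth_fun_onD]
  by (auto simp: smooth_fun_on_def comp_def)

lemma smooth_fun_on_sum:
  "open W \<Longrightarrow> (\<And>i. i \<in> I \<Longrightarrow> smooth_fun_on A W (f i)) \<Longrightarrow> smooth_fun_on A W (\<lambda>p. \<Sum>i\<in>I. f i p)"
  by (induction I rule: infinite_finite_induct) (auto intro: smooth_fun_on_const smooth_fun_on_add)

lemma smooth_fun_on_chart: "(U, \<phi>) \<in> A \<Longrightarrow> smooth_fun_on A U (\<lambda>p. \<phi> p $ k)"
proof (rule smooth_fun_onI)
  fix V \<psi> assume "(U, \<phi>) \<in> A" "(V, \<psi>) \<in> A"
  then show "smooth_on (\<psi> ` (V \<inter> U)) ((\<lambda>p. \<phi> p $ k) \<circ> inv_into V \<psi>)"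
    using smooth_on_bounded_linear[OF bounded_linear_vec_nth open_chart_image compatible] open_chart
    by (simp add: comp_def)
qed

lemma smooth_nearI: "open W \<Longrightarrow> p \<in> W \<Longrightarrow> smooth_fun_on A W f \<Longrightarrow> smooth_near A p f"
  by (auto simp: smooth_near_def)

lemma smooth_near_cong_imp:
  assumes "open N" "p \<in> N" "\<And>q. q \<in> N \<Longrightarrow> f q = g q" "smooth_near A p f"
  shows "smooth_near A p g"
proof -
  obtain W where W: "open W" "p \<in> W" "smooth_fun_on A W f"
    using assms(4) by (auto simp: smooth_near_def)
  have "smooth_fun_on A (N \<inter> W) g"
    by (rule smooth_fun_on_cong[OF _ _ smooth_fun_on_subset[OF W(3)]]) (use assms W in auto)
  then show ?thesis using assms W by (intro smooth_nearI[of "N \<inter> W"]) auto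
qed

lemma smooth_near_const: "smooth_near A p (\<lambda>_. c)"
  by (rule smooth_nearI[of UNIV]) (auto intro: smooth_fun_on_const)

lemma smooth_near_add:
  assumes "smooth_near A p f" "smooth_near A p g"
  shows "smooth_near A p (\<lambda>q. f q + g q)"
proof -
  obtain V W where "open V" "p \<in> V" "smooth_fun_on A V f" "open W" "p \<in> W" "smooth_fun_on A W g"
    using assms by (auto simp: smooth_near_def)
  then show ?thesis
    by (intro smooth_nearI[of "V \<inter> W"] smooth_fun_on_add) (auto intro: smooth_fun_on_subset)
qed

lemma smooth_near_mult:
  assumes "smooth_near A p f" "smooth_near A p g"
  shows "smooth_near A p (\<lambda>q. f q * g q)"
proof -
  obtain V W where "open V" "p \<in> V" "smooth_fun_on A V f" "open W" "p \<in> W" "smooth_fun_on A W g"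
    using assms by (auto simp: smooth_near_def)
  then show ?thesis
    by (intro smooth_nearI[of "V \<inter> W"] smooth_fun_on_mult) (auto intro: smooth_fun_on_subset)
qed

lemma smooth_near_sum:
  "(\<And>i. i \<in> I \<Longrightarrow> smooth_near A p (f i)) \<Longrightarrow> smooth_near A p (\<lambda>q. \<Sum>i\<in>I. f i q)"
  by (induction I rule: infinite_finite_induct) (auto intro: smooth_near_const smooth_near_add)

lemma smooth_near_chart: "(U, \<phi>) \<in> A \<Longrightarrow> p \<in> U \<Longrightarrow> smooth_near A p (\<lambda>q. \<phi> q $ k)"
  by (rule smooth_nearI[OF open_chart(1) _ smooth_fun_on_chart])

lemma smooth_near_differentiable:
  assumes "(U, \<phi>) \<in> A" "p \<in> U" "smooth_near A p f"
  shows "(f \<circ> inv_into U \<phi>) differentiable (at (\<phi> p))"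
proof -
  obtain W where "open W" "p \<in> W" "smooth_fun_on A W f"
    using assms(3) by (auto simp: smooth_near_def)
  then show ?thesis
    using smooth_on_imp_differentiable[OF smooth_fun_onD] assms by blast
qed

section \<open>Tangent vectors\<close>

text \<open>Both the identity and the left translations are smooth maps in this sense.  The chain rule for the former
  is the change of charts, for the latter it is the transport of tangent vectors.\<close>

definition smooth_map :: "('g \<Rightarrow> 'g) \<Rightarrow> bool"
  where "smooth_map h \<longleftrightarrow> continuous_on UNIV h \<and>
    (\<forall>(U, \<phi>)\<in>A. \<forall>(V, \<psi>)\<in>A. smooth_on (\<phi> ` (U \<inter> h -` V)) (\<psi> \<circ> h \<circ> inv_into U \<phi>))"

lemma smooth_map_id: "smooth_map (\<lambda>x. x)"
  using compatible by (auto simp: smooth_map_def comp_def continuous_on_id)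

lemma smooth_mapD:
  assumes "smooth_map h" "(U, \<phi>) \<in> A" "(V, \<psi>) \<in> A"
  shows "smooth_on (\<phi> ` (U \<inter> h -` V)) (\<psi> \<circ> h \<circ> inv_into U \<phi>)"
  using assms by (auto simp: smooth_map_def)

lemma smooth_map_open_vimage: "smooth_map h \<Longrightarrow> open W \<Longrightarrow> open (h -` W)"
  by (simp add: smooth_map_def open_vimage)

lemma smooth_fun_on_compose:
  assumes h: "smooth_map h" and W: "open W" and f: "smooth_fun_on A W f"
  shows "smooth_fun_on A (h -` W) (f \<circ> h)"
proof (rule smooth_fun_onI, rule smooth_on_local)
  fix U \<phi> a assume U: "(U, \<phi>) \<in> A" and "a \<in> \<phi> ` (U \<inter> h -` W)"
  then obtain x where x: "x \<in> U" "h x \<in> W" "a = \<phi> x" by auto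
  obtain V \<psi> where V: "(V, \<psi>) \<in> A" "h x \<in> V" by (rule chart_at)
  define N where "N = \<phi> ` (U \<inter> h -` (V \<inter> W))"
  have N: "open N"
    unfolding N_def using U V W h open_chart by (intro open_chart_image smooth_map_open_vimage) auto
  have "smooth_on N (\<lambda>a. (f \<circ> inv_into V \<psi>) ((\<psi> \<circ> h \<circ> inv_into U \<phi>) a))"
  proof (rule smooth_on_compose[OF N open_chart_image[OF V(1) W]])
    show "(\<psi> \<circ> h \<circ> inv_into U \<phi>) ` N \<subseteq> \<psi> ` (V \<inter> W)"
      using U by (auto simp: N_def)
    show "smooth_on N (\<psi> \<circ> h \<circ> inv_into U \<phi>)"
      by (rule smooth_on_subset[OF smooth_mapD[OF h U V(1)]]) (auto simp: N_def)
  qed (rule smooth_fun_onD[OF f V(1)])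
  then have "smooth_on N (f \<circ> h \<circ> inv_into U \<phi>)"
    by (rule smooth_on_cong[OF N, rotated]) (use U V in \<open>auto simp: N_def\<close>)
  then show "\<exists>N. open N \<and> a \<in> N \<and> smooth_on N (f \<circ> h \<circ> inv_into U \<phi>)"
    using N x V by (intro exI[of _ N]) (auto simp: N_def)
qed

lemma smooth_near_compose:
  assumes "smooth_map h" "smooth_near A (h p) f"
  shows "smooth_near A p (f \<circ> h)"
  using assms(2) smooth_fun_on_compose[OF assms(1)] smooth_map_open_vimage[OF assms(1)]
  unfolding smooth_near_def by (meson vimage_eq)

definition chart_vec :: "'g set \<Rightarrow> ('g \<Rightarrow> real ^ 'n) \<Rightarrow> 'g \<Rightarrow> real ^ 'n \<Rightarrow> 'g tvec"
  where "chart_vec U \<phi> p w =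
    (\<lambda>f. if smooth_near A p f then frechet_derivative (f \<circ> inv_into U \<phi>) (at (\<phi> p)) w else 0)"

text \<open>This is the chain rule for the coordinate expressions
  \<open>f \<circ> inv_into V \<psi>\<close> and \<open>\<psi> \<circ> h \<circ> inv_into U \<phi>\<close>.\<close>

lemma chart_vec_compose:
  assumes h: "smooth_map h" and U: "(U, \<phi>) \<in> A" "p \<in> U" and V: "(V, \<psi>) \<in> A" "h p \<in> V"
    and f: "smooth_near A (h p) f"
  shows "chart_vec U \<phi> p w (f \<circ> h)
    = chart_vec V \<psi> (h p) (frechet_derivative (\<psi> \<circ> h \<circ> inv_into U \<phi>) (at (\<phi> p)) w) f"
proof -
  define N where "N = \<phi> ` (U \<inter> h -` V)"
  have N: "open N" "\<phi> p \<in> N"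
    unfolding N_def using U V h open_chart by (auto intro!: open_chart_image smooth_map_open_vimage)
  have d1: "((\<psi> \<circ> h \<circ> inv_into U \<phi>) has_derivative
      frechet_derivative (\<psi> \<circ> h \<circ> inv_into U \<phi>) (at (\<phi> p))) (at (\<phi> p))"
    using smooth_on_imp_differentiable[OF smooth_mapD[OF h U(1) V(1)]] N frechet_derivative_works
    unfolding N_def by blast
  have d2: "((f \<circ> inv_into V \<psi>) has_derivative frechet_derivative (f \<circ> inv_into V \<psi>) (at (\<psi> (h p))))
      (at ((\<psi> \<circ> h \<circ> inv_into U \<phi>) (\<phi> p)))"
    using smooth_near_differentiable[OF V f] U frechet_derivative_works[of "f \<circ> inv_into V \<psi>"]
    by simp
  have d: "((\<lambda>a. (f \<circ> inv_into V \<psi>) ((\<psi> \<circ> h \<circ> inv_into U \<phi>) a)) has_derivative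
      (\<lambda>w. frechet_derivative (f \<circ> inv_into V \<psi>) (at (\<psi> (h p)))
        (frechet_derivative (\<psi> \<circ> h \<circ> inv_into U \<phi>) (at (\<phi> p)) w))) (at (\<phi> p))"
    using has_derivative_compose[OF d1 d2] .
  have "((f \<circ> h \<circ> inv_into U \<phi>) has_derivative
      (\<lambda>w. frechet_derivative (f \<circ> inv_into V \<psi>) (at (\<psi> (h p)))
        (frechet_derivative (\<psi> \<circ> h \<circ> inv_into U \<phi>) (at (\<phi> p)) w))) (at (\<phi> p))"
    by (rule has_derivative_transform_within_open[OF d N]) (use U V in \<open>auto simp: N_def\<close>)
  from frechet_derivative_at[OF this]
  show ?thesis
    using smooth_near_compose[OF h f] f by (simp add: chart_vec_def fun_eq_iff)
qed

lemma chart_vec_in_tangent_space: "(U, \<phi>) \<in> A \<Longrightarrow> p \<in> U \<Longrightarrow> chart_vec U \<phi> p w \<in> tangent_space A p"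
  unfolding tangent_space_def chart_vec_def by blast

text \<open>A vector written in some chart at \<open>p\<close> is rewritten in the given chart by the chain rule for the identity
  map.\<close>

lemma tangent_space_eq_range_chart_vec:
  assumes U: "(U, \<phi>) \<in> A" "p \<in> U"
  shows "tangent_space A p = range (chart_vec U \<phi> p)"
proof
  show "tangent_space A p \<subseteq> range (chart_vec U \<phi> p)"
  proof
    fix v assume "v \<in> tangent_space A p"
    then obtain V \<psi> w where V: "(V, \<psi>) \<in> A" "p \<in> V" "v = chart_vec V \<psi> p w"
      unfolding tangent_space_def chart_vec_def by blast
    have "v = chart_vec U \<phi> p (frechet_derivative (\<phi> \<circ> (\<lambda>x. x) \<circ> inv_into V \<psi>) (at (\<psi> p)) w)"
    proof
      fix f
      show "v f = chart_vec U \<phi> p (frechet_derivative (\<phi> \<circ> (\<lambda>x. x) \<circ> inv_into V \<psi>) (at (\<psi> p)) w) f"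
      proof (cases "smooth_near A p f")
        case True
        then show ?thesis
          using chart_vec_compose[OF smooth_map_id V(1,2) U True, of w] by (simp add: V(3) comp_def)
      qed (simp add: V(3) chart_vec_def)
    qed
    then show "v \<in> range (chart_vec U \<phi> p)" by blast
  qed
qed (use U in \<open>auto intro: chart_vec_in_tangent_space\<close>)

lemma linear_chart_vec:
  assumes "(U, \<phi>) \<in> A" "p \<in> U"
  shows "linear (chart_vec U \<phi> p)"
proof (rule linearI)
  have lin: "linear (frechet_derivative (f \<circ> inv_into U \<phi>) (at (\<phi> p)))" if "smooth_near A p f" for f
    by (rule linear_frechet_derivative[OF smooth_near_differentiable[OF assms that]])
  show "chart_vec U \<phi> p (w + w') = chart_vec U \<phi> p w + chart_vec U \<phi> p w'" for w w'
    by (auto simp: chart_vec_def fun_eq_iff linear_add[OF lin])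
  show "chart_vec U \<phi> p (c *\<^sub>R w) = c *\<^sub>R chart_vec U \<phi> p w" for c w
    by (auto simp: chart_vec_def fun_eq_iff linear_cmul[OF lin] scaleR_fun_def)
qed

lemma subspace_tangent_space: "subspace (tangent_space A p)"
proof -
  obtain U \<phi> where U: "(U, \<phi>) \<in> A" "p \<in> U" by (rule chart_at)
  show ?thesis
    unfolding tangent_space_eq_range_chart_vec[OF U]
    using linear_subspace_image[OF linear_chart_vec[OF U]] by simp
qed

lemma chart_vec_coordinate:
  assumes "(U, \<phi>) \<in> A" "p \<in> U"
  shows "chart_vec U \<phi> p w (\<lambda>q. \<phi> q $ k) = w $ k"
proof -
  have "((\<lambda>a. a $ k) has_derivative (\<lambda>w. w $ k)) (at (\<phi> p))"
    by (rule bounded_linear_imp_has_derivative[OF bounded_linear_vec_nth])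
  then have "(((\<lambda>q. \<phi> q $ k) \<circ> inv_into U \<phi>) has_derivative (\<lambda>w. w $ k)) (at (\<phi> p))"
    by (rule has_derivative_transform_within_open[OF _ open_chart(2)[OF assms(1)]]) (use assms in auto)
  from fun_cong[OF frechet_derivative_at[OF this, symmetric]] show ?thesis
    using smooth_near_chart[OF assms] by (simp add: chart_vec_def comp_def)
qed

lemma tangent_vec_eq_chart_vec:
  assumes "(U, \<phi>) \<in> A" "p \<in> U" "v \<in> tangent_space A p"
  shows "v = chart_vec U \<phi> p (\<chi> k. v (\<lambda>q. \<phi> q $ k))"
proof -
  obtain w where w: "v = chart_vec U \<phi> p w"
    using assms tangent_space_eq_range_chart_vec by blast
  have "w = (\<chi> k. v (\<lambda>q. \<phi> q $ k))"
    by (simp add: vec_eq_iff w chart_vec_coordinate[OF assms(1,2)])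
  then show ?thesis using w by simp
qed

lemma tangent_vec_expand:
  assumes "(U, \<phi>) \<in> A" "p \<in> U" "v \<in> tangent_space A p"
  shows "v f = (\<Sum>k\<in>UNIV. v (\<lambda>q. \<phi> q $ k) * chart_vec U \<phi> p (axis k 1) f)"
proof -
  have "v = chart_vec U \<phi> p (\<Sum>k\<in>UNIV. v (\<lambda>q. \<phi> q $ k) *\<^sub>R axis k 1)"
  proof -
    have coords: "(\<chi> k. v (\<lambda>q. \<phi> q $ k)) = (\<Sum>k\<in>UNIV. v (\<lambda>q. \<phi> q $ k) *\<^sub>R axis k 1)"
      using basis_expansion[of "\<chi> k. v (\<lambda>q. \<phi> q $ k)"] by (simp add: scalar_mult_eq_scaleR)
    show ?thesis using tangent_vec_eq_chart_vec[OF assms] unfolding coords .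
  qed
  also have "\<dots> = (\<Sum>k\<in>UNIV. v (\<lambda>q. \<phi> q $ k) *\<^sub>R chart_vec U \<phi> p (axis k 1))"
    using linear_chart_vec[OF assms(1,2)] by (simp add: linear_sum linear_cmul)
  finally have "v f = (\<Sum>k\<in>UNIV. v (\<lambda>q. \<phi> q $ k) *\<^sub>R chart_vec U \<phi> p (axis k 1)) f"
    by (rule fun_cong)
  then show ?thesis by (simp add: sum_fun_apply scaleR_fun_def)
qed

lemma tangent_vec_not_smooth: "v \<in> tangent_space A p \<Longrightarrow> \<not> smooth_near A p f \<Longrightarrow> v f = 0"
  by (auto simp: tangent_space_def)

lemma tangent_vec_local:
  assumes "v \<in> tangent_space A p" "open N" "p \<in> N" "\<And>q. q \<in> N \<Longrightarrow> f q = g q"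
  shows "v f = v g"
proof -
  obtain U \<phi> where U: "(U, \<phi>) \<in> A" "p \<in> U" by (rule chart_at)
  obtain w where v: "v = chart_vec U \<phi> p w"
    using assms U tangent_space_eq_range_chart_vec by blast
  have "smooth_near A p f \<longleftrightarrow> smooth_near A p g"
    using smooth_near_cong_imp[OF assms(2,3), of f g] smooth_near_cong_imp[OF assms(2,3), of g f]
      assms(4) by auto
  moreover have "frechet_derivative (f \<circ> inv_into U \<phi>) (at (\<phi> p))
      = frechet_derivative (g \<circ> inv_into U \<phi>) (at (\<phi> p))"
    by (rule frechet_derivative_cong_open[OF open_chart_image[OF U(1) assms(2)]])
      (use U assms in auto)
  ultimately show ?thesis by (simp add: v chart_vec_def)
qed

lemma tangent_vec_const: "v \<in> tangent_space A p \<Longrightarrow> v (\<lambda>_. c) = 0"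
  by (auto simp: tangent_space_def comp_def)

lemma tangent_vec_add:
  assumes "v \<in> tangent_space A p" "smooth_near A p f" "smooth_near A p g"
  shows "v (\<lambda>q. f q + g q) = v f + v g"
proof -
  obtain U \<phi> where U: "(U, \<phi>) \<in> A" "p \<in> U" by (rule chart_at)
  obtain w where v: "v = chart_vec U \<phi> p w"
    using assms U tangent_space_eq_range_chart_vec by blast
  have "((\<lambda>a. (f \<circ> inv_into U \<phi>) a + (g \<circ> inv_into U \<phi>) a) has_derivative
      (\<lambda>w. frechet_derivative (f \<circ> inv_into U \<phi>) (at (\<phi> p)) w
        + frechet_derivative (g \<circ> inv_into U \<phi>) (at (\<phi> p)) w)) (at (\<phi> p))"
    using smooth_near_differentiable[OF U] assms(2,3) frechet_derivative_works
    by (intro has_derivative_add) blast+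
  from fun_cong[OF frechet_derivative_at[OF this, symmetric]] show ?thesis
    using assms(2,3) smooth_near_add[OF assms(2,3)] by (simp add: v chart_vec_def comp_def)
qed

lemma tangent_vec_mult:
  assumes "v \<in> tangent_space A p" "smooth_near A p f" "smooth_near A p g"
  shows "v (\<lambda>q. f q * g q) = v f * g p + f p * v g"
proof -
  obtain U \<phi> where U: "(U, \<phi>) \<in> A" "p \<in> U" by (rule chart_at)
  obtain w where v: "v = chart_vec U \<phi> p w"
    using assms U tangent_space_eq_range_chart_vec by blast
  have "((\<lambda>a. (f \<circ> inv_into U \<phi>) a * (g \<circ> inv_into U \<phi>) a) has_derivative
      (\<lambda>w. (f \<circ> inv_into U \<phi>) (\<phi> p) * frechet_derivative (g \<circ> inv_into U \<phi>) (at (\<phi> p)) w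
        + frechet_derivative (f \<circ> inv_into U \<phi>) (at (\<phi> p)) w * (g \<circ> inv_into U \<phi>) (\<phi> p))) (at (\<phi> p))"
    using smooth_near_differentiable[OF U] assms(2,3) frechet_derivative_works
    by (intro has_derivative_mult) blast+
  from fun_cong[OF frechet_derivative_at[OF this, symmetric]] show ?thesis
    using assms(2,3) smooth_near_mult[OF assms(2,3)] U
    by (simp add: v chart_vec_def comp_def)
qed

lemma tangent_vec_cmult:
  "v \<in> tangent_space A p \<Longrightarrow> smooth_near A p f \<Longrightarrow> v (\<lambda>q. c * f q) = c * v f"
  by (subst tangent_vec_mult[OF _ smooth_near_const]) (auto simp: tangent_vec_const)

lemma tangent_vec_sum:
  assumes "v \<in> tangent_space A p" "\<And>i. i \<in> I \<Longrightarrow> smooth_near A p (f i)"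
  shows "v (\<lambda>q. \<Sum>i\<in>I. f i q) = (\<Sum>i\<in>I. v (f i))"
  using assms(2)
proof (induction I rule: infinite_finite_induct)
  case (insert i I)
  then show ?case
    by (simp add: tangent_vec_add[OF assms(1)] smooth_near_sum)
qed (use assms(1) in \<open>auto simp: tangent_vec_const\<close>)

text \<open>Invertibility of \<open>h\<close> ensures that \<open>f\<close> is smooth near \<open>h p\<close> exactly when \<open>f \<circ> h\<close> is smooth
  near \<open>p\<close>, so that the differential again vanishes on the functions that are not smooth.\<close>

lemma differential_in_tangent_space:
  assumes h: "smooth_map h" and k: "smooth_map k" "\<And>x. k (h x) = x" "\<And>x. h (k x) = x"
    and v: "v \<in> tangent_space A p"
  shows "differential h v \<in> tangent_space A (h p)"
proof -
  obtain U \<phi> where U: "(U, \<phi>) \<in> A" "p \<in> U" by (rule chart_at)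
  obtain V \<psi> where V: "(V, \<psi>) \<in> A" "h p \<in> V" by (rule chart_at)
  obtain w where w: "v = chart_vec U \<phi> p w"
    using v U tangent_space_eq_range_chart_vec by blast
  define w' where "w' = frechet_derivative (\<psi> \<circ> h \<circ> inv_into U \<phi>) (at (\<phi> p)) w"
  have "differential h v = chart_vec V \<psi> (h p) w'"
  proof
    fix f
    show "differential h v f = chart_vec V \<psi> (h p) w' f"
    proof (cases "smooth_near A (h p) f")
      case True
      then show ?thesis
        using chart_vec_compose[OF h U V True, of w] by (simp add: differential_def w w'_def)
    next
      case False
      have "\<not> smooth_near A p (f \<circ> h)"
      proof
        assume "smooth_near A p (f \<circ> h)"
        then have "smooth_near A (h p) ((f \<circ> h) \<circ> k)"
          using smooth_near_compose[OF k(1), of "h p"] k(2) by simp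
        then show False using False k(3) by (simp add: comp_def)
      qed
      then show ?thesis
        using False tangent_vec_not_smooth[OF v] by (simp add: differential_def chart_vec_def)
    qed
  qed
  then show ?thesis using chart_vec_in_tangent_space[OF V] by simp
qed

section \<open>Vector fields and their Lie bracket\<close>

lemma vector_field_tangent: "X \<in> vector_fields_on A W \<Longrightarrow> p \<in> W \<Longrightarrow> X p \<in> tangent_space A p"
  by (simp add: vector_fields_on_def)

lemma vector_field_smooth:
  "X \<in> vector_fields_on A W \<Longrightarrow> open V \<Longrightarrow> V \<subseteq> W \<Longrightarrow> smooth_fun_on A V f
    \<Longrightarrow> smooth_fun_on A V (\<lambda>p. X p f)"
  by (simp add: vector_fields_on_def)

lemma vector_field_smooth_near:
  assumes "X \<in> vector_fields_on A UNIV" "smooth_near A p f"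
  shows "smooth_near A p (\<lambda>q. X q f)"
  using assms(2) vector_field_smooth[OF assms(1)] unfolding smooth_near_def by blast

lemma vector_field_sum:
  assumes x: "\<And>i. i \<in> I \<Longrightarrow> smooth_fun_on A W (x i)"
    and X: "\<And>i. i \<in> I \<Longrightarrow> X i \<in> vector_fields_on A W"
  shows "(\<lambda>p. \<Sum>i\<in>I. x i p *\<^sub>R X i p) \<in> vector_fields_on A W"
  unfolding vector_fields_on_def
proof (intro CollectI conjI ballI allI impI)
  show "(\<Sum>i\<in>I. x i p *\<^sub>R X i p) \<in> tangent_space A p" if "p \<in> W" for p
    by (intro subspace_sum subspace_scale subspace_tangent_space vector_field_tangent[OF X that])
  fix V and f :: "'g \<Rightarrow> real" assume V: "open V \<and> V \<subseteq> W \<and> smooth_fun_on A V f"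
  have "smooth_fun_on A V (\<lambda>p. \<Sum>i\<in>I. x i p * X i p f)"
    using V by (intro smooth_fun_on_sum smooth_fun_on_mult smooth_fun_on_subset[OF x]
      vector_field_smooth[OF X]) auto
  then show "smooth_fun_on A V (\<lambda>p. (\<Sum>i\<in>I. x i p *\<^sub>R X i p) f)"
    by (simp add: sum_fun_apply scaleR_fun_def)
qed

text \<open>Near \<open>p\<close>, $Y f = \sum_k Y^k \partial_k f$.  Apply the product rule and expand
  $X(\partial_k f)$ in the same way.\<close>

lemma second_order_action:
  assumes X: "X \<in> vector_fields_on A UNIV" and Y: "Y \<in> vector_fields_on A UNIV"
    and U: "(U, \<phi>) \<in> A" "p \<in> U" and W: "open W" "p \<in> W" "smooth_fun_on A W f"
  defines "pd \<equiv> \<lambda>k q. frechet_derivative (f \<circ> inv_into U \<phi>) (at (\<phi> q)) (axis k 1)"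
  shows "X p (\<lambda>q. Y q f) = (\<Sum>k\<in>UNIV. X p (\<lambda>q. Y q (\<lambda>q. \<phi> q $ k)) * pd k p)
    + (\<Sum>k\<in>UNIV. \<Sum>l\<in>UNIV. Y p (\<lambda>q. \<phi> q $ k) * X p (\<lambda>q. \<phi> q $ l) *
        frechet_derivative (\<lambda>a. frechet_derivative (f \<circ> inv_into U \<phi>) (at a) (axis k 1))
          (at (\<phi> p)) (axis l 1))"
proof -
  have UW: "open (U \<inter> W)" "p \<in> U \<inter> W" using U W open_chart by auto
  have Xp: "X p \<in> tangent_space A p" by (rule vector_field_tangent[OF X UNIV_I])
  have f_smooth: "smooth_on (\<phi> ` (U \<inter> W)) (f \<circ> inv_into U \<phi>)"
    by (rule smooth_fun_onD[OF W(3) U(1)])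
  have pd_smooth: "smooth_near A p (pd k)" for k
  proof (rule smooth_nearI[OF UW], rule smooth_fun_onI)
    fix V \<psi> assume V: "(V, \<psi>) \<in> A"
    have "smooth_on (\<psi> ` (V \<inter> (U \<inter> W)))
      (\<lambda>a. (\<lambda>b. frechet_derivative (f \<circ> inv_into U \<phi>) (at b) (axis k 1)) ((\<phi> \<circ> inv_into V \<psi>) a))"
    proof (rule smooth_on_compose[OF open_chart_image[OF V UW(1)] open_chart_image[OF U(1) W(1)]])
      show "(\<phi> \<circ> inv_into V \<psi>) ` \<psi> ` (V \<inter> (U \<inter> W)) \<subseteq> \<phi> ` (U \<inter> W)"
        using V by auto
      show "smooth_on (\<psi> ` (V \<inter> (U \<inter> W))) (\<phi> \<circ> inv_into V \<psi>)"
        by (rule smooth_on_subset[OF compatible[OF V U(1)]]) auto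
    qed (rule smooth_on_derivative[OF f_smooth])
    then show "smooth_on (\<psi> ` (V \<inter> (U \<inter> W))) (pd k \<circ> inv_into V \<psi>)"
      by (simp add: pd_def comp_def)
  qed
  have coord: "smooth_near A p (\<lambda>q. Y q (\<lambda>q. \<phi> q $ k))" for k
    by (rule vector_field_smooth_near[OF Y smooth_near_chart[OF U]])
  have "X p (\<lambda>q. Y q f) = X p (\<lambda>q. \<Sum>k\<in>UNIV. Y q (\<lambda>q. \<phi> q $ k) * pd k q)"
  proof (rule tangent_vec_local[OF Xp UW])
    fix q assume q: "q \<in> U \<inter> W"
    then have "smooth_near A q f" using W by (auto intro: smooth_nearI)
    then show "Y q f = (\<Sum>k\<in>UNIV. Y q (\<lambda>q. \<phi> q $ k) * pd k q)"
      using tangent_vec_expand[OF U(1) _ vector_field_tangent[OF Y UNIV_I], of q f] q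
      by (simp add: pd_def chart_vec_def)
  qed
  also have "\<dots> = (\<Sum>k\<in>UNIV. X p (\<lambda>q. Y q (\<lambda>q. \<phi> q $ k)) * pd k p
      + Y p (\<lambda>q. \<phi> q $ k) * X p (pd k))"
    by (subst tangent_vec_sum[OF Xp smooth_near_mult[OF coord pd_smooth]])
      (simp add: tangent_vec_mult[OF Xp coord pd_smooth])
  finally have expand: "X p (\<lambda>q. Y q f) = (\<Sum>k\<in>UNIV. X p (\<lambda>q. Y q (\<lambda>q. \<phi> q $ k)) * pd k p
      + Y p (\<lambda>q. \<phi> q $ k) * X p (pd k))" .
  have "X p (pd k) = (\<Sum>l\<in>UNIV. X p (\<lambda>q. \<phi> q $ l) *
      frechet_derivative (\<lambda>a. frechet_derivative (f \<circ> inv_into U \<phi>) (at a) (axis k 1))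
          (at (\<phi> p)) (axis l 1))" for k
  proof -
    have "frechet_derivative (pd k \<circ> inv_into U \<phi>) (at (\<phi> p))
      = frechet_derivative (\<lambda>a. frechet_derivative (f \<circ> inv_into U \<phi>) (at a) (axis k 1)) (at (\<phi> p))"
      by (rule frechet_derivative_cong_open[OF open_chart(2)[OF U(1)]])
        (use U in \<open>auto simp: pd_def\<close>)
    then show ?thesis
      using tangent_vec_expand[OF U Xp, of "pd k"] pd_smooth by (simp add: chart_vec_def)
  qed
  then show ?thesis
    unfolding expand by (simp add: sum.distrib sum_distrib_left mult.assoc)
qed

text \<open>By the symmetry of second derivatives the second-order terms of \<open>X (Y f)\<close> and \<open>Y (X f)\<close> cancel.  What
  is left is the derivative of \<open>f\<close> along the vector with components
  \<open>X (Y \<phi>\<^sub>k) - Y (X \<phi>\<^sub>k)\<close>.\<close>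

lemma lie_bracket_tangent:
  assumes X: "X \<in> vector_fields_on A UNIV" and Y: "Y \<in> vector_fields_on A UNIV"
  shows "lie_bracket A X Y p \<in> tangent_space A p"
proof -
  obtain U \<phi> where U: "(U, \<phi>) \<in> A" "p \<in> U" by (rule chart_at)
  define w :: "real ^ 'n" where "w = (\<chi> k. X p (\<lambda>q. Y q (\<lambda>q. \<phi> q $ k)) - Y p (\<lambda>q. X q (\<lambda>q. \<phi> q $ k)))"
  have "lie_bracket A X Y p f = chart_vec U \<phi> p w f" for f
  proof (cases "smooth_near A p f")
    case True
    then obtain W where W: "open W" "p \<in> W" "smooth_fun_on A W f" by (auto simp: smooth_near_def)
    define d2 where "d2 k l = frechet_derivative (\<lambda>a. frechet_derivative (f \<circ> inv_into U \<phi>) (at a)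
      (axis k 1)) (at (\<phi> p)) (axis l 1)" for k l :: 'n
    have sym: "d2 k l = d2 l k" for k l
      unfolding d2_def
      by (rule second_derivative_symmetric[OF open_chart_image[OF U(1) W(1)] _ smooth_fun_onD[OF W(3) U(1)]])
        (use U W in auto)
    have "(\<Sum>k\<in>UNIV. \<Sum>l\<in>UNIV. Y p (\<lambda>q. \<phi> q $ k) * X p (\<lambda>q. \<phi> q $ l) * d2 k l)
      = (\<Sum>k\<in>UNIV. \<Sum>l\<in>UNIV. X p (\<lambda>q. \<phi> q $ k) * Y p (\<lambda>q. \<phi> q $ l) * d2 k l)"
      by (subst sum.swap) (simp add: sym mult_ac)
    then have "lie_bracket A X Y p f = (\<Sum>k\<in>UNIV. w $ k *
        frechet_derivative (f \<circ> inv_into U \<phi>) (at (\<phi> p)) (axis k 1))"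
      using True unfolding lie_bracket_def second_order_action[OF X Y U W]
        second_order_action[OF Y X U W] d2_def[symmetric]
      by (simp add: w_def left_diff_distrib sum_subtractf)
    also have "\<dots> = chart_vec U \<phi> p w f"
      using tangent_vec_expand[OF U chart_vec_in_tangent_space[OF U], of w f] True
      by (simp add: chart_vec_coordinate[OF U]) (simp add: chart_vec_def)
    finally show ?thesis .
  qed (simp add: lie_bracket_def chart_vec_def)
  then have "lie_bracket A X Y p = chart_vec U \<phi> p w" by blast
  then show ?thesis using chart_vec_in_tangent_space[OF U] by simp
qed

section \<open>Functions with values in a Euclidean space\<close>

definition smooth_vec :: "('g \<Rightarrow> 'v::euclidean_space) \<Rightarrow> bool"
  where "smooth_vec a \<longleftrightarrow> (\<forall>b. smooth_fun A (\<lambda>q. a q \<bullet> b))"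

definition dvec :: "'g tvec \<Rightarrow> ('g \<Rightarrow> 'v::euclidean_space) \<Rightarrow> 'v"
  where "dvec v a = (\<Sum>b\<in>Basis. v (\<lambda>q. a q \<bullet> b) *\<^sub>R b)"

lemma smooth_vecD: "smooth_vec a \<Longrightarrow> smooth_fun A (\<lambda>q. a q \<bullet> b)"
  by (simp add: smooth_vec_def)

lemma smooth_fun_near: "smooth_fun A f \<Longrightarrow> smooth_near A p f"
  by (rule smooth_nearI[of UNIV]) auto

lemmas smooth_vec_near = smooth_fun_near[OF smooth_vecD]

lemma smooth_vecI:
  fixes a :: "'g \<Rightarrow> 'v::euclidean_space"
  assumes "\<And>b. b \<in> Basis \<Longrightarrow> smooth_fun A (\<lambda>q. a q \<bullet> b)"
  shows "smooth_vec a"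
  unfolding smooth_vec_def
proof
  fix b
  have "smooth_fun A (\<lambda>q. \<Sum>i\<in>Basis. a q \<bullet> i * (b \<bullet> i))"
    by (intro smooth_fun_on_sum smooth_fun_on_mult smooth_fun_on_const assms) auto
  then show "smooth_fun A (\<lambda>q. a q \<bullet> b)"
    by (simp add: euclidean_inner[symmetric])
qed

lemma smooth_vec_const: "smooth_vec (\<lambda>_. c)"
  by (auto simp: smooth_vec_def intro: smooth_fun_on_const)

lemma smooth_vec_add: "smooth_vec a \<Longrightarrow> smooth_vec b \<Longrightarrow> smooth_vec (\<lambda>q. a q + b q)"
  by (auto simp: smooth_vec_def inner_add_left intro: smooth_fun_on_add)

lemma smooth_vec_scaleR: "smooth_fun A f \<Longrightarrow> smooth_vec a \<Longrightarrow> smooth_vec (\<lambda>q. f q *\<^sub>R a q)"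
  by (auto simp: smooth_vec_def intro: smooth_fun_on_mult)

lemma smooth_vec_sum: "(\<And>i. i \<in> I \<Longrightarrow> smooth_vec (a i)) \<Longrightarrow> smooth_vec (\<lambda>q. \<Sum>i\<in>I. a i q)"
  by (auto simp: smooth_vec_def inner_sum_left intro: smooth_fun_on_sum)

lemma smooth_vec_linear:
  assumes "linear L" "smooth_vec a" shows "smooth_vec (\<lambda>q. L (a q))"
  by (subst linear_eq_sum_Basis[OF assms(1)])
    (intro smooth_vec_sum smooth_vec_scaleR smooth_vecD[OF assms(2)] smooth_vec_const)

lemma smooth_vec_bilinear:
  assumes "bilinear B" "smooth_vec a" "smooth_vec b" shows "smooth_vec (\<lambda>q. B (a q) (b q))"
  by (subst bilinear_eq_sum_Basis[OF assms(1)])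
    (intro smooth_vec_sum smooth_vec_scaleR smooth_vecD[OF assms(2)] smooth_vecD[OF assms(3)]
      smooth_vec_const smooth_fun_on_mult open_UNIV)

lemma smooth_vec_dvec:
  assumes "X \<in> vector_fields_on A UNIV" "smooth_vec a" shows "smooth_vec (\<lambda>q. dvec (X q) a)"
  unfolding dvec_def
  by (intro smooth_vec_sum smooth_vec_scaleR smooth_vec_const vector_field_smooth[OF assms(1)]
      smooth_vecD[OF assms(2)]) auto

context
  fixes v p assumes v: "v \<in> tangent_space A p"
begin

lemma dvec_inner:
  fixes a :: "'g \<Rightarrow> 'v::euclidean_space"
  assumes "smooth_vec a"
  shows "dvec v a \<bullet> b = v (\<lambda>q. a q \<bullet> b)"
proof -
  have "v (\<lambda>q. a q \<bullet> b) = v (\<lambda>q. \<Sum>i\<in>Basis. b \<bullet> i * (a q \<bullet> i))"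
    by (subst euclidean_inner) (simp add: mult.commute)
  also have "\<dots> = (\<Sum>i\<in>Basis. v (\<lambda>q. b \<bullet> i * (a q \<bullet> i)))"
    by (intro tangent_vec_sum[OF v] smooth_near_mult smooth_near_const smooth_vec_near assms)
  also have "\<dots> = (\<Sum>i\<in>Basis. b \<bullet> i * v (\<lambda>q. a q \<bullet> i))"
    by (simp add: tangent_vec_cmult[OF v smooth_vec_near[OF assms]])
  also have "\<dots> = dvec v a \<bullet> b"
    by (simp add: dvec_def inner_sum_left inner_commute[of b] mult.commute)
  finally show ?thesis by simp
qed

lemma dvec_const: "dvec v (\<lambda>_. c) = 0"
  by (simp add: dvec_def tangent_vec_const[OF v])

lemma dvec_add:
  "smooth_vec a \<Longrightarrow> smooth_vec b \<Longrightarrow> dvec v (\<lambda>q. a q + b q) = dvec v a + dvec v b"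
  by (simp add: dvec_def inner_add_left tangent_vec_add[OF v] smooth_vec_near scaleR_add_left
      sum.distrib)

lemma dvec_scaleR:
  fixes a :: "'g \<Rightarrow> 'v::euclidean_space"
  shows "smooth_fun A f \<Longrightarrow> smooth_vec a \<Longrightarrow> dvec v (\<lambda>q. f q *\<^sub>R a q) = v f *\<^sub>R a p + f p *\<^sub>R dvec v a"
  by (simp add: dvec_def tangent_vec_mult[OF v] smooth_vec_near smooth_fun_near scaleR_add_left
      sum.distrib flip: scaleR_scaleR scaleR_sum_right)
    (simp add: euclidean_representation)

lemma dvec_sum:
  "(\<And>i. i \<in> I \<Longrightarrow> smooth_vec (a i)) \<Longrightarrow> dvec v (\<lambda>q. \<Sum>i\<in>I. a i q) = (\<Sum>i\<in>I. dvec v (a i))"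
  by (induction I rule: infinite_finite_induct) (auto simp: dvec_const dvec_add smooth_vec_sum)

lemma dvec_linear:
  fixes a :: "'g \<Rightarrow> 'v::euclidean_space" and L :: "'v \<Rightarrow> 'w::euclidean_space"
  assumes "linear L" "smooth_vec a"
  shows "dvec v (\<lambda>q. L (a q)) = L (dvec v a)"
proof -
  have "dvec v (\<lambda>q. L (a q)) = dvec v (\<lambda>q. \<Sum>i\<in>Basis. (a q \<bullet> i) *\<^sub>R L i)"
    by (subst linear_eq_sum_Basis[OF assms(1)]) simp
  also have "\<dots> = (\<Sum>i\<in>Basis. dvec v (\<lambda>q. (a q \<bullet> i) *\<^sub>R L i))"
    by (intro dvec_sum smooth_vec_scaleR smooth_vecD assms smooth_vec_const)
  also have "\<dots> = (\<Sum>i\<in>Basis. (dvec v a \<bullet> i) *\<^sub>R L i)"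
    by (simp add: dvec_scaleR smooth_vecD assms smooth_vec_const dvec_const dvec_inner)
  finally show ?thesis by (simp add: linear_eq_sum_Basis[OF assms(1), of "dvec v a"])
qed

lemma dvec_bilinear:
  fixes a :: "'g \<Rightarrow> 'v::euclidean_space" and b :: "'g \<Rightarrow> 'w::euclidean_space"
    and B :: "'v \<Rightarrow> 'w \<Rightarrow> 'x::euclidean_space"
  assumes "bilinear B" "smooth_vec a" "smooth_vec b"
  shows "dvec v (\<lambda>q. B (a q) (b q)) = B (dvec v a) (b p) + B (a p) (dvec v b)"
proof -
  have "dvec v (\<lambda>q. B (a q) (b q))
      = dvec v (\<lambda>q. \<Sum>i\<in>Basis. \<Sum>j\<in>Basis. (a q \<bullet> i * (b q \<bullet> j)) *\<^sub>R B i j)"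
    by (subst bilinear_eq_sum_Basis[OF assms(1)]) simp
  also have "\<dots> = (\<Sum>i\<in>Basis. \<Sum>j\<in>Basis. dvec v (\<lambda>q. (a q \<bullet> i * (b q \<bullet> j)) *\<^sub>R B i j))"
    by (subst dvec_sum, (intro smooth_vec_sum smooth_vec_scaleR smooth_fun_on_mult smooth_vecD assms
          smooth_vec_const open_UNIV)[1], subst dvec_sum, (intro smooth_vec_scaleR smooth_fun_on_mult smooth_vecD assms
          smooth_vec_const open_UNIV)[1], rule refl)
  also have "\<dots> = (\<Sum>i\<in>Basis. \<Sum>j\<in>Basis.
      (dvec v a \<bullet> i * (b p \<bullet> j)) *\<^sub>R B i j + (a p \<bullet> i * (dvec v b \<bullet> j)) *\<^sub>R B i j)"
    by (simp add: dvec_scaleR smooth_fun_on_mult smooth_vecD assms smooth_vec_const dvec_const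
        dvec_inner tangent_vec_mult[OF v] smooth_vec_near scaleR_add_left)
  also have "\<dots> = B (dvec v a) (b p) + B (a p) (dvec v b)"
    by (simp add: sum.distrib bilinear_eq_sum_Basis[OF assms(1), of "dvec v a"]
        bilinear_eq_sum_Basis[OF assms(1), of "a p"])
  finally show ?thesis .
qed

end

lemma dvec_real: "dvec v f = v f" for f :: "'g \<Rightarrow> real"
  by (simp add: dvec_def)

lemma linear_dvec: "linear (\<lambda>v. dvec v a)"
  by (simp add: linear_iff dvec_def scaleR_fun_def scaleR_add_left sum.distrib scaleR_sum_right)

lemma smooth_vec_real: "smooth_fun A f \<Longrightarrow> smooth_vec f"
  by (auto simp: smooth_vec_def intro: smooth_fun_on_mult smooth_fun_on_const)

lemma smooth_vec_Pair: "smooth_vec a \<Longrightarrow> smooth_vec b \<Longrightarrow> smooth_vec (\<lambda>q. (a q, b q))"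
  by (auto simp: smooth_vec_def inner_Pair_0 split_paired_all inner_prod_def intro: smooth_fun_on_add)

lemma tangent_vec_inner:
  fixes a b :: "'g \<Rightarrow> 'v::euclidean_space"
  assumes "v \<in> tangent_space A p" "smooth_vec a" "smooth_vec b"
  shows "v (\<lambda>q. a q \<bullet> b q) = dvec v a \<bullet> b p + a p \<bullet> dvec v b"
proof -
  have "bilinear (inner :: 'v \<Rightarrow> 'v \<Rightarrow> real)"
    using bilinear_conv_bounded_bilinear bounded_bilinear_inner by blast
  from dvec_bilinear[OF assms(1) this assms(2,3)] show ?thesis by (simp add: dvec_real)
qed

end

context lie_group
begin

lemma mul_one [simp]: "mul one x = x" "mul x one = x"
  and mul_ginv [simp]: "mul x (ginv x) = one" "mul (ginv x) x = one"
  and mul_ginv_cancel [simp]: "mul (ginv x) (mul x y) = y" "mul x (mul (ginv x) y) = y"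
  by (simp_all flip: assoc)

section \<open>Smoothness of the group operations\<close>

lemma open_chart_pairs:
  assumes U: "(U, \<phi>) \<in> A" and V: "(V, \<psi>) \<in> A" and N: "open N"
    and m: "continuous_on UNIV (\<lambda>(x, y). m x y)"
  shows "open {(\<phi> x, \<psi> y) | x y. x \<in> U \<and> y \<in> V \<and> m x y \<in> N}" (is "open ?S")
proof -
  have "?S = (\<phi> ` U \<times> \<psi> ` V) \<inter> (\<lambda>z. m (inv_into U \<phi> (fst z)) (inv_into V \<psi> (snd z))) -` N"
    using U V by force
  moreover have "continuous_on (\<phi> ` U \<times> \<psi> ` V) (\<lambda>z. m (inv_into U \<phi> (fst z)) (inv_into V \<psi> (snd z)))"
  proof -
    have "continuous_on (\<phi> ` U \<times> \<psi> ` V) (\<lambda>z. (inv_into U \<phi> (fst z), inv_into V \<psi> (snd z)))"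
      by (intro continuous_on_Pair continuous_on_compose2[OF continuous_chart(2)[OF U]]
          continuous_on_compose2[OF continuous_chart(2)[OF V]] continuous_on_fst continuous_on_snd
          continuous_on_id) auto
    from continuous_on_compose2[OF m this] show ?thesis by simp
  qed
  ultimately show ?thesis
    using continuous_open_preimage[OF _ open_Times[OF open_chart(2)[OF U] open_chart(2)[OF V]] N]
    by simp
qed

text \<open>The axioms speak of the product in one chart.  Locally it stays in such a chart, in which \<open>f\<close> can be
  composed with it.\<close>

lemma smooth_on_chart_pairs_mult:
  assumes U: "(U, \<phi>) \<in> A" and V: "(V, \<psi>) \<in> A" and N: "open N" and f: "smooth_fun_on A N f"
  shows "smooth_on {(\<phi> x, \<psi> y) | x y. x \<in> U \<and> y \<in> V \<and> mul x y \<in> N}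
    (\<lambda>z. f (mul (inv_into U \<phi> (fst z)) (inv_into V \<psi> (snd z))))"
proof (rule smooth_on_local)
  fix z assume "z \<in> {(\<phi> x, \<psi> y) | x y. x \<in> U \<and> y \<in> V \<and> mul x y \<in> N}"
  then obtain x y where z: "z = (\<phi> x, \<psi> y)" "x \<in> U" "y \<in> V" "mul x y \<in> N" by auto
  obtain W \<theta> where W: "(W, \<theta>) \<in> A" "mul x y \<in> W" by (rule chart_at)
  define S where "S = {(\<phi> x, \<psi> y) | x y. x \<in> U \<and> y \<in> V \<and> mul x y \<in> W \<inter> N}"
  have S: "open S"
    unfolding S_def by (rule open_chart_pairs[OF U V _ continuous_mult]) (use N open_chart W in auto)
  have "smooth_on S (\<lambda>z. (f \<circ> inv_into W \<theta>)
      ((\<lambda>(a, b). \<theta> (mul (inv_into U \<phi> a) (inv_into V \<psi> b))) z))"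
  proof (rule smooth_on_compose[OF S open_chart_image[OF W(1) N]])
    show "(\<lambda>(a, b). \<theta> (mul (inv_into U \<phi> a) (inv_into V \<psi> b))) ` S \<subseteq> \<theta> ` (W \<inter> N)"
      using U V by (auto simp: S_def)
    show "smooth_on S (\<lambda>(a, b). \<theta> (mul (inv_into U \<phi> a) (inv_into V \<psi> b)))"
      by (rule smooth_on_subset[OF smooth_mult[OF U V W(1)]]) (auto simp: S_def)
  qed (rule smooth_fun_onD[OF f W(1)])
  then have "smooth_on S (\<lambda>z. f (mul (inv_into U \<phi> (fst z)) (inv_into V \<psi> (snd z))))"
    by (rule smooth_on_cong[OF S, rotated]) (use U V W in \<open>auto simp: S_def\<close>)
  then show "\<exists>N. open N \<and> z \<in> N \<and> smooth_on N (\<lambda>z. f (mul (inv_into U \<phi> (fst z)) (inv_into V \<psi> (snd z))))"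
    using S z W by (intro exI[of _ S]) (auto simp: S_def)
qed

lemma continuous_left_division: "continuous_on UNIV (\<lambda>(x, y). mul (ginv x) y)"
proof -
  have "continuous_on UNIV (\<lambda>z::'g \<times> 'g. (ginv (fst z), snd z))"
    by (intro continuous_on_Pair continuous_on_compose2[OF continuous_inverse] continuous_on_fst
        continuous_on_snd continuous_on_id) auto
  from continuous_on_compose2[OF continuous_mult this] show ?thesis
    by (simp add: case_prod_beta)
qed

text \<open>Where \<open>ginv x\<close> stays in one chart, this is the composition of the inversion with the multiplication read
  in that chart.\<close>

lemma smooth_on_chart_pairs_left_division:
  assumes U: "(U, \<phi>) \<in> A" and V: "(V, \<psi>) \<in> A" and N: "open N" and f: "smooth_fun_on A N f"
  shows "smooth_on {(\<phi> x, \<psi> y) | x y. x \<in> U \<and> y \<in> V \<and> mul (ginv x) y \<in> N}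
    (\<lambda>z. f (mul (ginv (inv_into U \<phi> (fst z))) (inv_into V \<psi> (snd z))))"
proof (rule smooth_on_local)
  fix z assume "z \<in> {(\<phi> x, \<psi> y) | x y. x \<in> U \<and> y \<in> V \<and> mul (ginv x) y \<in> N}"
  then obtain x y where z: "z = (\<phi> x, \<psi> y)" "x \<in> U" "y \<in> V" "mul (ginv x) y \<in> N" by auto
  obtain W \<theta> where W: "(W, \<theta>) \<in> A" "ginv x \<in> W" by (rule chart_at)
  define P where "P = \<phi> ` (U \<inter> ginv -` W)"
  define S where "S = {(\<phi> x, \<psi> y) | x y. x \<in> U \<and> y \<in> V \<and> mul (ginv x) y \<in> N} \<inter> (P \<times> UNIV)"
  have P: "open P"
    unfolding P_def using open_vimage[OF open_chart(1)[OF W(1)] continuous_inverse]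
    by (intro open_chart_image[OF U])
  have in_W: "ginv x \<in> W" if "x \<in> U" "\<phi> x \<in> P" for x
    using that chart_inverse[OF U] unfolding P_def by (metis IntE imageE vimageE)
  have S: "open S"
    unfolding S_def using open_chart_pairs[OF U V N continuous_left_division] P
    by (intro open_Int open_Times) auto
  have "smooth_on S (\<lambda>z. (\<lambda>z. f (mul (inv_into W \<theta> (fst z)) (inv_into V \<psi> (snd z))))
      (\<theta> (ginv (inv_into U \<phi> (fst z))), snd z))"
  proof (rule smooth_on_compose[OF S open_chart_pairs[OF W(1) V N continuous_mult]])
    show "(\<lambda>z. (\<theta> (ginv (inv_into U \<phi> (fst z))), snd z)) ` S
        \<subseteq> {(\<theta> x, \<psi> y) |x y. x \<in> W \<and> y \<in> V \<and> mul x y \<in> N}"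
      using U V in_W by (auto simp: S_def) blast
    have "smooth_on S (\<lambda>z. \<theta> (ginv (inv_into U \<phi> (fst z))))"
    proof (rule smooth_on_compose[OF S P, where f = fst])
      show "smooth_on P (\<lambda>a. \<theta> (ginv (inv_into U \<phi> a)))"
        unfolding P_def by (rule smooth_inverse[OF U W(1)])
    qed (auto simp: S_def intro: smooth_on_linear bounded_linear_fst)
    then show "smooth_on S (\<lambda>z. (\<theta> (ginv (inv_into U \<phi> (fst z))), snd z))"
      by (rule smooth_on_Pair[OF S _ smooth_on_linear[OF bounded_linear_snd]])
  qed (rule smooth_on_chart_pairs_mult[OF W(1) V N f])
  then have "smooth_on S (\<lambda>z. f (mul (ginv (inv_into U \<phi> (fst z))) (inv_into V \<psi> (snd z))))"
    by (rule smooth_on_cong[OF S, rotated]) (use U V W in_W in \<open>auto simp: S_def\<close>)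
  then show "\<exists>N. open N \<and> z \<in> N \<and>
      smooth_on N (\<lambda>z. f (mul (ginv (inv_into U \<phi> (fst z))) (inv_into V \<psi> (snd z))))"
    using S z W by (intro exI[of _ S]) (auto simp: S_def P_def)
qed

lemma smooth_map_left_mult: "smooth_map (mul x)"
  unfolding smooth_map_def
proof (intro conjI ballI, safe)
  show cont: "continuous_on UNIV (mul x)"
  proof -
    have "continuous_on UNIV (\<lambda>y. (x, y))"
      by (intro continuous_on_Pair continuous_on_const continuous_on_id)
    from continuous_on_compose2[OF continuous_mult this] show ?thesis by simp
  qed
  fix U \<phi> V \<psi> assume U: "(U, \<phi>) \<in> A" and V: "(V, \<psi>) \<in> A"
  obtain W \<theta> where W: "(W, \<theta>) \<in> A" "x \<in> W" by (rule chart_at)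
  define N where "N = \<phi> ` (U \<inter> mul x -` V)"
  have N: "open N"
    unfolding N_def using open_vimage[OF open_chart(1)[OF V] cont] by (intro open_chart_image[OF U])
  have "smooth_on N (\<lambda>a. (\<lambda>(a, b). \<psi> (mul (inv_into W \<theta> a) (inv_into U \<phi> b))) (\<theta> x, a))"
  proof (rule smooth_on_compose[OF N open_chart_pairs[OF W(1) U open_chart(1)[OF V] continuous_mult]])
    show "smooth_on {(\<theta> x, \<phi> y) |x y. x \<in> W \<and> y \<in> U \<and> mul x y \<in> V}
        (\<lambda>(a, b). \<psi> (mul (inv_into W \<theta> a) (inv_into U \<phi> b)))"
      by (rule smooth_mult[OF W(1) U V])
    show "(\<lambda>a. (\<theta> x, a)) ` N \<subseteq> {(\<theta> x, \<phi> y) |x y. x \<in> W \<and> y \<in> U \<and> mul x y \<in> V}"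
      using W by (auto simp: N_def)
  qed (intro smooth_on_Pair N smooth_on_const smooth_on_id)
  then show "smooth_on (\<phi> ` (U \<inter> mul x -` V)) (\<psi> \<circ> mul x \<circ> inv_into U \<phi>)"
    using W by (simp add: N_def comp_def)
qed

lemma differential_left_mult_tangent:
  "v \<in> tangent_space A p \<Longrightarrow> differential (mul x) v \<in> tangent_space A (mul x p)"
  by (rule differential_in_tangent_space[OF smooth_map_left_mult smooth_map_left_mult[of "ginv x"]])
    auto

lemma differential_mul_mul: "differential (mul x) (differential (mul y) v) = differential (mul (mul x y)) v"
  by (simp add: differential_def comp_def assoc)

lemma differential_mul_one [simp]: "differential (mul one) v = v"
  by (simp add: differential_def comp_def)

section \<open>The left-invariant frame\<close>

definition base_chart :: "('g, 'n) chart"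
  where "base_chart = (SOME c. c \<in> A \<and> one \<in> fst c)"

abbreviation "base_dom \<equiv> fst base_chart"
abbreviation "base_map \<equiv> snd base_chart"

lemma base_chart: "(base_dom, base_map) \<in> A" "one \<in> base_dom"
proof -
  obtain U \<phi> where "(U, \<phi>) \<in> A" "one \<in> U" by (rule chart_at)
  then have "\<exists>c. c \<in> A \<and> one \<in> fst c" by force
  from someI_ex[OF this] show "(base_dom, base_map) \<in> A" "one \<in> base_dom"
    by (auto simp: base_chart_def)
qed

definition left_field :: "real ^ 'n \<Rightarrow> 'g \<Rightarrow> 'g tvec"
  where "left_field w p = differential (mul p) (chart_vec base_dom base_map one w)"

text \<open>The components of \<open>v\<close> in the left-invariant frame are the derivatives along \<open>v\<close> of the coordinates of
  $p^{-1} q$.  In this form their smooth dependence on \<open>p\<close> follows from that of the division.\<close>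

definition frame_coords :: "'g \<Rightarrow> 'g tvec \<Rightarrow> real ^ 'n"
  where "frame_coords p v = (\<chi> k. v (\<lambda>q. base_map (mul (ginv p) q) $ k))"

lemma left_field_tangent: "left_field w p \<in> tangent_space A p"
  using differential_left_mult_tangent[OF chart_vec_in_tangent_space[OF base_chart], of p]
  by (simp add: left_field_def)

lemma differential_left_field: "differential (mul x) (left_field w p) = left_field w (mul x p)"
  by (simp add: left_field_def differential_mul_mul)

lemma left_field_apply: "left_field w (mul x p) f = left_field w p (f \<circ> mul x)"
  by (simp add: differential_left_field[symmetric] differential_def)

lemma linear_left_field: "linear (\<lambda>w. left_field w p)"
  using linear_chart_vec[OF base_chart]
  by (auto simp: left_field_def differential_def linear_iff scaleR_fun_def fun_eq_iff)

lemma linear_frame_coords: "linear (frame_coords p)"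
  by (rule linearI) (simp_all add: frame_coords_def vec_eq_iff scaleR_fun_def)

lemma frame_coords_left_field [simp]: "frame_coords p (left_field w p) = w"
  by (simp add: frame_coords_def left_field_def differential_def comp_def vec_eq_iff
      chart_vec_coordinate[OF base_chart])

text \<open>Translating \<open>v\<close> to the identity reduces the claim to the expansion of a tangent vector in the base chart.\<close>

lemma left_field_frame_coords:
  assumes "v \<in> tangent_space A p"
  shows "left_field (frame_coords p v) p = v"
proof -
  define v' where "v' = differential (mul (ginv p)) v"
  have "v' \<in> tangent_space A one"
    using differential_left_mult_tangent[OF assms, of "ginv p"] by (simp add: v'_def)
  then have "v' = chart_vec base_dom base_map one (\<chi> k. v' (\<lambda>q. base_map q $ k))"
    by (rule tangent_vec_eq_chart_vec[OF base_chart])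
  also have "(\<chi> k. v' (\<lambda>q. base_map q $ k)) = frame_coords p v"
    by (simp add: frame_coords_def v'_def differential_def comp_def)
  finally have "left_field (frame_coords p v) p = differential (mul p) v'"
    by (simp add: left_field_def)
  then show ?thesis by (simp add: v'_def differential_mul_mul)
qed

lemma frame_expand:
  assumes "v \<in> tangent_space A p"
  shows "v f = (\<Sum>i\<in>Basis. frame_coords p v \<bullet> i * left_field i p f)"
proof -
  have "v = (\<Sum>i\<in>Basis. (frame_coords p v \<bullet> i) *\<^sub>R left_field i p)"
    using linear_eq_sum_Basis[OF linear_left_field, of "frame_coords p v" p]
    by (simp add: left_field_frame_coords[OF assms])
  from fun_cong[OF this, of f] show ?thesis
    by (simp add: sum_fun_apply scaleR_fun_def)
qed

text \<open>In charts, \<open>left_field w p f\<close> is the partial derivative of \<open>(x, y) \<mapsto> f (x y)\<close> in the second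
  variable, at \<open>(p, one)\<close>.\<close>

lemma left_field_vector_field: "left_field w \<in> vector_fields_on A W"
  unfolding vector_fields_on_def
proof (intro CollectI conjI ballI allI impI left_field_tangent)
  fix N and f :: "'g \<Rightarrow> real" assume "open N \<and> N \<subseteq> W \<and> smooth_fun_on A N f"
  then have N: "open N" and f: "smooth_fun_on A N f" by auto
  show "smooth_fun_on A N (\<lambda>p. left_field w p f)"
  proof (rule smooth_fun_onI)
    fix U \<phi> assume U: "(U, \<phi>) \<in> A"
    define S where "S = {(\<phi> x, base_map y) | x y. x \<in> U \<and> y \<in> base_dom \<and> mul x y \<in> N}"
    define h where "h z = f (mul (inv_into U \<phi> (fst z)) (inv_into base_dom base_map (snd z)))" for z
    have S: "open S"
      unfolding S_def by (rule open_chart_pairs[OF U base_chart(1) N continuous_mult])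
    have h: "smooth_on S h"
      unfolding S_def h_def by (rule smooth_on_chart_pairs_mult[OF U base_chart(1) N f])
    have O: "open (\<phi> ` (U \<inter> N))" by (rule open_chart_image[OF U N])
    have "smooth_on (\<phi> ` (U \<inter> N)) (\<lambda>a. (\<lambda>z. frechet_derivative (\<lambda>b. h (fst z, b)) (at (snd z)) w)
        (a, base_map one))"
    proof (rule smooth_on_compose[OF O S _ _ smooth_on_partial_derivative[OF S h]])
      show "(\<lambda>a. (a, base_map one)) ` \<phi> ` (U \<inter> N) \<subseteq> S"
        using base_chart(2) by (force simp: S_def)
    qed (intro smooth_on_Pair O smooth_on_const smooth_on_id)
    then show "smooth_on (\<phi> ` (U \<inter> N)) ((\<lambda>p. left_field w p f) \<circ> inv_into U \<phi>)"
    proof (rule smooth_on_cong[OF O, rotated])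
      fix a assume "a \<in> \<phi> ` (U \<inter> N)"
      then obtain p where p: "p \<in> U" "p \<in> N" "a = \<phi> p" by auto
      have "smooth_near A one (f \<circ> mul p)"
        using smooth_near_compose[OF smooth_map_left_mult, of p one f] smooth_nearI[OF N p(2) f] by simp
      then show "(\<lambda>z. frechet_derivative (\<lambda>b. h (fst z, b)) (at (snd z)) w) (a, base_map one)
          = ((\<lambda>p. left_field w p f) \<circ> inv_into U \<phi>) a"
        using p U by (simp add: left_field_def differential_def chart_vec_def h_def comp_def)
    qed
  qed
qed

text \<open>In a chart, the \<open>k\<close>-th component is the sum of the components of \<open>X\<close> times the partial derivatives of
  $(x, y) \mapsto (x^{-1} y)_k$ in the second variable, on the diagonal.\<close>

lemma smooth_frame_coords:
  assumes N: "open N" and X: "X \<in> vector_fields_on A N"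
  shows "smooth_fun_on A N (\<lambda>p. frame_coords p (X p) $ k)"
proof (rule smooth_fun_onI)
  fix U \<phi> assume U: "(U, \<phi>) \<in> A"
  let ?f = "\<lambda>q. base_map q $ k"
  define S where "S = {(\<phi> x, \<phi> y) | x y. x \<in> U \<and> y \<in> U \<and> mul (ginv x) y \<in> base_dom}"
  define h where "h z = ?f (mul (ginv (inv_into U \<phi> (fst z))) (inv_into U \<phi> (snd z)))" for z
  have S: "open S"
    unfolding S_def by (rule open_chart_pairs[OF U U open_chart(1)[OF base_chart(1)] continuous_left_division])
  have h: "smooth_on S h"
    unfolding S_def h_def
    by (rule smooth_on_chart_pairs_left_division[OF U U open_chart(1)[OF base_chart(1)]
        smooth_fun_on_chart[OF base_chart(1)]])
  have O: "open (\<phi> ` (U \<inter> N))" by (rule open_chart_image[OF U N])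
  have D: "smooth_on (\<phi> ` (U \<inter> N))
      (\<lambda>a. (\<lambda>z. frechet_derivative (\<lambda>b. h (fst z, b)) (at (snd z)) w) (a, a))" for w
  proof (rule smooth_on_compose[OF O S _ _ smooth_on_partial_derivative[OF S h]])
    show "(\<lambda>a. (a, a)) ` \<phi> ` (U \<inter> N) \<subseteq> S"
      using base_chart(2) by (force simp: S_def)
  qed (intro smooth_on_Pair O smooth_on_id)
  have X_smooth: "smooth_on (\<phi> ` (U \<inter> N)) (\<lambda>a. X (inv_into U \<phi> a) (\<lambda>q. \<phi> q $ j))" for j
  proof -
    have "smooth_fun_on A (U \<inter> N) (\<lambda>p. X p (\<lambda>q. \<phi> q $ j))"
      using open_chart(1)[OF U] N
      by (intro vector_field_smooth[OF X] smooth_fun_on_subset[OF smooth_fun_on_chart[OF U]]) auto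
    from smooth_fun_onD[OF this U] show ?thesis by (simp add: comp_def)
  qed
  have "smooth_on (\<phi> ` (U \<inter> N)) (\<lambda>a. \<Sum>j\<in>UNIV. X (inv_into U \<phi> a) (\<lambda>q. \<phi> q $ j) *
      (\<lambda>z. frechet_derivative (\<lambda>b. h (fst z, b)) (at (snd z)) (axis j 1)) (a, a))"
    by (intro smooth_on_sum smooth_on_mult O X_smooth D)
  then show "smooth_on (\<phi> ` (U \<inter> N)) ((\<lambda>p. frame_coords p (X p) $ k) \<circ> inv_into U \<phi>)"
  proof (rule smooth_on_cong[OF O, rotated])
    fix a assume "a \<in> \<phi> ` (U \<inter> N)"
    then obtain p where p: "p \<in> U" "p \<in> N" "a = \<phi> p" by auto
    have "smooth_near A p (?f \<circ> mul (ginv p))"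
      using smooth_near_compose[OF smooth_map_left_mult, of "ginv p" p ?f]
        smooth_near_chart[OF base_chart] by simp
    then show "(\<Sum>j\<in>UNIV. X (inv_into U \<phi> a) (\<lambda>q. \<phi> q $ j) *
      (\<lambda>z. frechet_derivative (\<lambda>b. h (fst z, b)) (at (snd z)) (axis j 1)) (a, a))
      = ((\<lambda>p. frame_coords p (X p) $ k) \<circ> inv_into U \<phi>) a"
      using p U tangent_vec_expand[OF U p(1) vector_field_tangent[OF X p(2)], of "?f \<circ> mul (ginv p)"]
      by (simp add: frame_coords_def chart_vec_def h_def comp_def)
  qed
qed

lemma smooth_vec_frame_coords:
  assumes "X \<in> vector_fields_on A UNIV"
  shows "smooth_vec (\<lambda>p. frame_coords p (X p))"
  by (rule smooth_vecI) (auto simp: Basis_vec_def inner_axis intro: smooth_frame_coords[OF open_UNIV assms])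

section \<open>The Lie bracket in the left-invariant frame\<close>

text \<open>The structure constants of the Lie algebra, extended from the basis so that bilinearity holds by
  construction.\<close>

definition lie_const :: "real ^ 'n \<Rightarrow> real ^ 'n \<Rightarrow> real ^ 'n"
  where "lie_const x y = (\<Sum>i\<in>Basis. \<Sum>j\<in>Basis. (x \<bullet> i * (y \<bullet> j)) *\<^sub>R
    frame_coords one (lie_bracket A (left_field i) (left_field j) one))"

lemma bilinear_lie_const: "bilinear lie_const"
  by (simp add: bilinear_def lie_const_def linear_iff inner_add_left scaleR_add_left sum.distrib
      distrib_left distrib_right scaleR_sum_right mult.assoc mult.left_commute)

lemma lie_bracket_skew: "lie_bracket A Y X p = - lie_bracket A X Y p"
  by (simp add: lie_bracket_def fun_eq_iff)

lemma lie_const_skew: "lie_const y x = - lie_const x y"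
proof -
  have "lie_const y x = (\<Sum>i\<in>Basis. \<Sum>j\<in>Basis. (x \<bullet> i * (y \<bullet> j)) *\<^sub>R
      frame_coords one (lie_bracket A (left_field j) (left_field i) one))"
    unfolding lie_const_def by (subst sum.swap) (simp add: mult.commute)
  then show ?thesis
    by (subst (asm) lie_bracket_skew)
      (simp add: lie_const_def linear_neg[OF linear_frame_coords] sum_negf)
qed

text \<open>A left-invariant field applied at \<open>p\<close> to \<open>f\<close> is the same field applied at the identity to the
  translated function, and this passes to the bracket.\<close>

lemma lie_bracket_left_fields:
  "lie_bracket A (left_field x) (left_field y) p
    = left_field (frame_coords one (lie_bracket A (left_field x) (left_field y) one)) p"
proof
  fix f
  let ?b = "lie_bracket A (left_field x) (left_field y)"
  show "?b p f = left_field (frame_coords one (?b one)) p f"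
  proof (cases "smooth_near A p f")
    case True
    then have "smooth_near A one (f \<circ> mul p)"
      using smooth_near_compose[OF smooth_map_left_mult, of p one f] by simp
    then have "?b p f = ?b one (f \<circ> mul p)"
      using True left_field_apply[of _ p one] by (simp add: lie_bracket_def comp_def left_field_apply)
    also have "\<dots> = left_field (frame_coords one (?b one)) one (f \<circ> mul p)"
      by (simp add: left_field_frame_coords lie_bracket_tangent left_field_vector_field)
    finally show ?thesis using left_field_apply[of _ p one] by simp
  next
    case False
    then show ?thesis
      using tangent_vec_not_smooth[OF left_field_tangent False] by (simp add: lie_bracket_def)
  qed
qed

text \<open>Expand both fields in the left-invariant frame.  The product rule gives the derivatives of the components,
  and the brackets of the frame fields give the structure constants.\<close>

lemma lie_bracket_frame:
  assumes X: "X \<in> vector_fields_on A UNIV" and Y: "Y \<in> vector_fields_on A UNIV"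
  defines "x \<equiv> \<lambda>q. frame_coords q (X q)" and "y \<equiv> \<lambda>q. frame_coords q (Y q)"
  shows "lie_bracket A X Y p = left_field (dvec (X p) y - dvec (Y p) x + lie_const (x p) (y p)) p"
proof
  fix f
  note lf = linear_left_field[of p]
  have Xp: "X p \<in> tangent_space A p" and Yp: "Y p \<in> tangent_space A p"
    using X Y by (auto intro: vector_field_tangent)
  have smooth: "smooth_vec x" "smooth_vec y"
    unfolding x_def y_def using X Y by (auto intro: smooth_vec_frame_coords)
  show "lie_bracket A X Y p f = left_field (dvec (X p) y - dvec (Y p) x + lie_const (x p) (y p)) p f"
  proof (cases "smooth_near A p f")
    case True
    have E: "smooth_near A p (\<lambda>q. left_field i q f)" for i
      by (rule vector_field_smooth_near[OF left_field_vector_field True])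
    have second: "v (\<lambda>q. Z q f) = (\<Sum>j\<in>Basis. v (\<lambda>q. frame_coords q (Z q) \<bullet> j) * left_field j p f)
        + (\<Sum>i\<in>Basis. \<Sum>j\<in>Basis. frame_coords p v \<bullet> i * (frame_coords p (Z p) \<bullet> j) *
            left_field i p (\<lambda>q. left_field j q f))"
      if v: "v \<in> tangent_space A p" and Z: "Z \<in> vector_fields_on A UNIV" for v Z
    proof -
      have z: "smooth_near A p (\<lambda>q. frame_coords q (Z q) \<bullet> j)" for j
        by (rule smooth_vec_near[OF smooth_vec_frame_coords[OF Z]])
      have "v (\<lambda>q. Z q f) = v (\<lambda>q. \<Sum>j\<in>Basis. frame_coords q (Z q) \<bullet> j * left_field j q f)"
        by (subst frame_expand[OF vector_field_tangent[OF Z UNIV_I]]) simp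
      also have "\<dots> = (\<Sum>j\<in>Basis. v (\<lambda>q. frame_coords q (Z q) \<bullet> j) * left_field j p f
          + frame_coords p (Z p) \<bullet> j * v (\<lambda>q. left_field j q f))"
        by (subst tangent_vec_sum[OF v smooth_near_mult[OF z E]]) (simp add: tangent_vec_mult[OF v z E])
      finally show ?thesis
        by (subst (asm) frame_expand[OF v, of "\<lambda>q. left_field j q f" for j])
          (simp add: sum.distrib sum_distrib_left mult.assoc mult.left_commute, subst sum.swap, simp)
    qed
    have lie: "left_field (lie_const x y) p f = (\<Sum>i\<in>Basis. \<Sum>j\<in>Basis. x \<bullet> i * (y \<bullet> j) *
        (left_field i p (\<lambda>q. left_field j q f) - left_field j p (\<lambda>q. left_field i q f)))" for x y
      using True unfolding lie_const_def
      by (simp add: linear_sum[OF lf] linear_cmul[OF lf] lie_bracket_left_fields[symmetric]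
          sum_fun_apply scaleR_fun_def) (simp add: lie_bracket_def)
    have d: "left_field (dvec v z) p f = (\<Sum>j\<in>Basis. v (\<lambda>q. z q \<bullet> j) * left_field j p f)" for v and z :: "'g \<Rightarrow> real ^ 'n"
      by (simp add: dvec_def linear_sum[OF lf] linear_cmul[OF lf] sum_fun_apply scaleR_fun_def)
    have "lie_bracket A X Y p f = X p (\<lambda>q. Y q f) - Y p (\<lambda>q. X q f)"
      using True by (simp add: lie_bracket_def)
    also have "\<dots> = left_field (dvec (X p) y) p f - left_field (dvec (Y p) x) p f
        + left_field (lie_const (x p) (y p)) p f"
      unfolding second[OF Xp Y] second[OF Yp X] d lie unfolding x_def y_def
      by (subst (2) sum.swap) (simp add: algebra_simps sum_subtractf)
    finally show ?thesis
      by (simp add: linear_add[OF lf] linear_diff[OF lf])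
  next
    case False
    then show ?thesis
      using tangent_vec_not_smooth[OF left_field_tangent False] by (simp add: lie_bracket_def)
  qed
qed

end

section \<open>The left-invariant trivialisation of the Courant algebroid\<close>

type_synonym 'n model = "(real ^ 'n) \<times> (real ^ 'n) \<times> real"

definition model_pairing :: "'n::finite model \<Rightarrow> 'n model \<Rightarrow> real"
  where "model_pairing a b = (fst (snd a) \<bullet> fst b + fst (snd b) \<bullet> fst a) / 2 + snd (snd a) * snd (snd b)"

lemma bilinear_model_pairing: "bilinear model_pairing"
  by (simp add: bilinear_def linear_iff model_pairing_def inner_add_left inner_add_right algebra_simps
      add_divide_distrib)

lemma model_pairing_sym: "model_pairing a b = model_pairing b a"
  by (simp add: model_pairing_def algebra_simps)

text \<open>Pairing \<open>a\<close> with the vector in which its first two components are exchanged gives a positive definite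
  form.\<close>

lemma model_pairing_nondegenerate:
  assumes "\<And>b. model_pairing a b = 0" shows "a = 0"
proof -
  have "model_pairing a (fst (snd a), fst a, snd (snd a)) = 0" by (rule assms)
  then have "(fst (snd a) \<bullet> fst (snd a) + fst a \<bullet> fst a) / 2 + snd (snd a) * snd (snd a) = 0"
    by (simp add: model_pairing_def)
  moreover have "0 \<le> fst (snd a) \<bullet> fst (snd a)" "0 \<le> fst a \<bullet> fst a" "0 \<le> snd (snd a) * snd (snd a)"
    by simp_all
  ultimately have "fst (snd a) \<bullet> fst (snd a) = 0" "fst a \<bullet> fst a = 0" "snd (snd a) * snd (snd a) = 0"
    by argo+
  then show ?thesis by (simp add: prod_eq_iff)
qed

lemma linear_fst: "linear fst" and linear_snd: "linear snd"
  by (simp_all add: linear_iff)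

context lie_group
begin

definition covec_coords :: "'g \<Rightarrow> 'g covec \<Rightarrow> real ^ 'n"
  where "covec_coords p \<alpha> = (\<Sum>i\<in>Basis. \<alpha> (left_field i p) *\<^sub>R i)"

text \<open>A covector is extended by 0 to non-tangent arguments, as \<^term>\<open>cotangent_space\<close> requires.\<close>

definition triv :: "'g \<Rightarrow> 'n model \<Rightarrow> 'g E_elem"
  where "triv p a = (left_field (fst a) p,
    (\<lambda>v. if v \<in> tangent_space A p then fst (snd a) \<bullet> frame_coords p v else 0), snd (snd a))"

definition fibre_coords :: "'g \<Rightarrow> 'g E_elem \<Rightarrow> 'n model"
  where "fibre_coords p e = (frame_coords p (fst e), covec_coords p (fst (snd e)), snd (snd e))"

definition section_coords :: "'g E_section \<Rightarrow> 'g \<Rightarrow> 'n model"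
  where "section_coords u p = fibre_coords p (u p)"

lemma cotangent_apply:
  assumes "\<alpha> \<in> cotangent_space A p" "v \<in> tangent_space A p"
  shows "\<alpha> v = covec_coords p \<alpha> \<bullet> frame_coords p v"
proof -
  have lin: "linear (\<lambda>w. \<alpha> (left_field w p))"
    using assms(1) left_field_tangent
    by (auto simp: cotangent_space_def linear_on_def linear_iff linear_add[OF linear_left_field]
        linear_cmul[OF linear_left_field])
  have "\<alpha> v = \<alpha> (left_field (frame_coords p v) p)"
    by (simp add: left_field_frame_coords assms(2))
  also have "\<dots> = (\<Sum>i\<in>Basis. (frame_coords p v \<bullet> i) *\<^sub>R \<alpha> (left_field i p))"
    by (rule linear_eq_sum_Basis[OF lin])
  finally show ?thesis
    by (simp add: covec_coords_def inner_sum_left inner_commute[of "frame_coords p v"] mult.commute)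
qed

lemma linear_triv: "linear (triv p)"
  by (simp add: linear_iff triv_def linear_add[OF linear_left_field] linear_cmul[OF linear_left_field]
      fun_eq_iff scaleR_fun_def inner_add_left)

lemma linear_covec_coords: "linear (covec_coords p)"
  by (simp add: linear_iff covec_coords_def scaleR_fun_def scaleR_add_left sum.distrib scaleR_sum_right)

lemma linear_fibre_coords: "linear (fibre_coords p)"
  by (simp add: linear_iff fibre_coords_def linear_add[OF linear_frame_coords]
      linear_cmul[OF linear_frame_coords] linear_add[OF linear_covec_coords]
      linear_cmul[OF linear_covec_coords])

lemma triv_in_fibre: "triv p a \<in> E_fibre A p"
  by (auto simp: triv_def E_fibre_def cotangent_space_def linear_on_def left_field_tangent
      subspace_add[OF subspace_tangent_space] subspace_scale[OF subspace_tangent_space]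
      linear_add[OF linear_frame_coords] linear_cmul[OF linear_frame_coords] inner_add_right)

lemma fibre_coords_triv [simp]: "fibre_coords p (triv p a) = a"
  by (simp add: fibre_coords_def triv_def covec_coords_def left_field_tangent euclidean_representation)

lemma triv_fibre_coords:
  assumes "e \<in> E_fibre A p" shows "triv p (fibre_coords p e) = e"
proof -
  have e: "fst e \<in> tangent_space A p" "fst (snd e) \<in> cotangent_space A p"
    using assms by (auto simp: E_fibre_def)
  have "v \<notin> tangent_space A p \<Longrightarrow> fst (snd e) v = 0" for v
    using e(2) by (auto simp: cotangent_space_def)
  then show ?thesis
    using cotangent_apply[OF e(2)]
    by (simp add: triv_def fibre_coords_def left_field_frame_coords[OF e(1)] prod_eq_iff fun_eq_iff)
qed

lemma E_fibre_eq: "E_fibre A p = range (triv p)"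
proof (rule set_eqI)
  show "e \<in> E_fibre A p \<longleftrightarrow> e \<in> range (triv p)" for e
    using triv_in_fibre[of p] triv_fibre_coords[of e p] by (metis rangeE rangeI)
qed

lemma inj_triv: "inj (triv p)"
  by (metis fibre_coords_triv injI)

lemma pairing_triv: "pairing (triv p a) (triv p b) = model_pairing a b"
  by (simp add: pairing_def triv_def model_pairing_def left_field_tangent)

lemma differential_tangent_iff:
  "differential (mul (ginv x)) v \<in> tangent_space A p \<longleftrightarrow> v \<in> tangent_space A (mul x p)"
  using differential_left_mult_tangent[of v "mul x p" "ginv x"]
    differential_left_mult_tangent[of "differential (mul (ginv x)) v" p x]
  by (auto simp: differential_mul_mul)

lemma E_action_triv: "E_action mul x (triv p a) = triv (mul x p) a"
proof -
  have inv: "inv (differential (mul x)) = differential (mul (ginv x))"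
    by (rule inv_unique_comp) (simp_all add: fun_eq_iff differential_mul_mul)
  have "frame_coords p (differential (mul (ginv x)) v) = frame_coords (mul x p) v"
    if "v \<in> tangent_space A (mul x p)" for v
  proof -
    have "differential (mul (ginv x)) (left_field (frame_coords (mul x p) v) (mul x p))
        = left_field (frame_coords (mul x p) v) p"
      by (simp add: differential_left_field)
    then show ?thesis
      using left_field_frame_coords[OF that] frame_coords_left_field by metis
  qed
  then show ?thesis
    by (auto simp: E_action_def triv_def differential_left_field inv fun_eq_iff differential_tangent_iff)
qed

lemma section_in_fibre: "u \<in> sections A \<Longrightarrow> u p \<in> E_fibre A p"
  by (simp add: sections_on_def vector_fields_on_def one_forms_on_def E_fibre_def mem_Times_iff)

lemma triv_section_coords: "u \<in> sections A \<Longrightarrow> triv p (section_coords u p) = u p"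
  by (simp add: section_coords_def triv_fibre_coords section_in_fibre)

lemma section_coords_of_triv [simp]: "section_coords (\<lambda>p. triv p (a p)) = a"
  by (simp add: section_coords_def fun_eq_iff)

lemma section_anchor: "u \<in> sections A \<Longrightarrow> tvec_part u \<in> vector_fields_on A UNIV"
  and section_anchor_tangent: "u \<in> sections A \<Longrightarrow> fst (u p) \<in> tangent_space A p"
  and section_covec: "u \<in> sections A \<Longrightarrow> fst (snd (u p)) \<in> cotangent_space A p"
  and section_scal: "u \<in> sections A \<Longrightarrow> smooth_fun A (scal_part u)"
  by (auto simp: sections_on_def vector_fields_on_def one_forms_on_def)

lemma smooth_section_coords:
  assumes "u \<in> sections A" shows "smooth_vec (section_coords u)"
proof -
  have "smooth_fun A (\<lambda>p. fst (snd (u p)) (left_field i p))" for i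
    using assms left_field_vector_field[of i UNIV] by (auto simp: sections_on_def one_forms_on_def)
  then have "smooth_vec (\<lambda>p. covec_coords p (fst (snd (u p))))"
    unfolding covec_coords_def by (intro smooth_vec_sum smooth_vec_scaleR smooth_vec_const)
  then have "smooth_vec (\<lambda>p. (frame_coords p (fst (u p)), covec_coords p (fst (snd (u p))), snd (snd (u p))))"
    by (intro smooth_vec_Pair smooth_vec_frame_coords[OF section_anchor[OF assms]]
        smooth_vec_real[OF section_scal[OF assms]])
  then show ?thesis by (simp add: section_coords_def[abs_def] fibre_coords_def)
qed

text \<open>Smoothness of the vector part is that of the frame, smoothness of the 1-form part is that of the coframe.\<close>

lemma triv_in_sections:
  assumes "smooth_vec a" shows "(\<lambda>p. triv p (a p)) \<in> sections A"
proof -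
  have x: "smooth_vec (\<lambda>p. fst (a p))" by (rule smooth_vec_linear[OF linear_fst assms])
  have y: "smooth_vec (\<lambda>p. fst (snd (a p)))" and l: "smooth_vec (\<lambda>p. snd (snd (a p)))"
    using linear_compose[OF linear_snd linear_fst] linear_compose[OF linear_snd linear_snd]
    by (auto dest: smooth_vec_linear[OF _ assms])
  have "(\<lambda>p. \<Sum>i\<in>Basis. (fst (a p) \<bullet> i) *\<^sub>R left_field i p) \<in> vector_fields_on A UNIV"
    by (intro vector_field_sum smooth_vecD[OF x] left_field_vector_field)
  then have 1: "(\<lambda>p. left_field (fst (a p)) p) \<in> vector_fields_on A UNIV"
    by (subst linear_eq_sum_Basis[OF linear_left_field])
  have 2: "smooth_fun_on A V (\<lambda>p. if X p \<in> tangent_space A p then fst (snd (a p)) \<bullet> frame_coords p (X p) else 0)"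
    if V: "open V" and X: "X \<in> vector_fields_on A V" for V X
  proof (rule smooth_fun_on_cong[OF V])
    show "smooth_fun_on A V (\<lambda>p. \<Sum>k\<in>UNIV. (fst (snd (a p)) \<bullet> axis k 1) * frame_coords p (X p) $ k)"
      by (intro smooth_fun_on_sum smooth_fun_on_mult V smooth_frame_coords[OF V X]
          smooth_fun_on_subset[OF smooth_vecD[OF y]]) auto
    show "(\<Sum>k\<in>UNIV. (fst (snd (a p)) \<bullet> axis k 1) * frame_coords p (X p) $ k)
        = (if X p \<in> tangent_space A p then fst (snd (a p)) \<bullet> frame_coords p (X p) else 0)"
      if "p \<in> V" for p
      using vector_field_tangent[OF X that] by (simp add: inner_axis) (simp add: inner_vec_def)
  qed
  have 3: "fst (snd (triv p (a p))) \<in> cotangent_space A p" for p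
    using triv_in_fibre[of p "a p"] by (auto simp: E_fibre_def)
  have "smooth_fun A (\<lambda>p. snd (snd (a p)))"
    using smooth_vecD[OF l, of 1] by simp
  then show ?thesis
    using 1 2 3 by (simp add: sections_on_def one_forms_on_def triv_def)
qed

lemma left_invariant_triv_const: "left_invariant_section mul (\<lambda>p. triv p a)"
  by (simp add: left_invariant_section_def E_action_triv)

text \<open>The action of \<open>p\<close> on the fibre at the identity does not change the coordinates.\<close>

lemma left_invariant_section_coords:
  assumes "u \<in> sections A" "left_invariant_section mul u"
  shows "section_coords u p = section_coords u one"
proof -
  have "u p = E_action mul p (u one)"
    using assms(2) mul_one(2) unfolding left_invariant_section_def by metis
  also have "\<dots> = triv p (section_coords u one)"
    using triv_section_coords[OF assms(1), of one] E_action_triv[of p one "section_coords u one"] by simp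
  finally show ?thesis by (simp add: section_coords_def)
qed

section \<open>The Dorfman bracket in the trivialisation\<close>

definition form2_const :: "('g \<Rightarrow> 'g tvec \<Rightarrow> 'g tvec \<Rightarrow> real) \<Rightarrow> real ^ 'n \<Rightarrow> real ^ 'n \<Rightarrow> real"
  where "form2_const F x y = F one (left_field x one) (left_field y one)"

definition form3_const ::
    "('g \<Rightarrow> 'g tvec \<Rightarrow> 'g tvec \<Rightarrow> 'g tvec \<Rightarrow> real) \<Rightarrow> real ^ 'n \<Rightarrow> real ^ 'n \<Rightarrow> real ^ 'n \<Rightarrow> real"
  where "form3_const H x y z = H one (left_field x one) (left_field y one) (left_field z one)"

lemma form2_frame:
  assumes "left_invariant_two_form A mul F" "v \<in> tangent_space A p" "w \<in> tangent_space A p"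
  shows "F p v w = form2_const F (frame_coords p v) (frame_coords p w)"
proof -
  have "F (mul p one) (differential (mul p) (left_field x one)) (differential (mul p) (left_field y one))
      = form2_const F x y" for x y
    using assms(1) left_field_tangent unfolding left_invariant_two_form_def form2_const_def by blast
  then have "F p (left_field x p) (left_field y p) = form2_const F x y" for x y
    by (simp add: differential_left_field)
  from this[of "frame_coords p v" "frame_coords p w"] show ?thesis
    by (simp add: left_field_frame_coords assms)
qed

lemma form3_frame:
  assumes "left_invariant_three_form A mul H" "v \<in> tangent_space A p" "w \<in> tangent_space A p"
    "z \<in> tangent_space A p"
  shows "H p v w z = form3_const H (frame_coords p v) (frame_coords p w) (frame_coords p z)"
proof -
  have "H (mul p one) (differential (mul p) (left_field x one)) (differential (mul p) (left_field y one))
      (differential (mul p) (left_field z one)) = form3_const H x y z" for x y z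
    using assms(1) left_field_tangent unfolding left_invariant_three_form_def form3_const_def by blast
  then have "H p (left_field x p) (left_field y p) (left_field z p) = form3_const H x y z" for x y z
    by (simp add: differential_left_field)
  from this[of "frame_coords p v" "frame_coords p w" "frame_coords p z"] show ?thesis
    by (simp add: left_field_frame_coords assms)
qed

lemma linear_form2_const: "F \<in> two_forms A \<Longrightarrow> linear (\<lambda>x. form2_const F x y)"
  and linear_form2_const': "F \<in> two_forms A \<Longrightarrow> linear (\<lambda>x. form2_const F y x)"
  and form2_const_alt: "F \<in> two_forms A \<Longrightarrow> form2_const F x x = 0"
  using left_field_tangent[of _ one] linear_left_field[of one]
  by (auto simp: two_forms_def linear_on_def form2_const_def linear_iff)

lemma form2_const_skew: "form2_const F y x = - form2_const F x y" if "F \<in> two_forms A"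
  using form2_const_alt[OF that, of "x + y"] form2_const_alt[OF that, of x] form2_const_alt[OF that, of y]
  by (simp add: linear_add[OF linear_form2_const[OF that]] linear_add[OF linear_form2_const'[OF that]])

lemma linear_form3_const1: "H \<in> three_forms A \<Longrightarrow> linear (\<lambda>x. form3_const H x y z)"
  and linear_form3_const2: "H \<in> three_forms A \<Longrightarrow> linear (\<lambda>x. form3_const H y x z)"
  and linear_form3_const3: "H \<in> three_forms A \<Longrightarrow> linear (\<lambda>x. form3_const H y z x)"
  and form3_const_alt: "H \<in> three_forms A \<Longrightarrow> form3_const H x x y = 0"
    "H \<in> three_forms A \<Longrightarrow> form3_const H y x x = 0"
  using left_field_tangent[of _ one] linear_left_field[of one]
  by (auto simp: three_forms_def linear_on_def form3_const_def linear_iff)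

lemma form3_const_skew:
  assumes "H \<in> three_forms A"
  shows "form3_const H y x z = - form3_const H x y z" "form3_const H x z y = - form3_const H x y z"
  using form3_const_alt(1)[OF assms, of "x + y" z] form3_const_alt(1)[OF assms, of x z]
    form3_const_alt(1)[OF assms, of y z] form3_const_alt(2)[OF assms, of x "y + z"]
    form3_const_alt(2)[OF assms, of x y] form3_const_alt(2)[OF assms, of x z]
  by (simp_all add: linear_add[OF linear_form3_const1[OF assms]] linear_add[OF linear_form3_const2[OF assms]]
      linear_add[OF linear_form3_const3[OF assms]])

text \<open>The value of $\langle [a, b], c \rangle$ on left-invariant sections.\<close>

definition dorfman_const ::
    "('g \<Rightarrow> 'g tvec \<Rightarrow> 'g tvec \<Rightarrow> 'g tvec \<Rightarrow> real) \<Rightarrow> ('g \<Rightarrow> 'g tvec \<Rightarrow> 'g tvec \<Rightarrow> real) \<Rightarrow>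
      'n model \<Rightarrow> 'n model \<Rightarrow> 'n model \<Rightarrow> real"
  where "dorfman_const H F = (\<lambda>(x, \<xi>, l) (y, \<eta>, m) (z, \<zeta>, n).
    (\<xi> \<bullet> lie_const y z + \<eta> \<bullet> lie_const z x + \<zeta> \<bullet> lie_const x y + form3_const H y x z) / 2
    + l * form2_const F y z + m * form2_const F z x + n * form2_const F x y)"

lemma dorfman_const_skew:
  assumes "H \<in> three_forms A" "F \<in> two_forms A"
  shows "dorfman_const H F b a c = - dorfman_const H F a b c"
    "dorfman_const H F a c b = - dorfman_const H F a b c"
proof -
  obtain x \<xi> l y \<eta> m z \<zeta> n where abc: "a = (x, \<xi>, l)" "b = (y, \<eta>, m)" "c = (z, \<zeta>, n)"
    by (metis surj_pair)
  show "dorfman_const H F b a c = - dorfman_const H F a b c"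
    using lie_const_skew[of x z] lie_const_skew[of z y] lie_const_skew[of x y]
      form2_const_skew[OF assms(2), of x z] form2_const_skew[OF assms(2), of z y]
      form2_const_skew[OF assms(2), of x y] form3_const_skew[OF assms(1), of y x z]
    by (simp add: abc dorfman_const_def field_simps)
  show "dorfman_const H F a c b = - dorfman_const H F a b c"
    using lie_const_skew[of y z] lie_const_skew[of y x] lie_const_skew[of x z]
      form2_const_skew[OF assms(2), of y z] form2_const_skew[OF assms(2), of y x]
      form2_const_skew[OF assms(2), of x z] form3_const_skew(1)[OF assms(1), of x z y]
      form3_const_skew(2)[OF assms(1), of x y z] form3_const_skew(1)[OF assms(1), of x y z]
    by (simp add: abc dorfman_const_def field_simps)
qed

lemma linear_dorfman_const:
  assumes "H \<in> three_forms A" "F \<in> two_forms A"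
  shows "linear (\<lambda>a. dorfman_const H F a b c)"
proof -
  note lins = linear_add[OF linear_form3_const2[OF assms(1)]] linear_cmul[OF linear_form3_const2[OF assms(1)]]
    linear_add[OF linear_form2_const[OF assms(2)]] linear_cmul[OF linear_form2_const[OF assms(2)]]
    linear_add[OF linear_form2_const'[OF assms(2)]] linear_cmul[OF linear_form2_const'[OF assms(2)]]
    bilinear_ladd[OF bilinear_lie_const] bilinear_radd[OF bilinear_lie_const]
    bilinear_lmul[OF bilinear_lie_const] bilinear_rmul[OF bilinear_lie_const]
  show ?thesis
    by (rule linearI)
      (simp_all add: dorfman_const_def case_prod_beta lins inner_add_left inner_add_right
        algebra_simps add_divide_distrib)
qed

text \<open>The terms that differentiate \<open>Z\<close> in $(\mathcal{L}_X \eta)(Z)$ and in $d\xi(Y, Z)$ are compensated by the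
  Lie brackets.  Hence the 1-form part of the bracket has a value at each point, and collecting the remaining
  derivatives gives the pairings of the differentiated sections.\<close>

lemma pairing_dorfman:
  assumes F: "F \<in> two_forms A" and Hi: "left_invariant_three_form A mul H"
    and Fi: "left_invariant_two_form A mul F"
    and u: "u \<in> sections A" and v: "v \<in> sections A" and w: "w \<in> sections A"
  defines "a \<equiv> section_coords u" and "b \<equiv> section_coords v" and "c \<equiv> section_coords w"
  shows "pairing (dorfman A H F u v p) (w p)
    = model_pairing (dvec (fst (u p)) b) (c p) - model_pairing (dvec (fst (v p)) a) (c p)
      + model_pairing (dvec (fst (w p)) a) (b p) + dorfman_const H F (a p) (b p) (c p)"
proof -
  have fields: "section_coords s = (\<lambda>q. (frame_coords q (fst (s q)), covec_coords q (fst (snd (s q))), snd (snd (s q))))" for s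
    by (simp add: section_coords_def fibre_coords_def fun_eq_iff)
  have frame: "smooth_vec (\<lambda>q. frame_coords q (fst (s q)))"
    and coframe: "smooth_vec (\<lambda>q. covec_coords q (fst (snd (s q))))" if "s \<in> sections A" for s
    using smooth_vec_linear[OF linear_fst smooth_section_coords[OF that]]
      smooth_vec_linear[OF linear_compose[OF linear_snd linear_fst] smooth_section_coords[OF that]]
    by (simp_all add: fields)
  have dvec_coords: "dvec \<nu> (section_coords s) = (dvec \<nu> (\<lambda>q. frame_coords q (fst (s q))),
      dvec \<nu> (\<lambda>q. covec_coords q (fst (snd (s q)))), \<nu> (scal_part s))"
    if "\<nu> \<in> tangent_space A p" "s \<in> sections A" for \<nu> s
    using dvec_linear[OF that(1) linear_fst smooth_section_coords[OF that(2)]]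
      dvec_linear[OF that(1) linear_compose[OF linear_snd linear_fst] smooth_section_coords[OF that(2)]]
      dvec_linear[OF that(1) linear_compose[OF linear_snd linear_snd] smooth_section_coords[OF that(2)]]
    by (simp add: fields prod_eq_iff dvec_real)
  define x y z where "x = (\<lambda>q. frame_coords q (fst (u q)))" and "y = (\<lambda>q. frame_coords q (fst (v q)))"
    and "z = (\<lambda>q. frame_coords q (fst (w q)))"
  define \<xi> \<eta> \<zeta> where "\<xi> = (\<lambda>q. covec_coords q (fst (snd (u q))))" and "\<eta> = (\<lambda>q. covec_coords q (fst (snd (v q))))"
    and "\<zeta> = (\<lambda>q. covec_coords q (fst (snd (w q))))"
  define l m n where "l = scal_part u" and "m = scal_part v" and "n = scal_part w"
  define X Y where "X = tvec_part u" and "Y = tvec_part v"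
  define \<Phi> where "\<Phi> = (\<lambda>Z q. lie_derivative A X (covec_part v) Z q - ext_deriv1 A (covec_part u) Y Z q
      + 2 * m q * Z q l + H q (Y q) (X q) (Z q) - 2 * (m q * F q (X q) (Z q) - l q * F q (Y q) (Z q)))"
  have X: "X \<in> vector_fields_on A UNIV" and Y: "Y \<in> vector_fields_on A UNIV"
    unfolding X_def Y_def by (rule section_anchor[OF u], rule section_anchor[OF v])
  have Xp: "X q \<in> tangent_space A q" and Yp: "Y q \<in> tangent_space A q" for q
    using X Y by (auto intro: vector_field_tangent)

  \<comment> \<open>Only the value of \<open>Z\<close> at \<open>p\<close> enters: the derivatives of \<open>Z\<close> cancel.\<close>
  define \<Psi> where "\<Psi> \<nu> = dvec (X p) \<eta> \<bullet> frame_coords p \<nu> + \<eta> p \<bullet> dvec \<nu> x - \<eta> p \<bullet> lie_const (x p) (frame_coords p \<nu>)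
      - dvec (Y p) \<xi> \<bullet> frame_coords p \<nu> + dvec \<nu> \<xi> \<bullet> y p + \<xi> p \<bullet> lie_const (y p) (frame_coords p \<nu>)
      + 2 * m p * \<nu> l + form3_const H (y p) (x p) (frame_coords p \<nu>)
      - 2 * (m p * form2_const F (x p) (frame_coords p \<nu>) - l p * form2_const F (y p) (frame_coords p \<nu>))" for \<nu>
  have tensorial: "\<Phi> Z p = \<Psi> (Z p)" if Z: "Z \<in> vector_fields_on A UNIV" for Z
  proof -
    let ?z = "\<lambda>q. frame_coords q (Z q)"
    have Zp: "Z q \<in> tangent_space A q" for q by (rule vector_field_tangent[OF Z UNIV_I])
    have sm: "smooth_vec x" "smooth_vec y" "smooth_vec \<xi>" "smooth_vec \<eta>" "smooth_vec ?z"
      unfolding x_def y_def \<xi>_def \<eta>_def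
      using frame[OF u] frame[OF v] coframe[OF u] coframe[OF v] smooth_vec_frame_coords[OF Z] by auto
    have cov: "fst (snd (s q)) \<nu> = covec_coords q (fst (snd (s q))) \<bullet> frame_coords q \<nu>"
      if "s \<in> sections A" "\<nu> \<in> tangent_space A q" for s q \<nu>
      by (rule cotangent_apply[OF section_covec[OF that(1)] that(2)])
    have \<eta>: "fst (snd (v q)) \<nu> = \<eta> q \<bullet> frame_coords q \<nu>"
      and \<xi>: "fst (snd (u q)) \<nu> = \<xi> q \<bullet> frame_coords q \<nu>"
      if "\<nu> \<in> tangent_space A q" for q \<nu>
      using cov[OF v that] cov[OF u that] by (simp_all add: \<eta>_def \<xi>_def)
    have xX: "frame_coords q (X q) = x q" "frame_coords q (Y q) = y q" for q
      by (simp_all add: x_def y_def X_def Y_def)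
    have 1: "lie_derivative A X (covec_part v) Z p = dvec (X p) \<eta> \<bullet> ?z p + \<eta> p \<bullet> dvec (Z p) x
        - \<eta> p \<bullet> lie_const (x p) (?z p)"
      unfolding lie_derivative_def \<eta>[OF Zp] \<eta>[OF left_field_tangent]
        tangent_vec_inner[OF Xp sm(4,5)] lie_bracket_frame[OF X Z] frame_coords_left_field xX
      by (simp add: inner_diff_right inner_add_right)
    have 2: "ext_deriv1 A (covec_part u) Y Z p = dvec (Y p) \<xi> \<bullet> ?z p - dvec (Z p) \<xi> \<bullet> y p
        - \<xi> p \<bullet> lie_const (y p) (?z p)"
      unfolding ext_deriv1_def \<xi>[OF Zp] \<xi>[OF Yp] \<xi>[OF left_field_tangent] xX
        tangent_vec_inner[OF Yp sm(3,5)] tangent_vec_inner[OF Zp sm(3,2)] lie_bracket_frame[OF Y Z]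
        frame_coords_left_field
      by (simp add: inner_diff_right inner_add_right)
    show ?thesis
      unfolding \<Phi>_def \<Psi>_def 1 2
      using form3_frame[OF Hi Yp Xp Zp, of p] form2_frame[OF Fi Xp Zp, of p] form2_frame[OF Fi Yp Zp, of p]
      by (simp add: x_def y_def X_def Y_def)
  qed
  have Z: "tvec_part w \<in> vector_fields_on A UNIV" and Zp: "fst (w p) \<in> tangent_space A p"
    using section_anchor[OF w] section_anchor_tangent[OF w] by auto
  have "value_at (vector_fields_on A UNIV) \<Phi> p (fst (w p)) = \<Psi> (fst (w p))"
    unfolding value_at_def using tensorial Z by (intro the_equality) auto
  then have one_form: "one_form_of A \<Phi> p (fst (w p)) = \<Psi> (fst (w p))"
    using Zp by (simp add: one_form_of_def)
  have bracket: "fst (snd (w p)) (lie_bracket A X Y p)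
      = \<zeta> p \<bullet> (dvec (X p) y - dvec (Y p) x + lie_const (x p) (y p))"
    using cotangent_apply[OF section_covec[OF w] left_field_tangent]
    unfolding lie_bracket_frame[OF X Y] by (simp add: \<zeta>_def x_def y_def X_def Y_def)
  have "dorfman A H F u v p = (lie_bracket A X Y p, one_form_of A \<Phi> p, X p m - Y p l + F p (X p) (Y p))"
    by (simp add: dorfman_def Let_def \<Phi>_def X_def Y_def l_def m_def)
  then have "pairing (dorfman A H F u v p) (w p) = (\<Psi> (fst (w p)) + fst (snd (w p)) (lie_bracket A X Y p)) / 2
      + (X p m - Y p l + F p (X p) (Y p)) * n p"
    by (simp add: pairing_def case_prod_beta one_form n_def)
  also have "F p (X p) (Y p) = form2_const F (x p) (y p)"
    using form2_frame[OF Fi Xp Yp, of p] by (simp add: x_def y_def X_def Y_def)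
  finally have lhs: "pairing (dorfman A H F u v p) (w p)
      = (\<Psi> (fst (w p)) + \<zeta> p \<bullet> (dvec (X p) y - dvec (Y p) x + lie_const (x p) (y p))) / 2
      + (X p m - Y p l + form2_const F (x p) (y p)) * n p"
    by (simp add: bracket)
  have abc: "a p = (x p, \<xi> p, l p)" "b p = (y p, \<eta> p, m p)" "c p = (z p, \<zeta> p, n p)"
    by (simp_all add: a_def b_def c_def fields x_def y_def z_def \<xi>_def \<eta>_def \<zeta>_def l_def m_def n_def)
  have d: "dvec \<nu> a = (dvec \<nu> x, dvec \<nu> \<xi>, \<nu> l)" "dvec \<nu> b = (dvec \<nu> y, dvec \<nu> \<eta>, \<nu> m)"
    if "\<nu> \<in> tangent_space A p" for \<nu>
    unfolding a_def b_def x_def y_def \<xi>_def \<eta>_def l_def m_def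
    using dvec_coords[OF that u] dvec_coords[OF that v] by auto
  have Wp: "fst (w p) \<in> tangent_space A p" and z: "frame_coords p (fst (w p)) = z p"
    by (rule section_anchor_tangent[OF w], simp add: z_def)
  have "lie_const (z p) (x p) = - lie_const (x p) (z p)" by (rule lie_const_skew)
  moreover have "form2_const F (z p) (x p) = - form2_const F (x p) (z p)"
    by (rule form2_const_skew[OF F])
  ultimately show ?thesis
    unfolding lhs \<Psi>_def z abc X_def[symmetric, THEN fun_cong] Y_def[symmetric, THEN fun_cong]
      d[OF Xp] d[OF Yp] d[OF Wp]
    by (simp add: model_pairing_def dorfman_const_def inner_diff_right inner_add_right field_simps)
qed

section \<open>Connections with constant coefficients\<close>

text \<open>The flat connection of the trivialisation, plus constant coefficients.\<close>

definition triv_connection :: "('n model \<Rightarrow> 'n model \<Rightarrow> 'n model) \<Rightarrow>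
    'g E_section \<Rightarrow> 'g E_section \<Rightarrow> 'g E_section"
  where "triv_connection \<Gamma> u v = (\<lambda>p. triv p
    (dvec (fst (u p)) (section_coords v) + \<Gamma> (section_coords u p) (section_coords v p)))"

lemma section_coords_add: "section_coords (u + v) p = section_coords u p + section_coords v p"
  and section_coords_scaleR: "section_coords (r *\<^sub>R u) p = r *\<^sub>R section_coords u p"
  and section_coords_fun_scale: "section_coords (fun_scale f u) p = f p *\<^sub>R section_coords u p"
  by (simp_all add: section_coords_def linear_add[OF linear_fibre_coords]
      linear_cmul[OF linear_fibre_coords] scaleR_fun_def fun_scale_def)

lemma anchor_derivative_model_pairing:
  assumes "v \<in> tangent_space A p" "smooth_vec a" "smooth_vec b"
  shows "v (\<lambda>q. model_pairing (a q) (b q)) = model_pairing (dvec v a) (b p) + model_pairing (a p) (dvec v b)"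
  using dvec_bilinear[OF assms(1) bilinear_model_pairing assms(2,3)] by (simp add: dvec_real)

lemma generalized_connection_triv:
  assumes \<Gamma>: "bilinear \<Gamma>"
    and metric: "\<And>a b c. model_pairing (\<Gamma> a b) c = - model_pairing b (\<Gamma> a c)"
  shows "generalized_connection A (triv_connection \<Gamma>)"
  unfolding generalized_connection_def
proof (intro conjI ballI allI impI)
  fix u v assume u: "u \<in> sections A" and v: "v \<in> sections A"
  note up = section_anchor_tangent[OF u] and sv = smooth_section_coords[OF v]
  show "triv_connection \<Gamma> u v \<in> sections A"
    unfolding triv_connection_def
    by (intro triv_in_sections smooth_vec_add smooth_vec_dvec[OF section_anchor[OF u] sv]
        smooth_vec_bilinear[OF \<Gamma> smooth_section_coords[OF u] sv])
  show "triv_connection \<Gamma> (u + u') v = triv_connection \<Gamma> u v + triv_connection \<Gamma> u' v" for u'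
    by (simp add: fun_eq_iff triv_connection_def section_coords_add bilinear_ladd[OF \<Gamma>]
        linear_add[OF linear_dvec] flip: linear_add[OF linear_triv]) (simp add: algebra_simps)
  show "triv_connection \<Gamma> (fun_scale f u) v = fun_scale f (triv_connection \<Gamma> u v)" for f
    unfolding triv_connection_def section_coords_fun_scale
    by (simp add: fun_scale_def bilinear_lmul[OF \<Gamma>]
        linear_cmul[OF linear_dvec] scaleR_add_right flip: linear_cmul[OF linear_triv])
  show "triv_connection \<Gamma> u (fun_scale f v)
      = fun_scale (anchor_apply u f) v + fun_scale f (triv_connection \<Gamma> u v)"
    if f: "smooth_fun A f" for f
  proof
    fix p
    have "dvec (fst (u p)) (section_coords (fun_scale f v))
        = fst (u p) f *\<^sub>R section_coords v p + f p *\<^sub>R dvec (fst (u p)) (section_coords v)"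
      using dvec_scaleR[OF up f sv, of p] by (simp add: section_coords_fun_scale[abs_def])
    then show "triv_connection \<Gamma> u (fun_scale f v) p
        = (fun_scale (anchor_apply u f) v + fun_scale f (triv_connection \<Gamma> u v)) p"
      unfolding triv_connection_def section_coords_fun_scale
      by (simp add: bilinear_rmul[OF \<Gamma>] fun_scale_def anchor_apply_def linear_add[OF linear_triv] linear_cmul[OF linear_triv]
          triv_section_coords[OF v] scaleR_add_right)
  qed
  fix w p assume w: "w \<in> sections A"
  have "pairing (v q) (w q) = model_pairing (section_coords v q) (section_coords w q)" for q
    using pairing_triv[of q "section_coords v q" "section_coords w q"]
    by (simp add: triv_section_coords v w)
  then have "anchor_apply u (\<lambda>q. pairing (v q) (w q)) p
      = model_pairing (dvec (fst (u p)) (section_coords v)) (section_coords w p)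
        + model_pairing (section_coords v p) (dvec (fst (u p)) (section_coords w))"
    by (simp add: anchor_apply_def anchor_derivative_model_pairing[OF up sv smooth_section_coords[OF w]])
  also have "\<dots> = model_pairing (section_coords (triv_connection \<Gamma> u v) p) (section_coords w p)
      + model_pairing (section_coords v p) (section_coords (triv_connection \<Gamma> u w) p)"
    unfolding triv_connection_def section_coords_of_triv
    by (simp add: bilinear_ladd[OF bilinear_model_pairing] bilinear_radd[OF bilinear_model_pairing] metric)
  also have "\<dots> = pairing (triv_connection \<Gamma> u v p) (triv p (section_coords w p))
      + pairing (triv p (section_coords v p)) (triv_connection \<Gamma> u w p)"
    by (simp add: triv_connection_def pairing_triv)
  finally show "anchor_apply u (\<lambda>q. pairing (v q) (w q)) p
      = pairing (triv_connection \<Gamma> u v p) (w p) + pairing (v p) (triv_connection \<Gamma> u w p)"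
    by (simp add: triv_section_coords v w)
next
  fix u assume u: "u \<in> sections A"
  show "linear_on (sections A) (triv_connection \<Gamma> u)"
    unfolding linear_on_def
  proof (intro conjI ballI allI; rule ext)
    note up = section_anchor_tangent[OF u] and sm = smooth_section_coords
    show "triv_connection \<Gamma> u (v + w) p = (triv_connection \<Gamma> u v + triv_connection \<Gamma> u w) p"
      if "v \<in> sections A" "w \<in> sections A" for v w p
      using dvec_add[OF up sm[OF that(1)] sm[OF that(2)], of p]
      by (simp add: triv_connection_def section_coords_add section_coords_add[abs_def] bilinear_radd[OF \<Gamma>]
          flip: linear_add[OF linear_triv]) (simp add: algebra_simps)
    show "triv_connection \<Gamma> u (r *\<^sub>R v) p = (r *\<^sub>R triv_connection \<Gamma> u v) p"
      if "v \<in> sections A" for v r p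
    proof -
      have "dvec (fst (u p)) (section_coords (r *\<^sub>R v)) = r *\<^sub>R dvec (fst (u p)) (section_coords v)"
        using dvec_scaleR[OF up smooth_fun_on_const sm[OF that], of p r]
        by (simp add: section_coords_scaleR[abs_def] tangent_vec_const[OF up])
      then show ?thesis
        unfolding triv_connection_def section_coords_scaleR
        by (simp only: scaleR_fun_def bilinear_rmul[OF \<Gamma>] linear_cmul[OF linear_triv, symmetric]
            scaleR_add_right)
    qed
  qed
qed

lemma pairing_diff_left:
  assumes "e \<in> E_fibre A p" "fst x \<in> tangent_space A p" "fst y \<in> tangent_space A p"
  shows "pairing (x - y) e = pairing x e - pairing y e"
proof -
  have "fst (snd e) (fst x - fst y) = fst (snd e) (fst x) - fst (snd e) (fst y)"
    using assms subspace_diff[OF subspace_tangent_space]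
    by (simp add: E_fibre_def mem_Times_iff cotangent_apply[of _ p] linear_diff[OF linear_frame_coords]
        inner_diff_right)
  note this [simp]
  show ?thesis by (simp add: pairing_def case_prod_beta field_simps)
qed

text \<open>The flat part contributes exactly the derivative terms of the bracket, so only the condition on
  \<open>\<Gamma>\<close> remains.\<close>

lemma torsion_triv_connection:
  assumes "F \<in> two_forms A" "left_invariant_three_form A mul H" "left_invariant_two_form A mul F"
    and \<Gamma>: "bilinear \<Gamma>"
    and metric: "\<And>a b c. model_pairing (\<Gamma> a b) c = - model_pairing b (\<Gamma> a c)"
    and cyclic: "\<And>a b c. model_pairing (\<Gamma> a b) c + model_pairing (\<Gamma> b c) a + model_pairing (\<Gamma> c a) b
      = dorfman_const H F a b c"
    and u: "u \<in> sections A" and v: "v \<in> sections A" and w: "w \<in> sections A"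
  shows "torsion A H F (triv_connection \<Gamma>) u v w p = 0"
proof -
  let ?D = "triv_connection \<Gamma>" and ?g = model_pairing
  let ?a = "section_coords u" and ?b = "section_coords v" and ?c = "section_coords w"
  note g = bilinear_ladd[OF bilinear_model_pairing] bilinear_radd[OF bilinear_model_pairing]
  have T: "fst (?D s t p) \<in> tangent_space A p" for s t
    using triv_in_fibre by (simp add: triv_connection_def triv_def left_field_tangent)
  have dT: "fst (dorfman A H F u v p) \<in> tangent_space A p"
    using lie_bracket_tangent[OF section_anchor[OF u] section_anchor[OF v]]
    by (simp add: dorfman_def Let_def)
  have D: "pairing (?D s t p) (r p) = ?g (dvec (fst (s p)) (section_coords t)) (section_coords r p)
      + ?g (\<Gamma> (section_coords s p) (section_coords t p)) (section_coords r p)"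
    if "r \<in> sections A" for s t r
    by (subst triv_section_coords[OF that, symmetric]) (simp add: triv_connection_def pairing_triv g)
  have D': "pairing (r p) (?D s t p) = pairing (?D s t p) (r p)" for r s t
    by (simp add: pairing_def case_prod_beta algebra_simps)
  have "torsion A H F ?D u v w p = pairing (?D u v p) (w p) - pairing (?D v u p) (w p)
      - pairing (dorfman A H F u v p) (w p) + pairing (v p) (?D w u p)"
    unfolding torsion_def
    using section_in_fibre[OF w] T dT subspace_diff[OF subspace_tangent_space T T]
    by (simp add: pairing_diff_left[of _ p])
  also have "\<dots> = ?g (\<Gamma> (?a p) (?b p)) (?c p) - ?g (\<Gamma> (?b p) (?a p)) (?c p)
      + ?g (\<Gamma> (?c p) (?a p)) (?b p) - dorfman_const H F (?a p) (?b p) (?c p)"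
    unfolding D' D[OF w] D[OF v] pairing_dorfman[OF assms(1-3) u v w] by simp
  also have "\<dots> = 0"
    using cyclic[of "?a p" "?b p" "?c p"] metric[of "?b p" "?a p" "?c p"]
      model_pairing_sym[of "?a p" "\<Gamma> (?b p) (?c p)"] by simp
  finally show ?thesis .
qed

lemma left_invariant_triv_connection: "left_invariant_connection A mul (triv_connection \<Gamma>)"
  unfolding left_invariant_connection_def
proof (intro ballI impI, elim conjE)
  fix u v assume u: "u \<in> sections A" "left_invariant_section mul u"
    and v: "v \<in> sections A" "left_invariant_section mul v"
  have const: "section_coords v = (\<lambda>_. section_coords v one)"
    using left_invariant_section_coords[OF v] by (simp add: fun_eq_iff)
  have "dvec (fst (u p)) (section_coords v) = 0" for p
    by (subst const) (rule dvec_const[OF section_anchor_tangent[OF u(1)]])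
  then have "triv_connection \<Gamma> u v = (\<lambda>p. triv p (\<Gamma> (section_coords u one) (section_coords v one)))"
    unfolding triv_connection_def
    by (intro ext) (metis left_invariant_section_coords[OF u] left_invariant_section_coords[OF v] add_0)
  then show "left_invariant_section mul (triv_connection \<Gamma> u v)"
    by (simp add: left_invariant_triv_const)
qed

section \<open>The divergence\<close>

definition frame_section :: "'n model \<Rightarrow> 'g E_section"
  where "frame_section a = (\<lambda>p. triv p a)"

lemma frame_section_in_sections: "frame_section a \<in> sections A"
  unfolding frame_section_def by (intro triv_in_sections smooth_vec_const)

text \<open>The Leibniz rule determines a divergence operator by its values on the frame sections.\<close>

lemma divergence_frame_expand:
  assumes \<delta>: "divergence_operator A \<delta>" and u: "u \<in> sections A"
  shows "\<delta> u p = (\<Sum>i\<in>Basis. left_field (fst i) p (\<lambda>q. section_coords u q \<bullet> i)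
    + (section_coords u p \<bullet> i) * \<delta> (frame_section i) p)"
proof -
  let ?a = "\<lambda>i q. section_coords u q \<bullet> i"
  have a: "smooth_fun A (?a i)" for i by (rule smooth_vecD[OF smooth_section_coords[OF u]])
  have scale_in: "fun_scale (?a i) (frame_section i) \<in> sections A" for i
  proof -
    have "fun_scale (?a i) (frame_section i) = (\<lambda>p. triv p (?a i p *\<^sub>R i))"
      by (simp add: fun_scale_def frame_section_def linear_cmul[OF linear_triv])
    then show ?thesis using triv_in_sections[OF smooth_vec_scaleR[OF a smooth_vec_const]] by simp
  qed
  have sum_in: "(\<Sum>i\<in>I. fun_scale (?a i) (frame_section i)) \<in> sections A" for I
  proof -
    have "(\<Sum>i\<in>I. fun_scale (?a i) (frame_section i)) = (\<lambda>p. triv p (\<Sum>i\<in>I. ?a i p *\<^sub>R i))"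
      by (simp add: fun_eq_iff sum_fun_apply fun_scale_def frame_section_def linear_cmul[OF linear_triv]
          linear_sum[OF linear_triv])
    then show ?thesis
      using triv_in_sections[OF smooth_vec_sum[OF smooth_vec_scaleR[OF a smooth_vec_const]]] by simp
  qed
  have zero: "\<delta> 0 = 0"
  proof -
    have "0 \<in> sections A" using sum_in[of "{}"] by simp
    then have "\<delta> (0 + 0) = \<delta> 0 + \<delta> 0"
      using \<delta> unfolding divergence_operator_def by blast
    then show ?thesis by simp
  qed
  have sum: "\<delta> (\<Sum>i\<in>I. fun_scale (?a i) (frame_section i))
      = (\<Sum>i\<in>I. \<delta> (fun_scale (?a i) (frame_section i)))" if "finite I" for I
    using that
  proof (induction I rule: finite_induct)
    case (insert i I)
    have "\<delta> (fun_scale (?a i) (frame_section i) + (\<Sum>i\<in>I. fun_scale (?a i) (frame_section i)))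
        = \<delta> (fun_scale (?a i) (frame_section i)) + \<delta> (\<Sum>i\<in>I. fun_scale (?a i) (frame_section i))"
      using \<delta> scale_in[of i] sum_in[of I] unfolding divergence_operator_def by blast
    then show ?case
      by (simp only: sum.insert[OF insert.hyps] insert.IH)
  qed (simp only: sum.empty zero)
  have "u = (\<Sum>i\<in>Basis. fun_scale (?a i) (frame_section i))"
  proof
    fix p
    have "u p = triv p (\<Sum>i\<in>Basis. (section_coords u p \<bullet> i) *\<^sub>R i)"
      by (simp only: euclidean_representation triv_section_coords[OF u])
    then show "u p = (\<Sum>i\<in>Basis. fun_scale (?a i) (frame_section i)) p"
      by (simp only: sum_fun_apply fun_scale_def frame_section_def linear_cmul[OF linear_triv]
          linear_sum[OF linear_triv])
  qed
  then have "\<delta> u p = \<delta> (\<Sum>i\<in>Basis. fun_scale (?a i) (frame_section i)) p" by simp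
  also have "\<dots> = (\<Sum>i\<in>Basis. \<delta> (fun_scale (?a i) (frame_section i)) p)"
    by (simp add: sum sum_fun_apply)
  also have "\<dots> = (\<Sum>i\<in>Basis. left_field (fst i) p (?a i) + ?a i p * \<delta> (frame_section i) p)"
  proof (rule sum.cong[OF refl])
    fix i
    have "\<delta> (fun_scale (?a i) (frame_section i)) = anchor_apply (frame_section i) (?a i) + ?a i * \<delta> (frame_section i)"
      using \<delta> a frame_section_in_sections unfolding divergence_operator_def by blast
    then show "\<delta> (fun_scale (?a i) (frame_section i)) p
        = left_field (fst i) p (?a i) + ?a i p * \<delta> (frame_section i) p"
      by (simp add: anchor_apply_def frame_section_def triv_def)
  qed
  finally show ?thesis .
qed

text \<open>The derivative of \<open>u\<close> along the frame contributes the same terms as to any divergence operator.\<close>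

lemma connection_divergence_triv:
  assumes \<Gamma>: "bilinear \<Gamma>" and u: "u \<in> sections A"
  shows "connection_divergence A (triv_connection \<Gamma>) u p
    = (\<Sum>i\<in>Basis. left_field (fst i) p (\<lambda>q. section_coords u q \<bullet> i))
      + lin_trace (\<lambda>a. \<Gamma> a (section_coords u p))"
proof -
  define L where "L a = dvec (left_field (fst a) p) (section_coords u) + \<Gamma> a (section_coords u p)" for a
  have L: "linear L"
    by (rule linearI) (simp_all add: L_def linear_add[OF linear_left_field] linear_cmul[OF linear_left_field]
        linear_add[OF linear_dvec] linear_cmul[OF linear_dvec] bilinear_ladd[OF \<Gamma>] bilinear_lmul[OF \<Gamma>]
        scaleR_add_right)
  have val: "value_at (sections A) (\<lambda>v. triv_connection \<Gamma> v u) p (triv p a) = triv p (L a)" for a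
    unfolding value_at_def
  proof (rule the_equality)
    have *: "triv_connection \<Gamma> s u p = triv p (L a)" if "s p = triv p a" for s
      by (simp add: triv_connection_def L_def section_coords_def that) (simp add: triv_def)
    then show "\<forall>s\<in>sections A. s p = triv p a \<longrightarrow> triv_connection \<Gamma> s u p = triv p (L a)"
      by blast
    show "r = triv p (L a)" if "\<forall>s\<in>sections A. s p = triv p a \<longrightarrow> triv_connection \<Gamma> s u p = r" for r
      using that * frame_section_in_sections[of a] unfolding frame_section_def by metis
  qed
  have "connection_divergence A (triv_connection \<Gamma>) u p = lin_trace L"
    unfolding connection_divergence_def E_fibre_eq
    by (rule trace_on_range[OF linear_triv inj_triv L val])
  also have "\<dots> = lin_trace (\<lambda>a. dvec (left_field (fst a) p) (section_coords u)) + lin_trace (\<lambda>a. \<Gamma> a (section_coords u p))"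
    unfolding L_def by (rule lin_trace_add)
  also have "lin_trace (\<lambda>a. dvec (left_field (fst a) p) (section_coords u))
      = (\<Sum>i\<in>Basis. left_field (fst i) p (\<lambda>q. section_coords u q \<bullet> i))"
    by (simp add: lin_trace_def dvec_inner[OF left_field_tangent smooth_section_coords[OF u]])
  finally show ?thesis .
qed

section \<open>Left-invariant generalized metrics\<close>

text \<open>Translations preserve coordinates and are invertible, so all fibres have the same image in the model.\<close>

lemma left_invariant_subbundle_iff:
  assumes inv: "left_invariant_subbundle mul E'" and fib: "\<And>p. E' p \<subseteq> E_fibre A p"
  shows "triv p a \<in> E' p \<longleftrightarrow> a \<in> fibre_coords one ` E' one"
proof -
  have move: "triv (mul x q) a \<in> E' (mul x q)" if "triv q a \<in> E' q" for x q
    using inv that unfolding left_invariant_subbundle_def by (metis E_action_triv image_subset_iff)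
  have "triv p a \<in> E' p \<longleftrightarrow> triv one a \<in> E' one"
    using move[of p "ginv p"] move[of one p] by auto
  also have "\<dots> \<longleftrightarrow> a \<in> fibre_coords one ` E' one"
  proof
    show "a \<in> fibre_coords one ` E' one" if "triv one a \<in> E' one"
      by (rule image_eqI[OF _ that]) simp
    show "triv one a \<in> E' one" if a: "a \<in> fibre_coords one ` E' one"
    proof -
      obtain e where "e \<in> E' one" "a = fibre_coords one e" using a by blast
      then show ?thesis using triv_fibre_coords[of e one] fib[of one] by auto
    qed
  qed
  finally show ?thesis .
qed

text \<open>The dimension comes from the anchor: it identifies the fibre of \<open>Em\<close> at the identity with the tangent
  space.\<close>

lemma generalized_metric_model:
  assumes gm: "generalized_metric A Em" and inv: "left_invariant_subbundle mul Em"
  defines "W \<equiv> fibre_coords one ` Em one"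
  shows "subspace W" "dim W = CARD('n)"
    "\<And>a. a \<in> W \<Longrightarrow> (\<And>b. b \<in> W \<Longrightarrow> model_pairing a b = 0) \<Longrightarrow> a = 0"
    "\<And>p a. triv p a \<in> Em p \<longleftrightarrow> a \<in> W"
proof -
  have sub: "subspace (Em p)" and fib: "Em p \<subseteq> E_fibre A p" for p
    using gm by (auto simp: generalized_metric_def subbundle_def)
  show W: "subspace W"
    unfolding W_def by (rule linear_subspace_image[OF linear_fibre_coords sub])
  show mem: "triv p a \<in> Em p \<longleftrightarrow> a \<in> W" for p a
    unfolding W_def by (rule left_invariant_subbundle_iff[OF inv fib])
  have Em_one: "Em one = triv one ` W"
    using fib triv_fibre_coords unfolding W_def by (force simp: image_image)
  show "a = 0" if "a \<in> W" "\<And>b. b \<in> W \<Longrightarrow> model_pairing a b = 0" for a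
  proof -
    have "triv one a = 0"
    proof -
      have "pairing (triv one a) e = 0" if "e \<in> Em one" for e
        using that \<open>\<And>b. b \<in> W \<Longrightarrow> model_pairing a b = 0\<close> by (auto simp: Em_one pairing_triv)
      moreover have "triv one a \<in> Em one" using \<open>a \<in> W\<close> mem by blast
      ultimately show ?thesis using gm unfolding generalized_metric_def by blast
    qed
    then have "fibre_coords one (triv one a) = fibre_coords one 0" by simp
    then show ?thesis using linear_0[OF linear_fibre_coords] by simp
  qed
  have bij: "bij_betw fst (Em one) (tangent_space A one)"
    using gm by (auto simp: generalized_metric_def)
  have inj: "inj_on fst W"
  proof (rule inj_onI)
    fix a b assume "a \<in> W" "b \<in> W" "fst a = fst b"
    then have "fst (triv one a) = fst (triv one b)" "triv one a \<in> Em one" "triv one b \<in> Em one"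
      unfolding mem by (simp_all add: triv_def)
    then have "triv one a = triv one b"
      using bij by (auto simp: bij_betw_def inj_on_def)
    then show "a = b" by (metis fibre_coords_triv)
  qed
  have surj: "fst ` W = UNIV"
  proof (intro set_eqI iffI UNIV_I)
    fix x :: "real ^ 'n"
    obtain e where "e \<in> Em one" "fst e = left_field x one"
      using bij left_field_tangent[of x one] by (metis bij_betw_def imageE)
    then show "x \<in> fst ` W"
      unfolding W_def by (force simp: fibre_coords_def)
  qed
  have "dim (fst ` W) = dim W"
    by (rule dim_image_eq[OF linear_fst]) (simp add: inj span_eq_iff[THEN iffD2, OF W])
  then show "dim W = CARD('n)" by (simp add: surj)
qed

text \<open>The derivative of a function with values in \<open>W\<close> again has values in \<open>W\<close>, since it is annihilated by
  every linear form that vanishes on \<open>W\<close>.\<close>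

lemma triv_connection_preserves:
  assumes \<Gamma>: "\<And>a b. b \<in> W \<Longrightarrow> \<Gamma> a b \<in> W" and W: "subspace W"
    and u: "u \<in> sections A" and v: "v \<in> sections A" and v_W: "\<And>p. section_coords v p \<in> W"
  shows "section_coords (triv_connection \<Gamma> u v) p \<in> W"
proof -
  have "dvec (fst (u p)) (section_coords v) \<in> W"
  proof (rule orthogonal_to_complement_imp_mem[OF W])
    fix y assume "\<And>w. w \<in> W \<Longrightarrow> w \<bullet> y = 0"
    then have "(\<lambda>q. section_coords v q \<bullet> y) = (\<lambda>_. 0)" using v_W by (simp add: fun_eq_iff)
    then show "dvec (fst (u p)) (section_coords v) \<bullet> y = 0"
      by (simp add: dvec_inner[OF section_anchor_tangent[OF u] smooth_section_coords[OF v]]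
          tangent_vec_const[OF section_anchor_tangent[OF u]])
  qed
  then show ?thesis
    unfolding triv_connection_def section_coords_of_triv by (intro subspace_add W \<Gamma> v_W)
qed

end

section \<open>Existence of the connection\<close>

theorem theorem8:
  fixes A :: "('g::{t2_space, second_countable_topology}, 'n::finite) chart set"
    and mul :: "'g \<Rightarrow> 'g \<Rightarrow> 'g" and one :: 'g and ginv :: "'g \<Rightarrow> 'g"
    and H :: "'g \<Rightarrow> 'g tvec \<Rightarrow> 'g tvec \<Rightarrow> 'g tvec \<Rightarrow> real"
    and F :: "'g \<Rightarrow> 'g tvec \<Rightarrow> 'g tvec \<Rightarrow> real"
    and Em :: "'g \<Rightarrow> 'g E_elem set"
    and \<delta> :: "'g E_section \<Rightarrow> 'g \<Rightarrow> real"
  assumes "lie_group A mul one ginv"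
    and "CARD('n) \<ge> 2"
    and "H \<in> three_forms A" and "left_invariant_three_form A mul H"
    and "F \<in> two_forms A" and "left_invariant_two_form A mul F"
    and "Bn_integrable A H F"
    and "generalized_metric A Em" and "left_invariant_subbundle mul Em"
    and "divergence_operator A \<delta>" and "left_invariant_divergence A mul \<delta>"
  shows "\<exists>D. generalized_connection A D \<and> levi_civita A H F Em D \<and>
    left_invariant_connection A mul D \<and>
    (\<forall>u\<in>sections A. \<forall>p. connection_divergence A D u p = \<delta> u p)"
proof -
  interpret lie_group A mul one ginv by (rule assms(1))
  define W where "W = fibre_coords one ` Em one"
  note W = generalized_metric_model[OF assms(8,9), folded W_def]
  \<comment> \<open>By left-invariance the values of \<open>\<delta>\<close> on the frame sections may be taken at the identity.\<close>
  define c where "c a = (\<Sum>i\<in>Basis. (a \<bullet> i) * \<delta> (frame_section i) one)" for a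
  have c: "linear c"
    by (rule linearI) (simp_all add: c_def inner_add_left distrib_right sum.distrib sum_distrib_left
        mult.assoc)
  have \<delta>_const: "\<delta> (frame_section a) p = \<delta> (frame_section a) one" for a p
    using assms(11) frame_section_in_sections[of a] left_invariant_triv_const[of a]
    unfolding left_invariant_divergence_def frame_section_def by metis
  have dims: "dim W \<noteq> 1" "dim W + 1 \<noteq> DIM('n model)"
    using assms(2) by (simp_all add: W(2))
  obtain \<Gamma> where \<Gamma>: "bilinear \<Gamma>"
    and metric: "\<And>a b c. model_pairing (\<Gamma> a b) c = - model_pairing b (\<Gamma> a c)"
    and cyclic: "\<And>x y z. model_pairing (\<Gamma> x y) z + model_pairing (\<Gamma> y z) x + model_pairing (\<Gamma> z x) y
      = dorfman_const H F x y z"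
    and \<Gamma>_W: "\<And>a b. b \<in> W \<Longrightarrow> \<Gamma> a b \<in> W"
    and tr: "\<And>b. lin_trace (\<lambda>a. \<Gamma> a b) = c b"
  proof (rule exists_connection_coefficients[of model_pairing "dorfman_const H F" c W])
    show "a = 0" if "\<And>b. model_pairing a b = 0" for a :: "'n model"
      by (rule model_pairing_nondegenerate[OF that])
    show "a = 0" if "a \<in> W" "\<And>b. b \<in> W \<Longrightarrow> model_pairing a b = 0" for a
      by (rule W(3)[OF that])
  qed (rule bilinear_model_pairing model_pairing_sym linear_dorfman_const[OF assms(3,5)]
      dorfman_const_skew[OF assms(3,5)] c W(1) dims that | assumption)+
  let ?D = "triv_connection \<Gamma>"
  have connection: "generalized_connection A ?D"
    by (rule generalized_connection_triv[OF \<Gamma> metric])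
  have levi_civita: "levi_civita A H F Em ?D"
    unfolding levi_civita_def
  proof (intro conjI ballI allI impI)
    show "torsion A H F ?D u v w p = 0"
      if "u \<in> sections A" "v \<in> sections A" "w \<in> sections A" for u v w p
      by (rule torsion_triv_connection[OF assms(5,4,6) \<Gamma> metric cyclic that])
    fix u v p assume u: "u \<in> sections A" and v: "v \<in> sections A" and v_Em: "\<forall>p. v p \<in> Em p"
    have v_W: "section_coords v q \<in> W" for q
      using v_Em W(4)[of q "section_coords v q"] triv_section_coords[OF v, of q] by simp
    have "section_coords (?D u v) p \<in> W"
      by (rule triv_connection_preserves[OF \<Gamma>_W W(1) u v v_W])
    then show "?D u v p \<in> Em p"
      using W(4) by (simp add: triv_connection_def)
  qed
  have divergence: "connection_divergence A ?D u p = \<delta> u p" if u: "u \<in> sections A" for u p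
    unfolding connection_divergence_triv[OF \<Gamma> u] divergence_frame_expand[OF assms(10) u] tr c_def
    by (simp add: sum.distrib \<delta>_const[of _ p])
  show ?thesis
    by (intro exI[of _ ?D] conjI ballI allI connection levi_civita left_invariant_triv_connection
        divergence)
qed

end
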